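(* Let $G$ be an infinite finitely generated amenable group with $\alpha^*(G)=\frac{1}{2\beta^*(G)}$. Then $$\alpha^*(G\wr \mathbb{Z})=\frac{1}{2\beta^*(G\wr \mathbb{Z})}=\frac{2\alpha^*(G)}{2\alpha^*(G)+1}.$$ In particular, if one defines iteratively $G_{(1)}=G$ and $G_{(k+1)}=G_{(k)}\wr \mathbb{Z}$, then for all $k\ge 1$, $$\alpha^*(G_{(k)})=\frac{2^{k-1}\alpha^*(G)}{(2^k-2)\alpha^*(G)+1}.$$
   Context: For a finitely generated group $G$ with left-invariant word metric $d_G$ (induced by a finite symmetric generating set), the Hilbert compression exponent $\alpha^*(G)$ is the supremum of all $\alpha\ge 0$ for which there exist a Lipschitz map $f:G\to L_2$ and $c>0$ with $\|f(x)-f(y)\|_2\ge c\,d_G(x,y)^\alpha$ for all distinct $x,y\in G$. It does not depend on the generating set. $\beta^*(G)$ is the supremum of all $\beta\ge 0$ for which there exist a finite symmetric generating set $S$ of $G$ and $c>0$ such that $\mathbb{E}[d_G(W_t,e)]\ge c\,t^\beta$ for all $t\in\mathbb{N}$, where $\{W_t\}_{t\ge0}$ is the simple random walk on the Cayley graph of $G$ determined by $S$ started at the identity $e$, and $d_G$ is the word metric of $S$. The wreath product $G\wr H$ is the group of all pairs $(f,x)$ with $f:H\to G$ finitely supported and $x\in H$, with product $(f,x)(g,y)=(z\mapsto f(z)g(x^{-1}z),\,xy)$. *)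

theory Defs
  imports
    "HOL-Probability.Probability"
    "HOL-Algebra.Algebra"
begin

definition sym_gen_set :: "('a, 'b) monoid_scheme \<Rightarrow> 'a set \<Rightarrow> bool" where
  "sym_gen_set G S \<longleftrightarrow>
     finite S \<and> S \<subseteq> carrier G \<and> (\<forall>s\<in>S. inv\<^bsub>G\<^esub> s \<in> S) \<and> generate G S = carrier G"

definition finitely_generated :: "('a, 'b) monoid_scheme \<Rightarrow> bool" where
  "finitely_generated G \<longleftrightarrow> (\<exists>S. finite S \<and> S \<subseteq> carrier G \<and> generate G S = carrier G)"

definition word_length :: "('a, 'b) monoid_scheme \<Rightarrow> 'a set \<Rightarrow> 'a \<Rightarrow> nat" where
  "word_length G S g =
     (LEAST n. \<exists>ws. set ws \<subseteq> S \<and> length ws = n \<and> foldr (mult G) ws \<one>\<^bsub>G\<^esub> = g)"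

definition word_dist :: "('a, 'b) monoid_scheme \<Rightarrow> 'a set \<Rightarrow> 'a \<Rightarrow> 'a \<Rightarrow> nat" where
  "word_dist G S x y = word_length G S (inv\<^bsub>G\<^esub> x \<otimes>\<^bsub>G\<^esub> y)"

text \<open>Existence of a left-invariant mean on the bounded real functions on the group.
  Functions are total on the underlying type; linearity and positivity force the mean to
  depend only on the values on the carrier.\<close>

definition bounded_funs :: "('a, 'b) monoid_scheme \<Rightarrow> ('a \<Rightarrow> real) set" where
  "bounded_funs G = {f. bounded (f ` carrier G)}"

definition amenable :: "('a, 'b) monoid_scheme \<Rightarrow> bool" where
  "amenable G \<longleftrightarrow>
     (\<exists>m :: ('a \<Rightarrow> real) \<Rightarrow> real.
        (\<forall>f\<in>bounded_funs G. \<forall>h\<in>bounded_funs G. m (\<lambda>x. f x + h x) = m f + m h) \<and>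
        (\<forall>f\<in>bounded_funs G. \<forall>a. m (\<lambda>x. a * f x) = a * m f) \<and>
        (\<forall>f\<in>bounded_funs G. (\<forall>x\<in>carrier G. 0 \<le> f x) \<longrightarrow> 0 \<le> m f) \<and>
        m (\<lambda>x. 1) = 1 \<and>
        (\<forall>f\<in>bounded_funs G. \<forall>g\<in>carrier G. m (\<lambda>x. f (g \<otimes>\<^bsub>G\<^esub> x)) = m f))"

text \<open>Points of \<open>L\<^sub>2 = L\<^sub>2([0,1])\<close> are given by representatives.\<close>

definition L2_funs :: "(real \<Rightarrow> real) set" where
  "L2_funs = {h \<in> borel_measurable (lebesgue_on {0..1}).
                integrable (lebesgue_on {0..1}) (\<lambda>t. (h t)\<^sup>2)}"

definition L2_norm :: "(real \<Rightarrow> real) \<Rightarrow> real" where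
  "L2_norm h = sqrt (LINT t|lebesgue_on {0..1}. (h t)\<^sup>2)"

definition L2_lipschitz :: "('a, 'b) monoid_scheme \<Rightarrow> 'a set \<Rightarrow> ('a \<Rightarrow> real \<Rightarrow> real) \<Rightarrow> bool" where
  "L2_lipschitz G S f \<longleftrightarrow>
     (\<forall>x\<in>carrier G. f x \<in> L2_funs) \<and>
     (\<exists>L\<ge>0. \<forall>x\<in>carrier G. \<forall>y\<in>carrier G.
        L2_norm (\<lambda>t. f x t - f y t) \<le> L * real (word_dist G S x y))"

text \<open>Word metrics of different generating sets are bi-Lipschitz equivalent, so the supremum
  may range over all of them.\<close>

definition alpha_star :: "('a, 'b) monoid_scheme \<Rightarrow> ereal" where
  "alpha_star G = Sup (ereal ` {\<alpha>. \<alpha> \<ge> 0 \<and>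
     (\<exists>S f c. sym_gen_set G S \<and> L2_lipschitz G S f \<and> c > 0 \<and>
        (\<forall>x\<in>carrier G. \<forall>y\<in>carrier G. x \<noteq> y \<longrightarrow>
           c * real (word_dist G S x y) powr \<alpha> \<le> L2_norm (\<lambda>t. f x t - f y t)))})"

text \<open>The law of the position \<open>W\<^sub>t\<close> of the simple random walk on the (right) Cayley graph;
  an identity element in \<open>S\<close> counts as a loop.\<close>

primrec srw :: "('a, 'b) monoid_scheme \<Rightarrow> 'a set \<Rightarrow> nat \<Rightarrow> 'a pmf" where
  "srw G S 0 = return_pmf \<one>\<^bsub>G\<^esub>"
| "srw G S (Suc t) = bind_pmf (srw G S t) (\<lambda>w. map_pmf (\<lambda>s. w \<otimes>\<^bsub>G\<^esub> s) (pmf_of_set S))"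

text \<open>The bound at \<open>t = 0\<close> is vacuous, also for \<open>\<beta> = 0\<close>, because \<open>0 powr 0 = 0\<close>.\<close>

definition beta_star :: "('a, 'b) monoid_scheme \<Rightarrow> ereal" where
  "beta_star G = Sup (ereal ` {\<beta>. \<beta> \<ge> 0 \<and>
     (\<exists>S c. sym_gen_set G S \<and> c > 0 \<and>
        (\<forall>t. c * real t powr \<beta> \<le>
               measure_pmf.expectation (srw G S t) (\<lambda>w. real (word_dist G S w \<one>\<^bsub>G\<^esub>))))})"

definition wreath_product ::
  "('a, 'c) monoid_scheme \<Rightarrow> ('b, 'd) monoid_scheme \<Rightarrow> (('b \<Rightarrow> 'a) \<times> 'b) monoid" where
  "wreath_product G H =
     \<lparr> carrier = {f \<in> carrier H \<rightarrow>\<^sub>E carrier G. finite {z \<in> carrier H. f z \<noteq> \<one>\<^bsub>G\<^esub>}} \<times> carrier H,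
       mult = (\<lambda>(f, x) (g, y).
                 (\<lambda>z\<in>carrier H. f z \<otimes>\<^bsub>G\<^esub> g (inv\<^bsub>H\<^esub> x \<otimes>\<^bsub>H\<^esub> z), x \<otimes>\<^bsub>H\<^esub> y)),
       one = (\<lambda>z\<in>carrier H. \<one>\<^bsub>G\<^esub>, \<one>\<^bsub>H\<^esub>) \<rparr>"

text \<open>The element type of \<open>G \<wr> \<int>\<close> differs from that of \<open>G\<close>. To iterate the construction with a
  variable number of steps, all iterates are copied along injections into one type:
  \<open>Pure_elem\<close> embeds \<open>G\<close> and \<open>Wreath_elem f x\<close> stands for the pair \<open>(f, x)\<close>.\<close>

datatype 'a iter_elem = Pure_elem 'a | Wreath_elem "int \<Rightarrow> 'a iter_elem" int

text \<open>\<open>iterated_wreath G n\<close> is \<open>G\<close> after \<open>n\<close> wreathings with \<open>\<int>\<close>, up to isomorphism;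
  this is \<open>G\<^bsub>(n+1)\<^esub>\<close>.\<close>

primrec iterated_wreath :: "('a, 'b) monoid_scheme \<Rightarrow> nat \<Rightarrow> 'a iter_elem monoid" where
  "iterated_wreath G 0 = image_group Pure_elem G"
| "iterated_wreath G (Suc n) =
     image_group (\<lambda>(f, x). Wreath_elem f x) (wreath_product (iterated_wreath G n) integer_group)"

lemma inj_image_group_iso:
  assumes "group G" "inj_on h (carrier G)"
  shows "h \<in> iso G (image_group h G)"
  using assms
  by (auto simp: iso_def hom_def image_group_def bij_betw_def inv_into_f_f)

lemma group_image_group:
  assumes "group G" "inj_on h (carrier G)"
  shows "group (image_group h G)"
proof -
  interpret group G by fact
  show ?thesis
    using iso_imp_img_group[OF inj_image_group_iso[OF assms]]
    by (simp add: image_group_def)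
qed

lemma group_wreath_product:
  assumes "group G" "group H"
  shows "group (wreath_product G H)"
proof -
  interpret G: group G by fact
  interpret H: group H by fact
  let ?F = "{f \<in> carrier H \<rightarrow>\<^sub>E carrier G. finite {z \<in> carrier H. f z \<noteq> \<one>\<^bsub>G\<^esub>}}"
  have shift: "finite {z \<in> carrier H. g (x \<otimes>\<^bsub>H\<^esub> z) \<noteq> \<one>\<^bsub>G\<^esub>}"
    if "finite {z \<in> carrier H. g z \<noteq> \<one>\<^bsub>G\<^esub>}" "x \<in> carrier H" for g x
    by (rule finite_imageD[where f = "\<lambda>z. x \<otimes>\<^bsub>H\<^esub> z"])
       (use that in \<open>auto intro!: inj_onI elim!: rev_finite_subset\<close>)
  have closed: "(\<lambda>z\<in>carrier H. f z \<otimes>\<^bsub>G\<^esub> g (inv\<^bsub>H\<^esub> x \<otimes>\<^bsub>H\<^esub> z)) \<in> ?F"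
    if "f \<in> ?F" "g \<in> ?F" "x \<in> carrier H" for f g x
  proof -
    have "finite ({z \<in> carrier H. f z \<noteq> \<one>\<^bsub>G\<^esub>} \<union> {z \<in> carrier H. g (inv\<^bsub>H\<^esub> x \<otimes>\<^bsub>H\<^esub> z) \<noteq> \<one>\<^bsub>G\<^esub>})"
      using shift[of g "inv\<^bsub>H\<^esub> x"] that by simp
    then have "finite {z \<in> carrier H. f z \<otimes>\<^bsub>G\<^esub> g (inv\<^bsub>H\<^esub> x \<otimes>\<^bsub>H\<^esub> z) \<noteq> \<one>\<^bsub>G\<^esub>}"
      by (rule rev_finite_subset) auto
    then show ?thesis
      using that by (auto simp: PiE_iff cong: conj_cong)
  qed
  show ?thesis
  proof (rule groupI)
    fix p q assume "p \<in> carrier (wreath_product G H)" "q \<in> carrier (wreath_product G H)"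
    then show "p \<otimes>\<^bsub>wreath_product G H\<^esub> q \<in> carrier (wreath_product G H)"
      using closed by (auto simp: wreath_product_def simp del: mem_Collect_eq)
  next
    show "\<one>\<^bsub>wreath_product G H\<^esub> \<in> carrier (wreath_product G H)"
      by (auto simp: wreath_product_def cong: conj_cong)
  next
    fix p q r
    assume "p \<in> carrier (wreath_product G H)" "q \<in> carrier (wreath_product G H)"
      "r \<in> carrier (wreath_product G H)"
    then show "p \<otimes>\<^bsub>wreath_product G H\<^esub> q \<otimes>\<^bsub>wreath_product G H\<^esub> r =
      p \<otimes>\<^bsub>wreath_product G H\<^esub> (q \<otimes>\<^bsub>wreath_product G H\<^esub> r)"
      by (auto simp: wreath_product_def PiE_iff G.m_assoc H.m_assoc H.inv_mult_group
          intro!: restrict_ext)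
  next
    fix p assume "p \<in> carrier (wreath_product G H)"
    then show "\<one>\<^bsub>wreath_product G H\<^esub> \<otimes>\<^bsub>wreath_product G H\<^esub> p = p"
      by (auto simp: wreath_product_def PiE_iff extensional_def fun_eq_iff)
  next
    fix p assume p: "p \<in> carrier (wreath_product G H)"
    obtain f x where fx: "p = (f, x)" by (cases p)
    let ?g = "\<lambda>z\<in>carrier H. inv\<^bsub>G\<^esub> f (x \<otimes>\<^bsub>H\<^esub> z)"
    have f: "f \<in> ?F" "x \<in> carrier H"
      using p by (auto simp: fx wreath_product_def)
    then have *: "f (x \<otimes>\<^bsub>H\<^esub> z) \<in> carrier G" if "z \<in> carrier H" for z
      using that by auto
    have "{z \<in> carrier H. inv\<^bsub>G\<^esub> f (x \<otimes>\<^bsub>H\<^esub> z) \<noteq> \<one>\<^bsub>G\<^esub>} = {z \<in> carrier H. f (x \<otimes>\<^bsub>H\<^esub> z) \<noteq> \<one>\<^bsub>G\<^esub>}"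
      using * by (auto simp: G.inv_eq_1_iff)
    then have "?g \<in> ?F"
      using shift[of f x] f * by (auto cong: conj_cong)
    then show "\<exists>q\<in>carrier (wreath_product G H).
        q \<otimes>\<^bsub>wreath_product G H\<^esub> p = \<one>\<^bsub>wreath_product G H\<^esub>"
      using f * by (intro bexI[of _ "(?g, inv\<^bsub>H\<^esub> x)"])
        (auto simp: wreath_product_def fx intro!: restrict_ext)
  qed
qed

lemma inj_Wreath_elem: "inj_on (\<lambda>(f, x). Wreath_elem f x) A"
  by (auto simp: inj_on_def)

lemma group_iterated_wreath: "group G \<Longrightarrow> group (iterated_wreath G n)"
  by (induction n)
     (auto intro!: group_image_group group_wreath_product inj_Wreath_elem simp: inj_on_def)

lemma iterated_wreath_0_iso: "group G \<Longrightarrow> G \<cong> iterated_wreath G 0"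
  by (auto intro!: is_isoI inj_image_group_iso simp: inj_on_def)

lemma iterated_wreath_Suc_iso:
  "group G \<Longrightarrow> wreath_product (iterated_wreath G n) integer_group \<cong> iterated_wreath G (Suc n)"
  by (auto intro!: is_isoI inj_image_group_iso inj_Wreath_elem group_wreath_product
      group_iterated_wreath)

end

theory Submission
  imports Defs
begin

text \<open>
  The statement compares two exponents of a group: how well its word metric embeds into Hilbert
  space, and how fast its random walk escapes. Three inequalities carry the proof.

  \<^item> \<open>2 \<alpha> \<beta> \<le> 1\<close> for an amenable group (\<open>compression_times_speed_le\<close>). Averaging the squared
    distance of an embedding over the group gives an almost translation invariant kernel
    \<open>\<psi>(x\<inverse>y)\<close>. Negative definiteness, tested on the law of \<open>W\<^sub>t\<close> minus the point mass at the
    identity, shows that the expectation of \<open>\<psi>(W\<^sub>t)\<close> at most doubles when \<open>t\<close> doubles, so it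
    grows linearly, while it dominates the expectation of \<open>d(W\<^sub>t, 1)\<^bsup>2\<alpha>\<^esup>\<close>, which is at least
    of order \<open>t\<^bsup>2\<alpha>\<beta>\<^esup>\<close>.
  \<^item> A speed exponent \<open>\<beta>\<close> of \<open>G\<close> yields the speed exponent \<open>(1 + \<beta>) / 2\<close> of \<open>G \<wr> \<int>\<close>
    (\<open>speed_W\<close>). Up to time \<open>t\<close> the marker spends time of order \<open>\<surd>t\<close> at each of about \<open>\<surd>t\<close> sites;
    given its path the lamps are random walks on \<open>G\<close> run for these local times, so the total
    length of the lamps is of order \<open>\<surd>t * \<surd>t\<^bsup>\<beta>\<^esup>\<close>.
  \<^item> A compression exponent \<open>p \<ge> 1/2\<close> of \<open>G\<close> yields all compression exponents of \<open>G \<wr> \<int>\<close> below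
    \<open>2 p / (2 p + 1)\<close> (\<open>compression_W\<close>). Two families of kernels on \<open>G \<wr> \<int>\<close>, each indexed by
    dyadic scales, see respectively the distance of the farthest difference from the marker and
    the embedded lamps close to it.

  Let \<open>a\<close> be the compression exponent of \<open>G\<close> and \<open>1 / (2 a)\<close> its speed exponent. Then \<open>G \<wr> \<int>\<close> has
  compression exponent at least \<open>A = 2 a / (2 a + 1)\<close> and speed exponent at least
  \<open>(1 + 1 / (2 a)) / 2 = 1 / (2 A)\<close>. As their product is at most \<open>1/2\<close>, both bounds are attained. The
  new group again satisfies the assumptions: wreathing with the integers preserves amenability, in
  the form of almost invariant means (\<open>approx_amenable_W\<close>). Iterating \<open>a \<mapsto> 2 a / (2 a + 1)\<close>, that is,
  \<open>1/a \<mapsto> 1 + 1/(2 a)\<close>, gives the last formula.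

  Embeddings are handled through their kernels of squared distances: sums, limits and
  Gaussians of such kernels are again such kernels, and every such kernel on a countable set is
  realised in \<open>L\<^sub>2\<close> (\<open>cnd_realization\<close>).
\<close>


section \<open>Word length and balls\<close>

locale cayley = group G for G (structure) +
  fixes S
  assumes gen: "sym_gen_set G S"
begin

abbreviation len where "len \<equiv> word_length G S"

lemma S_finite [simp]: "finite S" and S_subset: "S \<subseteq> carrier G"
  and S_inv: "s \<in> S \<Longrightarrow> inv s \<in> S" and S_gen: "generate G S = carrier G"
  using gen by (auto simp: sym_gen_set_def)

lemma S_carrier [simp]: "s \<in> S \<Longrightarrow> s \<in> carrier G"
  using S_subset by auto

lemma word_carrier [simp]: "set ws \<subseteq> S \<Longrightarrow> foldr (mult G) ws \<one> \<in> carrier G"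
  by (induction ws) auto

lemma foldr_mult_right:
  "set ws \<subseteq> S \<Longrightarrow> x \<in> carrier G \<Longrightarrow> foldr (mult G) ws x = foldr (mult G) ws \<one> \<otimes> x"
  by (induction ws) (auto simp: m_assoc)

lemma word_exists:
  assumes "g \<in> carrier G"
  shows "\<exists>ws. set ws \<subseteq> S \<and> foldr (mult G) ws \<one> = g"
proof -
  have "g \<in> generate G S" using assms S_gen by simp
  then show ?thesis
  proof (induction rule: generate.induct)
    case one then show ?case by (intro exI[of _ "[]"]) auto
  next
    case (incl h) then show ?case by (intro exI[of _ "[h]"]) auto
  next
    case (inv h) then show ?case by (intro exI[of _ "[inv h]"]) (auto intro: S_inv)
  next
    case (eng h1 h2)
    then obtain u v where "set u \<subseteq> S" "foldr (mult G) u \<one> = h1" "set v \<subseteq> S" "foldr (mult G) v \<one> = h2"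
      by blast
    then show ?case
      by (intro exI[of _ "u @ v"]) (auto simp: foldr_mult_right[of u "foldr (mult G) v \<one>"])
  qed
qed

lemma len_attained:
  assumes "g \<in> carrier G"
  obtains ws where "set ws \<subseteq> S" "length ws = len g" "foldr (mult G) ws \<one> = g"
proof -
  have "\<exists>n ws. set ws \<subseteq> S \<and> length ws = n \<and> foldr (mult G) ws \<one> = g"
    using word_exists[OF assms] by auto
  from LeastI_ex[OF this] show ?thesis
    using that unfolding word_length_def by blast
qed

lemma len_le: "set ws \<subseteq> S \<Longrightarrow> len (foldr (mult G) ws \<one>) \<le> length ws"
  unfolding word_length_def by (rule Least_le) auto

lemma len_one [simp]: "len \<one> = 0"
  using len_le[of "[]"] by simp

lemma len_gen: "s \<in> S \<Longrightarrow> len s \<le> 1"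
  using len_le[of "[s]"] by simp

lemma len_mult: assumes "g \<in> carrier G" "h \<in> carrier G" shows "len (g \<otimes> h) \<le> len g + len h"
proof -
  obtain u where u: "set u \<subseteq> S" "length u = len g" "foldr (mult G) u \<one> = g"
    using len_attained[OF assms(1)] .
  obtain v where v: "set v \<subseteq> S" "length v = len h" "foldr (mult G) v \<one> = h"
    using len_attained[OF assms(2)] .
  have "foldr (mult G) (u @ v) \<one> = g \<otimes> h"
    using u v foldr_mult_right[of u h] assms by simp
  then show ?thesis using len_le[of "u @ v"] u v by auto
qed

lemma len_eq_0: "g \<in> carrier G \<Longrightarrow> len g = 0 \<longleftrightarrow> g = \<one>"
  by (auto elim!: len_attained[of g])

lemma word_induct [consumes 1, case_names one step]:
  assumes "g \<in> carrier G"
    and "P \<one>" "\<And>g s. g \<in> carrier G \<Longrightarrow> s \<in> S \<Longrightarrow> P g \<Longrightarrow> P (g \<otimes> s)"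
  shows "P g"
proof -
  have "set ws \<subseteq> S \<Longrightarrow> P (foldr (mult G) ws \<one>)" for ws
  proof (induction ws rule: rev_induct)
    case (snoc s ws)
    then show ?case
      using assms(3)[of "foldr (mult G) ws \<one>" s] by (auto simp: foldr_mult_right[of ws s])
  qed (use assms in auto)
  then show ?thesis using word_exists[OF assms(1)] by blast
qed

text \<open>A function on the group is bounded by a multiple of the word length as soon as its
  growth along edges is bounded: follow a geodesic word.\<close>

lemma edge_growth_bound:
  fixes \<phi> :: "_ \<Rightarrow> real"
  assumes "g \<in> carrier G" "\<phi> \<one> \<le> 0"
    and "\<And>g s. g \<in> carrier G \<Longrightarrow> s \<in> S \<Longrightarrow> \<phi> (g \<otimes> s) \<le> \<phi> g + C"
  shows "\<phi> g \<le> C * len g"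
proof -
  have "set ws \<subseteq> S \<Longrightarrow> \<phi> (foldr (mult G) ws \<one>) \<le> C * length ws" for ws
  proof (induction ws rule: rev_induct)
    case (snoc s ws)
    then show ?case
      using assms(3)[of "foldr (mult G) ws \<one>" s]
      by (auto simp: foldr_mult_right[of ws s] algebra_simps)
  qed (use assms in auto)
  then show ?thesis using len_attained[OF assms(1)] by metis
qed

lemma len_inv_le: assumes "g \<in> carrier G" shows "len (inv g) \<le> len g"
proof -
  have "real (len (inv g)) \<le> 1 * real (len g)"
  proof (rule edge_growth_bound[OF assms])
    fix g s assume "g \<in> carrier G" "s \<in> S"
    then show "real (len (inv (g \<otimes> s))) \<le> real (len (inv g)) + 1"
      using len_mult[of "inv s" "inv g"] len_gen[OF S_inv, of s] by (simp add: inv_mult_group)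
  qed simp
  then show ?thesis by simp
qed

lemma len_inv [simp]: "g \<in> carrier G \<Longrightarrow> len (inv g) = len g"
  using len_inv_le[of g] len_inv_le[of "inv g"] by simp

lemma finite_ball: "finite {g \<in> carrier G. len g \<le> n}"
proof -
  have "{g \<in> carrier G. len g \<le> n} \<subseteq> (\<lambda>ws. foldr (mult G) ws \<one>) ` {ws. set ws \<subseteq> S \<and> length ws \<le> n}"
    by (auto elim!: len_attained)
  then show ?thesis
    by (rule finite_subset) (simp add: finite_lists_length_le)
qed

lemma countable_carrier: "countable (carrier G)"
proof -
  have "carrier G = (\<Union>n. {g \<in> carrier G. len g \<le> n})" by auto
  also have "countable \<dots>" using finite_ball by (auto intro: countable_finite)
  finally show ?thesis .
qed

lemma dist_left_mult:
  assumes "g \<in> carrier G" "x \<in> carrier G" "y \<in> carrier G"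
  shows "word_dist G S (g \<otimes> x) (g \<otimes> y) = word_dist G S x y"
proof -
  have "inv g \<otimes> (g \<otimes> y) = y" using assms by (simp add: m_assoc[symmetric])
  then show ?thesis unfolding word_dist_def
    using assms by (simp only: inv_mult_group m_assoc inv_closed m_closed)
qed

lemma dist_mult_right [simp]:
  "x \<in> carrier G \<Longrightarrow> h \<in> carrier G \<Longrightarrow> word_dist G S x (x \<otimes> h) = len h"
  by (simp add: word_dist_def m_assoc[symmetric])

lemma dist_one_right [simp]: "x \<in> carrier G \<Longrightarrow> word_dist G S x \<one> = len x"
  by (simp add: word_dist_def)

lemma dist_one_left [simp]: "x \<in> carrier G \<Longrightarrow> word_dist G S \<one> x = len x"
  by (simp add: word_dist_def)

lemma dist_eq_0: "x \<in> carrier G \<Longrightarrow> y \<in> carrier G \<Longrightarrow> word_dist G S x y = 0 \<longleftrightarrow> x = y"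
proof -
  assume xy: "x \<in> carrier G" "y \<in> carrier G"
  have "inv x \<otimes> y = \<one> \<longleftrightarrow> x = y"
    using xy inv_solve_left'[of \<one> x y] by auto
  then show ?thesis using xy len_eq_0[of "inv x \<otimes> y"] by (simp only: word_dist_def m_closed inv_closed)
qed

end

lemma word_length_bilipschitz:
  assumes "group G" "sym_gen_set G S" "sym_gen_set G T"
  obtains C :: real where "C > 0" "\<And>g. g \<in> carrier G \<Longrightarrow> word_length G T g \<le> C * word_length G S g"
proof -
  interpret S: cayley G S using assms by (simp add: cayley_def cayley_axioms_def)
  interpret T: cayley G T using assms by (simp add: cayley_def cayley_axioms_def)
  define C where "C = 1 + real (sum T.len S)"
  have "real (T.len g) \<le> C * S.len g" if "g \<in> carrier G" for g
  proof (rule S.edge_growth_bound[OF that])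
    fix g s assume *: "g \<in> carrier G" "s \<in> S"
    then have "T.len s \<le> sum T.len S"
      by (intro member_le_sum) auto
    moreover have "T.len (g \<otimes>\<^bsub>G\<^esub> s) \<le> T.len g + T.len s"
      using T.len_mult[of g s] * by simp
    ultimately have "T.len (g \<otimes>\<^bsub>G\<^esub> s) \<le> T.len g + sum T.len S" by linarith
    then show "real (T.len (g \<otimes>\<^bsub>G\<^esub> s)) \<le> real (T.len g) + C"
      unfolding C_def by linarith
  qed simp
  moreover have "C > 0" unfolding C_def by linarith
  ultimately show ?thesis using that by blast
qed

lemma sym_gen_set_exists:
  assumes "group G" "finitely_generated G"
  obtains S where "sym_gen_set G S"
proof -
  interpret group G by fact
  obtain A where A: "finite A" "A \<subseteq> carrier G" "generate G A = carrier G"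
    using assms(2) by (auto simp: finitely_generated_def)
  let ?S = "A \<union> (\<lambda>a. inv\<^bsub>G\<^esub> a) ` A"
  have sub: "?S \<subseteq> carrier G" using A by auto
  have "generate G A \<subseteq> generate G ?S" by (rule mono_generate) auto
  moreover have "generate G ?S \<subseteq> carrier G" using sub generate_incl by blast
  moreover have "\<forall>s\<in>?S. inv\<^bsub>G\<^esub> s \<in> ?S"
    using A by auto
  ultimately have "sym_gen_set G ?S"
    using A sub unfolding sym_gen_set_def by blast
  then show ?thesis by (rule that)
qed

section \<open>Expectations along the simple random walk\<close>

locale cayley_walk = cayley G S for G (structure) and S +
  assumes infinite_carrier: "infinite (carrier G)"
begin

abbreviation E where "E t h \<equiv> measure_pmf.expectation (srw G S t) (h :: _ \<Rightarrow> real)"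

lemma S_nonempty: "S \<noteq> {}"
proof
  assume "S = {}"
  then have "carrier G \<subseteq> {\<one>}" using word_exists by fastforce
  then show False using infinite_carrier finite_subset by blast
qed

lemma card_S_pos: "card S > 0"
  using S_nonempty by (simp add: card_gt_0_iff)

lemma len_unbounded: obtains g where "g \<in> carrier G" "len g > n"
proof -
  have "\<not> carrier G \<subseteq> {g \<in> carrier G. len g \<le> n}"
    using infinite_carrier finite_ball[of n] finite_subset by blast
  then show ?thesis using that by force
qed

lemma set_srw: "set_pmf (srw G S t) \<subseteq> {g \<in> carrier G. len g \<le> t}"
proof (induction t)
  case (Suc t)
  have "w \<otimes> s \<in> carrier G \<and> len (w \<otimes> s) \<le> Suc t" if "w \<in> set_pmf (srw G S t)" "s \<in> S" for w s
    using that Suc len_mult[of w s] len_gen[of s] by fastforce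
  then show ?case using S_nonempty by auto
qed auto

lemma finite_set_srw [simp]: "finite (set_pmf (srw G S t))"
  using finite_subset[OF set_srw finite_ball] .

lemma integrable_srw [simp]: "integrable (measure_pmf (srw G S t)) (h :: _ \<Rightarrow> real)"
  by (rule integrable_measure_pmf_finite) simp

lemma E_sum_support: "E t h = (\<Sum>x\<in>set_pmf (srw G S t). pmf (srw G S t) x * h x)"
  by (subst integral_measure_pmf[of "set_pmf (srw G S t)"]) auto

lemma E_cong:
  assumes "\<And>x. x \<in> carrier G \<Longrightarrow> len x \<le> t \<Longrightarrow> h x = h' x"
  shows "E t h = E t h'"
  using set_srw[of t] assms by (subst (1 2) E_sum_support) (auto intro!: sum.cong)

lemma E_mono:
  assumes "\<And>x. x \<in> carrier G \<Longrightarrow> len x \<le> t \<Longrightarrow> h x \<le> h' x"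
  shows "E t h \<le> E t h'"
  using set_srw[of t] assms by (subst (1 2) E_sum_support) (auto intro!: sum_mono mult_left_mono)

lemma E_Suc: "E (Suc t) h = E t (\<lambda>w. (\<Sum>s\<in>S. h (w \<otimes> s)) / card S)"
proof -
  have "E (Suc t) h = (\<Sum>x\<in>set_pmf (srw G S t). pmf (srw G S t) x *
      measure_pmf.expectation (map_pmf (\<lambda>s. x \<otimes> s) (pmf_of_set S)) h)"
    unfolding srw.simps by (subst pmf_expectation_bind[of "set_pmf (srw G S t)"]) (auto simp: S_nonempty)
  also have "\<dots> = E t (\<lambda>w. (\<Sum>s\<in>S. h (w \<otimes> s)) / card S)"
    by (subst E_sum_support) (simp add: integral_pmf_of_set[OF S_nonempty])
  finally show ?thesis .
qed

lemma E_sum: "E t (\<lambda>x. \<Sum>i\<in>I. h i x) = (\<Sum>i\<in>I. E t (h i))"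
  by (rule Bochner_Integration.integral_sum) simp

lemma E_le_bound: "(\<And>x. x \<in> carrier G \<Longrightarrow> len x \<le> t \<Longrightarrow> h x \<le> C) \<Longrightarrow> E t h \<le> C"
  using E_mono[of t h "\<lambda>_. C"] by simp

text \<open>The Markov property at time \<open>s\<close>: the walk is defined by multiplying increments on the right,
  and here the first \<open>s\<close> of them are split off on the left.\<close>

lemma walk_restart: "E (s + t) h = E s (\<lambda>x. E t (\<lambda>y. h (x \<otimes> y)))"
proof (induction t arbitrary: h)
  case 0
  then show ?case by (auto intro!: E_cong)
next
  case (Suc t)
  have "E (s + Suc t) h = E s (\<lambda>x. E t (\<lambda>y. (\<Sum>u\<in>S. h (x \<otimes> y \<otimes> u)) / card S))"
    using E_Suc[of "s + t" h] Suc.IH by simp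
  also have "\<dots> = E s (\<lambda>x. E (Suc t) (\<lambda>y. h (x \<otimes> y)))"
    unfolding E_Suc by (intro E_cong arg_cong2[of _ _ _ _ "(/)"] sum.cong) (auto simp: m_assoc)
  finally show ?case .
qed

text \<open>The generating set is symmetric, so reversing the order of the increments and inverting each
  of them does not change their joint law.\<close>

lemma walk_reversal: "E t (\<lambda>x. h (inv x)) = E t h"
proof (induction t arbitrary: h)
  case (Suc t)
  have bij: "bij_betw (\<lambda>s. inv s) S S"
    by (rule bij_betwI[where g = "\<lambda>s. inv s"]) (auto intro: S_inv)
  have "E (Suc t) (\<lambda>x. h (inv x)) = E t (\<lambda>w. (\<Sum>s\<in>S. h (inv s \<otimes> inv w)) / card S)"
    unfolding E_Suc
    by (intro E_cong arg_cong2[of _ _ _ _ "(/)"] sum.cong) (auto simp: inv_mult_group)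
  also have "\<dots> = (\<Sum>s\<in>S. E t (\<lambda>w. h (inv s \<otimes> inv w))) / card S"
    by (simp add: E_sum)
  also have "\<dots> = (\<Sum>s\<in>S. E t (\<lambda>w. h (inv s \<otimes> w))) / card S"
    by (simp add: Suc[of "\<lambda>w. h (inv _ \<otimes> w)"])
  also have "(\<Sum>s\<in>S. E t (\<lambda>w. h (inv s \<otimes> w))) = (\<Sum>s\<in>S. E t (\<lambda>w. h (s \<otimes> w)))"
    using sum.reindex_bij_betw[OF bij, of "\<lambda>s. E t (\<lambda>w. h (s \<otimes> w))"] by simp
  also have "\<dots> / card S = E 1 (\<lambda>x. E t (\<lambda>w. h (x \<otimes> w)))"
    unfolding One_nat_def E_Suc by (auto intro!: arg_cong2[of _ _ _ _ "(/)"] sum.cong)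
  also have "\<dots> = E (Suc t) h"
    using walk_restart[of 1 t h] by simp
  finally show ?case .
qed simp

end

section \<open>Positive definite and conditionally negative definite kernels\<close>

definition pd_on :: "'a set \<Rightarrow> ('a \<Rightarrow> 'a \<Rightarrow> real) \<Rightarrow> bool" where
  "pd_on A k \<longleftrightarrow> (\<forall>x\<in>A. \<forall>y\<in>A. k x y = k y x) \<and>
     (\<forall>F c. finite F \<longrightarrow> F \<subseteq> A \<longrightarrow> 0 \<le> (\<Sum>x\<in>F. \<Sum>y\<in>F. c x * c y * k x y))"

text \<open>Conditionally negative definite kernels are exactly the squared distances \<open>\<parallel>v x - v y\<parallel>\<^sup>2\<close> of
  maps into a Hilbert space; the easy direction is \<open>cnd_on_L2_distance\<close> below, the other one
  \<open>cnd_realization\<close>.\<close>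

definition cnd_on :: "'a set \<Rightarrow> ('a \<Rightarrow> 'a \<Rightarrow> real) \<Rightarrow> bool" where
  "cnd_on A K \<longleftrightarrow> (\<forall>x\<in>A. \<forall>y\<in>A. K x y = K y x) \<and> (\<forall>x\<in>A. K x x = 0) \<and>
     (\<forall>F c. finite F \<longrightarrow> F \<subseteq> A \<longrightarrow> sum c F = 0 \<longrightarrow> (\<Sum>x\<in>F. \<Sum>y\<in>F. c x * c y * K x y) \<le> 0)"

lemma pd_onD:
  assumes "pd_on A k"
  shows "x \<in> A \<Longrightarrow> y \<in> A \<Longrightarrow> k x y = k y x"
    "finite F \<Longrightarrow> F \<subseteq> A \<Longrightarrow> 0 \<le> (\<Sum>x\<in>F. \<Sum>y\<in>F. c x * c y * k x y)"
  using assms unfolding pd_on_def by blast+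

lemma cnd_onD:
  assumes "cnd_on A K"
  shows "x \<in> A \<Longrightarrow> y \<in> A \<Longrightarrow> K x y = K y x" "x \<in> A \<Longrightarrow> K x x = 0"
    "finite F \<Longrightarrow> F \<subseteq> A \<Longrightarrow> sum c F = 0 \<Longrightarrow> (\<Sum>x\<in>F. \<Sum>y\<in>F. c x * c y * K x y) \<le> 0"
  using assms unfolding cnd_on_def by blast+

lemma pd_on_cong:
  assumes "pd_on A k" "\<And>x y. x \<in> A \<Longrightarrow> y \<in> A \<Longrightarrow> k x y = k' x y"
  shows "pd_on A k'"
proof -
  have "(\<Sum>x\<in>F. \<Sum>y\<in>F. c x * c y * k' x y) = (\<Sum>x\<in>F. \<Sum>y\<in>F. c x * c y * k x y)"
    if "F \<subseteq> A" for F c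
    using that[unfolded subset_iff] by (intro sum.cong refl) (auto simp: assms(2))
  then show ?thesis using assms unfolding pd_on_def by simp
qed

lemma cnd_on_cong:
  assumes "cnd_on A k" "\<And>x y. x \<in> A \<Longrightarrow> y \<in> A \<Longrightarrow> k x y = k' x y"
  shows "cnd_on A k'"
proof -
  have "(\<Sum>x\<in>F. \<Sum>y\<in>F. c x * c y * k' x y) = (\<Sum>x\<in>F. \<Sum>y\<in>F. c x * c y * k x y)"
    if "F \<subseteq> A" for F c
    using that[unfolded subset_iff] by (intro sum.cong refl) (auto simp: assms(2))
  then show ?thesis using assms unfolding cnd_on_def by simp
qed

text \<open>Along a map that need not be injective, the coefficients of the points of a fibre add up.\<close>

lemma sum_fibers:
  fixes c :: "_ \<Rightarrow> real"
  assumes "finite F"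
  shows "(\<Sum>x\<in>F. c x * h (e x)) = (\<Sum>u\<in>e ` F. (\<Sum>x\<in>{x\<in>F. e x = u}. c x) * h u)"
  by (subst sum.image_gen[OF assms, of _ e]) (auto simp: sum_distrib_right intro!: sum.cong)

lemma double_sum_fibers:
  fixes c :: "'a \<Rightarrow> real" and e :: "'a \<Rightarrow> 'b"
  assumes "finite F"
  defines "C \<equiv> \<lambda>u. \<Sum>x\<in>{x\<in>F. e x = u}. c x"
  shows "(\<Sum>x\<in>F. \<Sum>y\<in>F. c x * c y * k (e x) (e y)) = (\<Sum>u\<in>e ` F. \<Sum>v\<in>e ` F. C u * C v * k u v)"
    and "sum C (e ` F) = sum c F"
proof -
  have fibers: "(\<Sum>x\<in>F. c x * h (e x)) = (\<Sum>u\<in>e ` F. C u * h u)" for h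
    unfolding C_def by (rule sum_fibers[OF assms(1)])
  have "(\<Sum>x\<in>F. \<Sum>y\<in>F. c x * c y * k (e x) (e y)) =
      (\<Sum>x\<in>F. c x * (\<Sum>y\<in>F. c y * k (e x) (e y)))"
    by (simp add: sum_distrib_left mult_ac)
  also have "\<dots> = (\<Sum>u\<in>e ` F. C u * (\<Sum>v\<in>e ` F. C v * k u v))"
    unfolding fibers[of "k _"] by (rule fibers)
  finally show "(\<Sum>x\<in>F. \<Sum>y\<in>F. c x * c y * k (e x) (e y)) =
      (\<Sum>u\<in>e ` F. \<Sum>v\<in>e ` F. C u * C v * k u v)"
    by (simp add: sum_distrib_left mult_ac)
  show "sum C (e ` F) = sum c F" using fibers[of "\<lambda>_. 1"] by simp
qed

lemma pd_on_pullback: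
  assumes "pd_on A k" "\<And>y. y \<in> B \<Longrightarrow> e y \<in> A"
  shows "pd_on B (\<lambda>x y. k (e x) (e y))"
  unfolding pd_on_def
proof (intro conjI ballI allI impI)
  fix F and c :: "_ \<Rightarrow> real"
  assume F: "finite F" "F \<subseteq> B"
  show "0 \<le> (\<Sum>x\<in>F. \<Sum>y\<in>F. c x * c y * k (e x) (e y))"
    unfolding double_sum_fibers(1)[OF F(1)]
    using F assms(2) by (intro pd_onD(2)[OF assms(1)]) auto
qed (use assms in \<open>auto simp: pd_on_def\<close>)

lemma cnd_on_pullback:
  assumes "cnd_on A k" "\<And>y. y \<in> B \<Longrightarrow> e y \<in> A"
  shows "cnd_on B (\<lambda>x y. k (e x) (e y))"
  unfolding cnd_on_def
proof (intro conjI ballI allI impI)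
  fix F and c :: "_ \<Rightarrow> real"
  assume F: "finite F" "F \<subseteq> B" and c: "sum c F = 0"
  show "(\<Sum>x\<in>F. \<Sum>y\<in>F. c x * c y * k (e x) (e y)) \<le> 0"
    unfolding double_sum_fibers(1)[OF F(1)]
    using F assms(2) c double_sum_fibers(2)[OF F(1), where e = e and c = c]
    by (intro cnd_onD(3)[OF assms(1)]) auto
qed (use assms in \<open>auto simp: cnd_on_def\<close>)

lemma pd_on_equality: "pd_on A (\<lambda>x y. if x = y then 1 else 0)"
  unfolding pd_on_def
proof (intro conjI ballI allI impI)
  fix F and c :: "_ \<Rightarrow> real"
  assume F: "finite F" "F \<subseteq> A"
  have "(\<Sum>x\<in>F. \<Sum>y\<in>F. c x * c y * (if x = y then 1 else 0)) = (\<Sum>x\<in>F. c x * c x)"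
    using F by (intro sum.cong) (simp_all add: if_distrib[of "\<lambda>z. _ * z"] cong: if_cong)
  then show "0 \<le> (\<Sum>x\<in>F. \<Sum>y\<in>F. c x * c y * (if x = y then 1 else 0))"
    by (simp add: sum_nonneg)
qed auto

lemma pd_on_weighted:
  assumes "pd_on A k" shows "pd_on A (\<lambda>x y. u x * u y * k x y)"
  unfolding pd_on_def
proof (intro conjI ballI allI impI)
  fix F and c :: "_ \<Rightarrow> real"
  assume F: "finite F" "F \<subseteq> A"
  have "(\<Sum>x\<in>F. \<Sum>y\<in>F. c x * c y * (u x * u y * k x y)) =
      (\<Sum>x\<in>F. \<Sum>y\<in>F. (c x * u x) * (c y * u y) * k x y)"
    by (simp add: mult_ac)
  then show "0 \<le> (\<Sum>x\<in>F. \<Sum>y\<in>F. c x * c y * (u x * u y * k x y))"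
    using pd_onD(2)[OF assms F, of "\<lambda>x. c x * u x"] by simp
qed (use pd_onD(1)[OF assms] in auto)

lemma pd_on_const_mult:
  assumes "pd_on A k" "a \<ge> 0" shows "pd_on A (\<lambda>x y. a * k x y)"
  using pd_on_weighted[OF assms(1), of "\<lambda>_. sqrt a"] assms(2) by simp

lemma pd_on_sum:
  assumes "\<And>i. i \<in> I \<Longrightarrow> pd_on A (k i)" shows "pd_on A (\<lambda>x y. \<Sum>i\<in>I. k i x y)"
  unfolding pd_on_def
proof (intro conjI ballI allI impI)
  fix F and c :: "_ \<Rightarrow> real"
  assume F: "finite F" "F \<subseteq> A"
  have "(\<Sum>x\<in>F. \<Sum>y\<in>F. c x * c y * (\<Sum>i\<in>I. k i x y)) =
      (\<Sum>x\<in>F. \<Sum>i\<in>I. \<Sum>y\<in>F. c x * c y * k i x y)"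
    by (simp add: sum_distrib_left) (intro sum.cong refl sum.swap)
  also have "\<dots> = (\<Sum>i\<in>I. \<Sum>x\<in>F. \<Sum>y\<in>F. c x * c y * k i x y)"
    by (rule sum.swap)
  also have "\<dots> \<ge> 0" by (rule sum_nonneg) (rule pd_onD(2)[OF assms F])
  finally show "0 \<le> (\<Sum>x\<in>F. \<Sum>y\<in>F. c x * c y * (\<Sum>i\<in>I. k i x y))" .
next
  fix x y assume "x \<in> A" "y \<in> A"
  then show "(\<Sum>i\<in>I. k i x y) = (\<Sum>i\<in>I. k i y x)"
    using pd_onD(1)[OF assms] by (intro sum.cong) auto
qed

lemma pd_on_limit:
  assumes "\<And>n. pd_on A (k n)" "\<And>x y. x \<in> A \<Longrightarrow> y \<in> A \<Longrightarrow> (\<lambda>n. k n x y) \<longlonglongrightarrow> l x y"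
  shows "pd_on A l"
  unfolding pd_on_def
proof (intro conjI ballI allI impI)
  fix F and c :: "_ \<Rightarrow> real"
  assume F: "finite F" "F \<subseteq> A"
  have "(\<lambda>n. \<Sum>x\<in>F. \<Sum>y\<in>F. c x * c y * k n x y) \<longlonglongrightarrow> (\<Sum>x\<in>F. \<Sum>y\<in>F. c x * c y * l x y)"
    using F assms(2) by (intro tendsto_intros) auto
  then show "0 \<le> (\<Sum>x\<in>F. \<Sum>y\<in>F. c x * c y * l x y)"
    by (rule LIMSEQ_le_const) (use pd_onD(2)[OF assms(1) F] in auto)
next
  fix x y assume *: "x \<in> A" "y \<in> A"
  then have "(\<lambda>n. k n y x) \<longlonglongrightarrow> l x y"
    using assms(2)[OF *] pd_onD(1)[OF assms(1) *] by simp
  then show "l x y = l y x"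
    using assms(2)[OF *(2,1)] LIMSEQ_unique by blast
qed

lemma cnd_on_limit:
  assumes "\<And>n. cnd_on A (k n)" "\<And>x y. x \<in> A \<Longrightarrow> y \<in> A \<Longrightarrow> (\<lambda>n. k n x y) \<longlonglongrightarrow> l x y"
  shows "cnd_on A l"
  unfolding cnd_on_def
proof (intro conjI ballI allI impI)
  fix F and c :: "_ \<Rightarrow> real"
  assume F: "finite F" "F \<subseteq> A" and c: "sum c F = 0"
  have "(\<lambda>n. \<Sum>x\<in>F. \<Sum>y\<in>F. c x * c y * k n x y) \<longlonglongrightarrow> (\<Sum>x\<in>F. \<Sum>y\<in>F. c x * c y * l x y)"
    using F assms(2) by (intro tendsto_intros) auto
  then show "(\<Sum>x\<in>F. \<Sum>y\<in>F. c x * c y * l x y) \<le> 0"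
    by (rule LIMSEQ_le_const2) (use cnd_onD(3)[OF assms(1) F c] in auto)
next
  fix x y assume *: "x \<in> A" "y \<in> A"
  then have "(\<lambda>n. k n y x) \<longlonglongrightarrow> l x y"
    using assms(2)[OF *] cnd_onD(1)[OF assms(1) *] by simp
  then show "l x y = l y x"
    using assms(2)[OF *(2,1)] LIMSEQ_unique by blast
next
  fix x assume *: "x \<in> A"
  then show "l x x = 0"
    using assms(2)[OF * *] cnd_onD(2)[OF assms(1) *] by (simp add: LIMSEQ_const_iff)
qed

lemma cnd_on_zero: "cnd_on A (\<lambda>x y. 0)"
  by (simp add: cnd_on_def)

lemma cnd_on_add:
  assumes "cnd_on A k" "cnd_on A l" shows "cnd_on A (\<lambda>x y. k x y + l x y)"
  unfolding cnd_on_def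
proof (intro conjI ballI allI impI)
  fix F and c :: "_ \<Rightarrow> real"
  assume F: "finite F" "F \<subseteq> A" "sum c F = 0"
  show "(\<Sum>x\<in>F. \<Sum>y\<in>F. c x * c y * (k x y + l x y)) \<le> 0"
    using cnd_onD(3)[OF assms(1) F] cnd_onD(3)[OF assms(2) F] by (simp add: ring_distribs sum.distrib)
qed (use cnd_onD(1,2)[OF assms(1)] cnd_onD(1,2)[OF assms(2)] in auto)

lemma cnd_on_const_mult:
  assumes "cnd_on A k" "a \<ge> 0" shows "cnd_on A (\<lambda>x y. a * k x y)"
  unfolding cnd_on_def
proof (intro conjI ballI allI impI)
  fix F and c :: "_ \<Rightarrow> real"
  assume F: "finite F" "F \<subseteq> A" "sum c F = 0"
  have "(\<Sum>x\<in>F. \<Sum>y\<in>F. c x * c y * (a * k x y)) = a * (\<Sum>x\<in>F. \<Sum>y\<in>F. c x * c y * k x y)"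
    by (simp add: sum_distrib_left mult_ac)
  then show "(\<Sum>x\<in>F. \<Sum>y\<in>F. c x * c y * (a * k x y)) \<le> 0"
    using cnd_onD(3)[OF assms(1) F] assms(2) by (simp add: mult_nonneg_nonpos)
qed (use cnd_onD(1,2)[OF assms(1)] in auto)

lemma cnd_on_sum:
  assumes "\<And>i. i \<in> I \<Longrightarrow> cnd_on A (k i)" shows "cnd_on A (\<lambda>x y. \<Sum>i\<in>I. k i x y)"
  using assms by (induction I rule: infinite_finite_induct) (auto intro: cnd_on_zero cnd_on_add)

text \<open>If \<open>k x y\<close> is the Gram matrix \<open>\<langle>v x, v y\<rangle>\<close>, the kernel below is \<open>\<parallel>v x - v y\<parallel>\<^sup>2\<close>.\<close>

lemma cnd_on_of_pd:
  assumes "pd_on A k" shows "cnd_on A (\<lambda>x y. k x x + k y y - 2 * k x y)"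
  unfolding cnd_on_def
proof (intro conjI ballI allI impI)
  fix F and c :: "_ \<Rightarrow> real"
  assume F: "finite F" "F \<subseteq> A" and c: "sum c F = 0"
  have 1: "(\<Sum>x\<in>F. \<Sum>y\<in>F. c x * c y * k x x) = 0"
    using c by (simp add: sum_distrib_right[symmetric] sum_distrib_left[symmetric] mult.assoc
        mult.left_commute[of _ "c _"] mult.commute[of _ "k _ _"])
  have 2: "(\<Sum>x\<in>F. \<Sum>y\<in>F. c x * c y * k y y) = 0"
    using 1 by (subst sum.swap) (simp add: mult_ac)
  have "(\<Sum>x\<in>F. \<Sum>y\<in>F. c x * c y * (k x x + k y y - 2 * k x y)) =
      - 2 * (\<Sum>x\<in>F. \<Sum>y\<in>F. c x * c y * k x y)"
    using 1 2 by (simp add: ring_distribs sum.distrib sum_subtractf sum_distrib_left sum_negf mult_ac)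
  then show "(\<Sum>x\<in>F. \<Sum>y\<in>F. c x * c y * (k x x + k y y - 2 * k x y)) \<le> 0"
    using pd_onD(2)[OF assms F] by simp
qed (use pd_onD(1)[OF assms] in auto)

lemma cnd_on_square_diff: "cnd_on A (\<lambda>x y. (u x - u y)\<^sup>2)"
proof -
  have "pd_on A (\<lambda>x y. 1)"
    using pd_on_pullback[OF pd_on_equality[of UNIV], of A "\<lambda>_. ()"] by simp
  from cnd_on_of_pd[OF pd_on_weighted[OF this, of u]] show ?thesis
    by (rule cnd_on_cong) (simp add: power2_eq_square algebra_simps)
qed

text \<open>If \<open>K\<close> is the squared distance of an embedding \<open>v\<close>, this kernel is the inner product
  \<open>\<langle>v x - v p, v y - v p\<rangle>\<close>.\<close>

lemma pd_on_of_cnd: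
  assumes K: "cnd_on A K" and "p \<in> A"
  shows "pd_on A (\<lambda>x y. (K x p + K y p - K x y) / 2)"
  unfolding pd_on_def
proof (intro conjI ballI allI impI)
  fix F and c :: "_ \<Rightarrow> real"
  assume F: "finite F" "F \<subseteq> A"
  \<comment> \<open>A copy \<open>None\<close> of \<open>p\<close> receives the mass that makes the total mass vanish.\<close>
  define e where "e = case_option p (\<lambda>x. x)"
  define d where "d = case_option (- sum c F) c"
  let ?F = "insert None (Some ` F)"
  have cnd: "cnd_on (insert None (Some ` A)) (\<lambda>x y. K (e x) (e y))"
    by (rule cnd_on_pullback[OF K]) (auto simp: e_def assms(2))
  have split: "(\<Sum>z\<in>?F. d z * h (e z)) = (\<Sum>x\<in>F. c x * h x) - sum c F * h p" for h
    using F by (simp add: d_def e_def sum.reindex)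
  have "sum d ?F = 0" using split[of "\<lambda>_. 1"] by simp
  then have "(\<Sum>x\<in>?F. \<Sum>y\<in>?F. d x * d y * K (e x) (e y)) \<le> 0"
    using F by (intro cnd_onD(3)[OF cnd]) auto
  also have "(\<Sum>x\<in>?F. \<Sum>y\<in>?F. d x * d y * K (e x) (e y)) =
      (\<Sum>x\<in>?F. d x * (\<Sum>y\<in>?F. d y * K (e x) (e y)))"
    by (simp only: sum_distrib_left mult.assoc)
  also have "\<dots> = (\<Sum>x\<in>F. c x * ((\<Sum>y\<in>F. c y * K x y) - sum c F * K x p))
      - sum c F * ((\<Sum>y\<in>F. c y * K p y) - sum c F * K p p)"
    unfolding split using split[of "\<lambda>u. (\<Sum>y\<in>F. c y * K u y) - sum c F * K u p"] by simp
  also have "(\<Sum>y\<in>F. c y * K p y) = (\<Sum>y\<in>F. c y * K y p)"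
    using F assms(2) cnd_onD(1)[OF K] by (intro sum.cong) auto
  also have "K p p = 0" using cnd_onD(2)[OF K assms(2)] .
  finally have "(\<Sum>x\<in>F. \<Sum>y\<in>F. c x * c y * K x y) \<le> 2 * sum c F * (\<Sum>x\<in>F. c x * K x p)"
    by (simp add: right_diff_distrib sum_subtractf sum_distrib_left sum_negf mult_ac)
  moreover have "(\<Sum>x\<in>F. \<Sum>y\<in>F. c x * c y * K x p) = sum c F * (\<Sum>x\<in>F. c x * K x p)"
    unfolding sum_product by (subst sum.swap) (simp add: mult_ac)
  moreover have "(\<Sum>x\<in>F. \<Sum>y\<in>F. c x * c y * K y p) = sum c F * (\<Sum>x\<in>F. c x * K x p)"
    unfolding sum_product by (simp add: mult_ac)
  moreover have "(\<Sum>x\<in>F. \<Sum>y\<in>F. c x * c y * ((K x p + K y p - K x y) / 2)) =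
     ((\<Sum>x\<in>F. \<Sum>y\<in>F. c x * c y * K x p) + (\<Sum>x\<in>F. \<Sum>y\<in>F. c x * c y * K y p)
       - (\<Sum>x\<in>F. \<Sum>y\<in>F. c x * c y * K x y)) / 2"
    by (simp add: sum.distrib[symmetric] sum_subtractf[symmetric] sum_divide_distrib algebra_simps
        diff_divide_distrib add_divide_distrib)
  ultimately show "0 \<le> (\<Sum>x\<in>F. \<Sum>y\<in>F. c x * c y * ((K x p + K y p - K x y) / 2))"
    by simp
qed (use cnd_onD(1)[OF K] in auto)

lemma cnd_on_nonneg:
  assumes "cnd_on A K" "x \<in> A" "y \<in> A" shows "K x y \<ge> 0"
  using pd_onD(2)[OF pd_on_of_cnd[OF assms(1,3)], of "{x}" "\<lambda>_. 1"] assms cnd_onD(2)[OF assms(1)]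
  by simp

text \<open>Cauchy-Schwarz for a positive definite form: the quadratic polynomial
  \<open>\<parallel>v + l w\<parallel>\<^sup>2\<close> in \<open>l\<close> has no sign change.\<close>

lemma pd_Cauchy_Schwarz:
  assumes k: "pd_on A k" and F: "finite F" "F \<subseteq> A" and a: "a \<in> A"
  shows "(\<Sum>x\<in>F. c x * k x a)\<^sup>2 \<le> (\<Sum>x\<in>F. \<Sum>y\<in>F. c x * c y * k x y) * k a a"
proof -
  define q where "q = (\<Sum>x\<in>F. \<Sum>y\<in>F. c x * c y * k x y)"
  define B where "B = (\<Sum>x\<in>F. c x * k x a)"
  define e where "e = case_option a (\<lambda>x. x)"
  have pd: "pd_on (insert None (Some ` A)) (\<lambda>x y. k (e x) (e y))"
    by (rule pd_on_pullback[OF k]) (auto simp: e_def a)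
  have sym: "(\<Sum>x\<in>F. c x * k a x) = B"
    unfolding B_def using F a pd_onD(1)[OF k] by (intro sum.cong) auto
  have quad: "0 \<le> q + 2 * l * B + l\<^sup>2 * k a a" for l
  proof -
    let ?d = "case_option l c" and ?F = "insert None (Some ` F)"
    have "0 \<le> (\<Sum>x\<in>?F. \<Sum>y\<in>?F. ?d x * ?d y * k (e x) (e y))"
      using F by (intro pd_onD(2)[OF pd]) auto
    also have "\<dots> = q + l * B + l * (\<Sum>x\<in>F. c x * k a x) + l * l * k a a"
      using F by (simp add: sum.reindex e_def sum.distrib q_def B_def sum_distrib_left mult_ac)
    also have "\<dots> = q + 2 * l * B + l\<^sup>2 * k a a"
      unfolding sym by (simp add: power2_eq_square)
    finally show ?thesis .
  qed
  have kaa: "k a a \<ge> 0" using pd_onD(2)[OF k, of "{a}" "\<lambda>_. 1"] a by simp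
  show ?thesis
  proof (cases "k a a = 0")
    case True
    have "B = 0"
    proof (rule ccontr)
      assume "B \<noteq> 0"
      then show False using quad[of "- (q + 1) / (2 * B)"] True by (simp add: field_simps)
    qed
    then show ?thesis using True by (simp add: B_def)
  next
    case False
    then have pos: "k a a > 0" using kaa by simp
    have "0 \<le> q + 2 * (- B / k a a) * B + (- B / k a a)\<^sup>2 * k a a" by (rule quad)
    also have "\<dots> = q - B\<^sup>2 / k a a"
      using pos by (simp add: power2_eq_square field_simps)
    finally have "B\<^sup>2 / k a a \<le> q" by simp
    then show ?thesis using pos by (simp add: divide_le_eq q_def B_def)
  qed
qed

text \<open>The three point inequality is the weighted form of
  \<open>\<parallel>u + v\<parallel>\<^sup>2 \<le> (a + b) (\<parallel>u\<parallel>\<^sup>2 / b + \<parallel>v\<parallel>\<^sup>2 / a)\<close>; it replaces the triangle inequality.\<close>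

lemma cnd_three_points:
  assumes K: "cnd_on A K" and A: "x \<in> A" "y \<in> A" "z \<in> A" and ab: "a > 0" "b > 0"
  shows "K x z \<le> (a + b) * (K x y / b + K y z / a)"
proof -
  let ?p = "\<lambda>u v. (K u y + K v y - K u v) / 2"
  have pd: "pd_on A ?p" by (rule pd_on_of_cnd[OF K A(2)])
  note [simp] = cnd_onD(2)[OF K A(1)] cnd_onD(2)[OF K A(2)] cnd_onD(2)[OF K A(3)]
  have sym: "K z y = K y z" using cnd_onD(1)[OF K A(3,2)] .
  have "(?p x z)\<^sup>2 \<le> ?p x x * ?p z z"
    using pd_Cauchy_Schwarz[OF pd, of "{x}" z "\<lambda>_. 1"] A by simp
  then have cs: "(?p x z)\<^sup>2 \<le> K x y * K y z" by (simp add: sym)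
  have nn: "K x y \<ge> 0" "K y z \<ge> 0" using cnd_on_nonneg[OF K] A by auto
  have "- ?p x z \<le> sqrt (K x y * K y z)"
    using cs by (intro real_le_rsqrt) (simp only: power2_minus)
  also have "\<dots> \<le> (a * (K x y / b) + b * (K y z / a)) / 2"
  proof -
    have "sqrt (K x y * K y z) = sqrt ((a * (K x y / b)) * (b * (K y z / a)))"
      using ab by simp
    also have "\<dots> \<le> (a * (K x y / b) + b * (K y z / a)) / 2"
      using ab nn by (intro arith_geo_mean_sqrt) auto
    finally show ?thesis .
  qed
  finally have *: "- ?p x z \<le> (a * (K x y / b) + b * (K y z / a)) / 2" .
  have "w \<le> u + v + P + Q" if "- ((u + v - w) / 2) \<le> (P + Q) / 2" for u v w P Q :: real
    using that by (simp add: field_simps)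
  from this[OF *] have "K x z \<le> K x y + K y z + a * (K x y / b) + b * (K y z / a)"
    by (simp only: sym)
  also have "\<dots> = (a + b) * (K x y / b + K y z / a)"
    using ab by (simp add: field_simps)
  finally show ?thesis .
qed

section \<open>Realising kernels in \<open>L\<^sub>2\<close>\<close>

text \<open>Symmetric Gaussian elimination with pivots \<open>0, 1, 2, \<dots>\<close>. A pivot \<open>0\<close> needs no special
  treatment: by Cauchy-Schwarz its row vanishes, and division by \<open>0\<close> yields \<open>0\<close>.\<close>

definition eliminate :: "nat \<Rightarrow> (nat \<Rightarrow> nat \<Rightarrow> real) \<Rightarrow> nat \<Rightarrow> nat \<Rightarrow> real" where
  "eliminate n k x y = k x y - k x n * k n y / k n n"

primrec schur_complement :: "(nat \<Rightarrow> nat \<Rightarrow> real) \<Rightarrow> nat \<Rightarrow> nat \<Rightarrow> nat \<Rightarrow> real" where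
  "schur_complement k 0 = k"
| "schur_complement k (Suc n) = eliminate n (schur_complement k n)"

lemma pd_schur_complement:
  assumes "pd_on UNIV k"
  shows "pd_on UNIV (schur_complement k n) \<and> (\<forall>m<n. \<forall>y. schur_complement k n m y = 0)"
proof (induction n)
  case (Suc n)
  define K where "K = schur_complement k n"
  have pd: "pd_on UNIV K" and zero: "\<And>m y. m < n \<Longrightarrow> K m y = 0" using Suc by (auto simp: K_def)
  have sym: "K x y = K y x" for x y using pd_onD(1)[OF pd] by blast
  let ?K = "\<lambda>x y. K x y - K x n * K y n / K n n"
  have "pd_on UNIV ?K"
    unfolding pd_on_def
  proof (intro conjI ballI allI impI)
    fix F :: "nat set" and c :: "nat \<Rightarrow> real"
    assume F: "finite F" "F \<subseteq> UNIV"
    define B where "B = (\<Sum>x\<in>F. c x * K x n)"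
    have Knn: "K n n \<ge> 0" using pd_onD(2)[OF pd, of "{n}" "\<lambda>_. 1"] by simp
    have "(\<Sum>x\<in>F. \<Sum>y\<in>F. c x * c y * ?K x y) =
        (\<Sum>x\<in>F. \<Sum>y\<in>F. c x * c y * K x y) - (\<Sum>x\<in>F. \<Sum>y\<in>F. (c x * K x n) * (c y * K y n)) / K n n"
      by (simp add: sum_subtractf sum_divide_distrib right_diff_distrib mult_ac)
    also have "(\<Sum>x\<in>F. \<Sum>y\<in>F. (c x * K x n) * (c y * K y n)) = B\<^sup>2"
      by (simp add: B_def power2_eq_square sum_product)
    finally have eq: "(\<Sum>x\<in>F. \<Sum>y\<in>F. c x * c y * ?K x y) =
        (\<Sum>x\<in>F. \<Sum>y\<in>F. c x * c y * K x y) - B\<^sup>2 / K n n" .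
    have "B\<^sup>2 \<le> (\<Sum>x\<in>F. \<Sum>y\<in>F. c x * c y * K x y) * K n n"
      unfolding B_def by (rule pd_Cauchy_Schwarz[OF pd F]) simp
    then have "B\<^sup>2 / K n n \<le> (\<Sum>x\<in>F. \<Sum>y\<in>F. c x * c y * K x y)"
      using Knn pd_onD(2)[OF pd F] by (cases "K n n = 0") (auto simp: divide_le_eq)
    then show "0 \<le> (\<Sum>x\<in>F. \<Sum>y\<in>F. c x * c y * ?K x y)"
      unfolding eq by simp
  next
    fix x y show "?K x y = ?K y x" using sym[of x y] by simp
  qed
  moreover have "?K m y = 0" if "m < Suc n" for m y
  proof (cases "m = n")
    case True
    show ?thesis
    proof (cases "K n n = 0")
      case K0: True
      have "(K y n)\<^sup>2 \<le> 0"
        using pd_Cauchy_Schwarz[OF pd, of "{y}" n "\<lambda>_. 1"] K0 by simp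
      then show ?thesis using True sym[of n y] by simp
    qed (use True sym[of n y] in simp)
  qed (use that zero in auto)
  moreover have "schur_complement k (Suc n) = ?K"
  proof (intro ext)
    fix x y show "schur_complement k (Suc n) x y = ?K x y"
      using sym[of n y] by (simp add: eliminate_def K_def)
  qed
  ultimately show ?case by metis
qed (use assms in simp)

text \<open>Each elimination step splits off a rank one kernel \<open>v x n * v y n\<close>. After step \<open>x\<close> the row of
  \<open>x\<close> is used up, so only finitely many coordinates of each vector are nonzero (a Cholesky
  decomposition).\<close>

lemma pd_on_nat_gram:
  assumes "pd_on UNIV (k :: nat \<Rightarrow> nat \<Rightarrow> real)"
  obtains v :: "nat \<Rightarrow> nat \<Rightarrow> real" where
    "\<And>x m. m > x \<Longrightarrow> v x m = 0" "\<And>x y n. n > x \<Longrightarrow> k x y = (\<Sum>m<n. v x m * v y m)"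
proof -
  let ?K = "schur_complement k"
  define v where "v x m = ?K m x m / sqrt (?K m m m)" for x m
  have pd: "pd_on UNIV (?K n)" and zero: "m < n \<Longrightarrow> ?K n m y = 0" for n m y
    using pd_schur_complement[OF assms] by auto
  have "k x y = ?K n x y + (\<Sum>m<n. v x m * v y m)" for x y n
  proof (induction n)
    case (Suc n)
    have "?K n n n \<ge> 0" using pd_onD(2)[OF pd[of n], of "{n}" "\<lambda>_. 1"] by simp
    then have "v x n * v y n = ?K n x n * ?K n n y / ?K n n n"
      using pd_onD(1)[OF pd[of n], of n y] by (simp add: v_def)
    then show ?case using Suc by (simp add: eliminate_def)
  qed simp
  then have "k x y = (\<Sum>m<n. v x m * v y m)" if "n > x" for x y n
    using zero[OF that, of y] by (metis add_0)
  moreover have "v x m = 0" if "m > x" for x m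
    using zero[OF that] by (simp add: v_def)
  ultimately show ?thesis using that by blast
qed

lemma pd_on_gram:
  assumes "countable A" "pd_on A k"
  obtains v :: "'a \<Rightarrow> nat \<Rightarrow> real" and N :: "'a \<Rightarrow> nat" where
    "\<And>x m. x \<in> A \<Longrightarrow> m \<ge> N x \<Longrightarrow> v x m = 0"
    "\<And>x y n. x \<in> A \<Longrightarrow> y \<in> A \<Longrightarrow> n \<ge> N x \<Longrightarrow> k x y = (\<Sum>m<n. v x m * v y m)"
proof (cases "A = {}")
  case False
  let ?e = "from_nat_into A" and ?i = "to_nat_on A"
  have "pd_on UNIV (\<lambda>m n. k (?e m) (?e n))"
    using from_nat_into[OF False] by (intro pd_on_pullback[OF assms(2)])
  then obtain v :: "nat \<Rightarrow> nat \<Rightarrow> real" where v: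
    "\<And>x m. m > x \<Longrightarrow> v x m = 0" "\<And>x y n. n > x \<Longrightarrow> k (?e x) (?e y) = (\<Sum>m<n. v x m * v y m)"
    using pd_on_nat_gram[of "\<lambda>m n. k (?e m) (?e n)"] by blast
  show ?thesis
  proof (rule that)
    show "m \<ge> Suc (?i x) \<Longrightarrow> v (?i x) m = 0" for x m
      by (rule v(1)) simp
    show "k x y = (\<Sum>m<n. v (?i x) m * v (?i y) m)" if "x \<in> A" "y \<in> A" "n \<ge> Suc (?i x)" for x y n
      using v(2)[of "?i x" n "?i y"] that from_nat_into_to_nat_on[OF assms(1)] by simp
  qed
qed (rule that, auto)

text \<open>The vectors \<open>unit_step 0, unit_step 1, \<dots>\<close> are orthonormal and have disjoint supports
  \<open>(1/(m+2), 1/(m+1)]\<close>.\<close>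

definition unit_step :: "nat \<Rightarrow> real \<Rightarrow> real" where
  "unit_step m t = sqrt ((real m + 1) * (real m + 2)) *
     indicator {1 / (real m + 2)<..1 / (real m + 1)} t"

lemma unit_step_orthogonal:
  assumes "m \<noteq> n" shows "unit_step m t * unit_step n t = 0"
proof -
  have "\<not> (t \<in> {1 / (real m + 2)<..1 / (real m + 1)} \<and> t \<in> {1 / (real n + 2)<..1 / (real n + 1)})"
    if "m < n" for m n :: nat
  proof -
    have "1 / (real n + 1) \<le> 1 / (real m + 2)"
      using that by (intro divide_left_mono) auto
    then show ?thesis by auto
  qed
  from this[of m n] this[of n m] show ?thesis
    using assms unfolding unit_step_def by (auto simp: indicator_def neq_iff)
qed

lemma unit_step_borel [measurable]: "unit_step m \<in> borel_measurable (lebesgue_on {0..1})"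
proof -
  have "unit_step m \<in> borel_measurable lborel"
    unfolding unit_step_def[abs_def] by measurable
  then show ?thesis
    by (intro measurable_restrict_space1 measurable_completion)
qed

lemma unit_step_square:
  "has_bochner_integral (lebesgue_on {0..1}) (\<lambda>t. (unit_step m t)\<^sup>2) 1"
proof -
  let ?I = "{1 / (real m + 2)<..1 / (real m + 1)}"
  have sub: "?I \<subseteq> {0..1}"
  proof
    fix t assume t: "t \<in> ?I"
    then have "0 \<le> t" by (smt (verit) divide_nonneg_nonneg greaterThanAtMost_iff of_nat_0_le_iff)
    moreover have "t \<le> 1"
    proof -
      have "t \<le> 1 / (real m + 1)" using t by simp
      also have "\<dots> \<le> 1" by simp
      finally show ?thesis .
    qed
    ultimately show "t \<in> {0..1}" by simp
  qed
  have le: "1 / (real m + 2) \<le> 1 / (real m + 1)" by (intro divide_left_mono) auto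
  have "has_bochner_integral lebesgue (indicator ?I :: real \<Rightarrow> real) (1 / (real m + 1) - 1 / (real m + 2))"
    using has_bochner_integral_real_indicator[of ?I lebesgue] le
    by (simp add: emeasure_lborel_Ioc)
  then have "has_bochner_integral lebesgue (\<lambda>t. ((real m + 1) * (real m + 2)) * (indicator ?I t :: real))
      (((real m + 1) * (real m + 2)) * (1 / (real m + 1) - 1 / (real m + 2)))"
    by (rule has_bochner_integral_mult_right)
  moreover have "((real m + 1) * (real m + 2)) * (1 / (real m + 1) - 1 / (real m + 2)) = 1"
  proof -
    have "a * b * (1 / a - 1 / b) = 1" if "a > 0" "b = a + 1" for a b :: real
    proof -
      have "b \<noteq> 0" using that by simp
      then show ?thesis using that(1) by (simp add: right_diff_distrib) (simp add: that(2))
    qed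
    from this[of "real m + 1" "real m + 2"] show ?thesis by simp
  qed
  moreover have "(\<lambda>t. ((real m + 1) * (real m + 2)) * (indicator ?I t :: real)) =
      (\<lambda>t. indicator {0..1} t *\<^sub>R (unit_step m t)\<^sup>2)"
    using sub by (auto simp: fun_eq_iff unit_step_def indicator_def power_mult_distrib)
  ultimately have "has_bochner_integral lebesgue (\<lambda>t. indicator {0..1} t *\<^sub>R (unit_step m t)\<^sup>2) 1"
    by simp
  then show ?thesis
    by (subst has_bochner_integral_restrict_space) auto
qed

lemma step_combination_L2:
  fixes n :: nat
  shows "has_bochner_integral (lebesgue_on {0..1}) (\<lambda>t. (\<Sum>m<n. a m * unit_step m t)\<^sup>2) (\<Sum>m<n. (a m)\<^sup>2)"
proof -
  have "(\<Sum>m<n. a m * unit_step m t)\<^sup>2 = (\<Sum>m<n. (a m)\<^sup>2 * (unit_step m t)\<^sup>2)" for t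
  proof -
    have "(\<Sum>m<n. a m * unit_step m t)\<^sup>2 =
        (\<Sum>i<n. \<Sum>j<n. a i * a j * (unit_step i t * unit_step j t))"
      by (simp add: power2_eq_square sum_product mult_ac)
    also have "\<dots> = (\<Sum>i<n. \<Sum>j<n. if j = i then (a i)\<^sup>2 * (unit_step i t)\<^sup>2 else 0)"
      using unit_step_orthogonal by (intro sum.cong refl) (auto simp: power2_eq_square)
    finally show ?thesis by simp
  qed
  moreover have "has_bochner_integral (lebesgue_on {0..1})
      (\<lambda>t. \<Sum>m<n. (a m)\<^sup>2 * (unit_step m t)\<^sup>2) (\<Sum>m<n. (a m)\<^sup>2 * 1)"
    by (intro has_bochner_integral_sum has_bochner_integral_mult_right unit_step_square)
  ultimately show ?thesis by simp
qed

theorem cnd_realization: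
  assumes "countable A" "cnd_on A K"
  obtains f :: "'a \<Rightarrow> real \<Rightarrow> real" where "\<And>x. x \<in> A \<Longrightarrow> f x \<in> L2_funs"
    "\<And>x y. x \<in> A \<Longrightarrow> y \<in> A \<Longrightarrow> L2_norm (\<lambda>t. f x t - f y t) = sqrt (K x y)"
proof (cases "A = {}")
  case False
  then obtain p where p: "p \<in> A" by blast
  let ?k = "\<lambda>x y. (K x p + K y p - K x y) / 2"
  obtain v :: "'a \<Rightarrow> nat \<Rightarrow> real" and N :: "'a \<Rightarrow> nat" where
    vN: "\<And>x m. x \<in> A \<Longrightarrow> m \<ge> N x \<Longrightarrow> v x m = 0"
    and v: "\<And>x y n. x \<in> A \<Longrightarrow> y \<in> A \<Longrightarrow> n \<ge> N x \<Longrightarrow> ?k x y = (\<Sum>m<n. v x m * v y m)"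
    by (rule pd_on_gram[OF assms(1) pd_on_of_cnd[OF assms(2) p]], rule that)
  define f where "f x t = (\<Sum>m<N x. v x m * unit_step m t)" for x t
  have f_eq: "f x t = (\<Sum>m<n. v x m * unit_step m t)" if "x \<in> A" "n \<ge> N x" for x n t
    unfolding f_def using that vN by (intro sum.mono_neutral_left) auto
  have "f x \<in> L2_funs" for x
    using step_combination_L2[of "v x" "N x"]
    unfolding L2_funs_def f_def[abs_def] by (auto simp: has_bochner_integral_iff)
  moreover have "L2_norm (\<lambda>t. f x t - f y t) = sqrt (K x y)" if xy: "x \<in> A" "y \<in> A" for x y
  proof -
    define n where "n = max (N x) (N y)"
    have n: "n \<ge> N x" "n \<ge> N y" by (auto simp: n_def)
    have "f x t - f y t = (\<Sum>m<n. (v x m - v y m) * unit_step m t)" for t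
      using xy n by (simp add: f_eq sum_subtractf left_diff_distrib)
    then have "(LINT t|lebesgue_on {0..1}. (f x t - f y t)\<^sup>2) = (\<Sum>m<n. (v x m - v y m)\<^sup>2)"
      using step_combination_L2[of "\<lambda>m. v x m - v y m" n] by (simp add: has_bochner_integral_iff)
    also have "\<dots> = ?k x x - 2 * ?k x y + ?k y y"
      unfolding v[OF xy(1) xy(1) n(1)] v[OF xy n(1)] v[OF xy(2) xy(2) n(2)]
      by (simp only: power2_diff sum.distrib sum_subtractf sum_distrib_left power2_eq_square[symmetric])
         (simp add: sum_distrib_left[symmetric] mult.assoc algebra_simps)
    also have "\<dots> = K x y"
      using cnd_onD(2)[OF assms(2)] xy by (simp add: field_simps)
    finally show ?thesis by (simp add: L2_norm_def)
  qed
  ultimately show ?thesis by (rule that)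
qed (rule that, auto)

lemma L2_funs_diff:
  assumes "f \<in> L2_funs" "g \<in> L2_funs"
  shows "integrable (lebesgue_on {0..1}) (\<lambda>t. (f t - g t)\<^sup>2)"
proof (rule Bochner_Integration.integrable_bound[of _ "\<lambda>t. 2 * (f t)\<^sup>2 + 2 * (g t)\<^sup>2"])
  show "AE t in lebesgue_on {0..1}. norm ((f t - g t)\<^sup>2) \<le> norm (2 * (f t)\<^sup>2 + 2 * (g t)\<^sup>2)"
  proof (intro AE_I2)
    fix t
    have "(f t - g t)\<^sup>2 \<le> 2 * (f t)\<^sup>2 + 2 * (g t)\<^sup>2"
      using zero_le_power2[of "f t + g t"] by (simp add: power2_sum power2_diff)
    then show "norm ((f t - g t)\<^sup>2) \<le> norm (2 * (f t)\<^sup>2 + 2 * (g t)\<^sup>2)"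
      by (metis abs_ge_self abs_power2 order_trans real_norm_def)
  qed
qed (use assms in \<open>auto simp: L2_funs_def\<close>)

lemma cnd_on_L2_distance:
  assumes f: "\<And>x. x \<in> A \<Longrightarrow> f x \<in> L2_funs"
  shows "cnd_on A (\<lambda>x y. (L2_norm (\<lambda>t. f x t - f y t))\<^sup>2)"
proof -
  let ?M = "lebesgue_on {0..1::real}"
  have int: "integrable ?M (\<lambda>t. (f x t - f y t)\<^sup>2)" if "x \<in> A" "y \<in> A" for x y
    using L2_funs_diff f that by blast
  have "cnd_on A (\<lambda>x y. LINT t|?M. (f x t - f y t)\<^sup>2)"
    unfolding cnd_on_def
  proof (intro conjI ballI allI impI)
    fix F and c :: "_ \<Rightarrow> real"
    assume F: "finite F" "F \<subseteq> A" and c: "sum c F = 0"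
    have "(\<Sum>x\<in>F. \<Sum>y\<in>F. c x * c y * (f x t - f y t)\<^sup>2) \<le> 0" for t
      by (rule cnd_onD(3)[OF cnd_on_square_diff F c])
    then have "0 \<le> (LINT t|?M. - (\<Sum>x\<in>F. \<Sum>y\<in>F. c x * c y * (f x t - f y t)\<^sup>2))"
      by (intro Bochner_Integration.integral_nonneg) simp
    then have "(LINT t|?M. (\<Sum>x\<in>F. \<Sum>y\<in>F. c x * c y * (f x t - f y t)\<^sup>2)) \<le> 0"
      by simp
    also have "(LINT t|?M. (\<Sum>x\<in>F. \<Sum>y\<in>F. c x * c y * (f x t - f y t)\<^sup>2)) =
        (\<Sum>x\<in>F. \<Sum>y\<in>F. c x * c y * (LINT t|?M. (f x t - f y t)\<^sup>2))"
    proof -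
      have int': "integrable ?M (\<lambda>t. c x * c y * (f x t - f y t)\<^sup>2)" if "x \<in> F" "y \<in> F" for x y
        using int that F by (intro integrable_mult_right) auto
      have "(LINT t|?M. (\<Sum>x\<in>F. \<Sum>y\<in>F. c x * c y * (f x t - f y t)\<^sup>2)) =
          (\<Sum>x\<in>F. LINT t|?M. (\<Sum>y\<in>F. c x * c y * (f x t - f y t)\<^sup>2))"
        by (intro Bochner_Integration.integral_sum Bochner_Integration.integrable_sum int')
      also have "\<dots> = (\<Sum>x\<in>F. \<Sum>y\<in>F. LINT t|?M. c x * c y * (f x t - f y t)\<^sup>2)"
        by (intro sum.cong refl Bochner_Integration.integral_sum int')
      finally show ?thesis by simp
    qed
    finally show "(\<Sum>x\<in>F. \<Sum>y\<in>F. c x * c y * (LINT t|?M. (f x t - f y t)\<^sup>2)) \<le> 0" .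
  qed (auto simp: power2_commute)
  then show ?thesis
    by (rule cnd_on_cong) (simp add: L2_norm_def)
qed

text \<open>The Schur product theorem: write one factor as a Gram matrix and sum over its coordinates.\<close>

lemma pd_on_mult:
  assumes "countable A" "pd_on A k" "pd_on A l"
  shows "pd_on A (\<lambda>x y. k x y * l x y)"
  unfolding pd_on_def
proof (intro conjI ballI allI impI)
  fix F and c :: "_ \<Rightarrow> real"
  assume F: "finite F" "F \<subseteq> A"
  obtain v :: "'a \<Rightarrow> nat \<Rightarrow> real" and N :: "'a \<Rightarrow> nat" where
    v: "\<And>x y n. x \<in> A \<Longrightarrow> y \<in> A \<Longrightarrow> n \<ge> N x \<Longrightarrow> k x y = (\<Sum>m<n. v x m * v y m)"
    using pd_on_gram[OF assms(1,2)] by metis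
  obtain n where n: "\<And>x. x \<in> F \<Longrightarrow> N x \<le> n"
    using finite_nat_set_iff_bounded_le[of "N ` F"] F by auto
  have "pd_on A (\<lambda>x y. \<Sum>m<n. v x m * v y m * l x y)"
    by (intro pd_on_sum pd_on_weighted assms)
  from pd_onD(2)[OF this F, of c]
  have "0 \<le> (\<Sum>x\<in>F. \<Sum>y\<in>F. c x * c y * (\<Sum>m<n. v x m * v y m * l x y))" .
  also have "\<dots> = (\<Sum>x\<in>F. \<Sum>y\<in>F. c x * c y * (k x y * l x y))"
  proof (intro sum.cong refl)
    fix x y assume "x \<in> F" "y \<in> F"
    then have "k x y = (\<Sum>m<n. v x m * v y m)" using F n by (intro v) auto
    then show "c x * c y * (\<Sum>m<n. v x m * v y m * l x y) = c x * c y * (k x y * l x y)"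
      by (simp add: sum_distrib_right)
  qed
  finally show "0 \<le> (\<Sum>x\<in>F. \<Sum>y\<in>F. c x * c y * (k x y * l x y))" .
qed (use pd_onD(1)[OF assms(2)] pd_onD(1)[OF assms(3)] in auto)

lemma pd_on_power:
  assumes "countable A" "pd_on A k" shows "pd_on A (\<lambda>x y. k x y ^ n)"
proof (induction n)
  case 0
  show ?case using pd_on_pullback[OF pd_on_equality[of UNIV], of A "\<lambda>_. ()"] by simp
next
  case (Suc n)
  then show ?case using pd_on_mult[OF assms Suc] by simp
qed

text \<open>Schoenberg's theorem. With \<open>k x y = \<langle>v x, v y\<rangle>\<close> for the embedding \<open>v\<close> based at \<open>p\<close>,
  \<open>exp (- s * \<parallel>v x - v y\<parallel>\<^sup>2)\<close> is \<open>exp (2 * s * k x y)\<close> up to weights in \<open>x\<close> and in \<open>y\<close>.\<close>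

lemma pd_on_exp_neg_cnd:
  assumes "countable A" and K: "cnd_on A K" and s: "s \<ge> 0"
  shows "pd_on A (\<lambda>x y. exp (- s * K x y))"
proof (cases "A = {}")
  case False
  then obtain p where p: "p \<in> A" by blast
  let ?k = "\<lambda>x y. (2 * s) * ((K x p + K y p - K x y) / 2)"
  have pd: "pd_on A ?k"
    using s by (intro pd_on_const_mult pd_on_of_cnd[OF K p]) auto
  have exp_lim: "(\<lambda>n. \<Sum>i<n. (1 / fact i) * z ^ i) \<longlonglongrightarrow> exp z" for z :: real
    using exp_converges[of z] by (simp add: sums_def divide_inverse)
  have "pd_on A (\<lambda>x y. exp (?k x y))"
  proof (rule pd_on_limit)
    show "pd_on A (\<lambda>x y. \<Sum>i<n. (1 / fact i) * ?k x y ^ i)" for n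
      by (rule pd_on_sum, rule pd_on_const_mult, rule pd_on_power[OF assms(1) pd]) simp
    show "(\<lambda>n. \<Sum>i<n. (1 / fact i) * ?k x y ^ i) \<longlonglongrightarrow> exp (?k x y)" for x y
      by (rule exp_lim)
  qed
  from pd_on_weighted[OF this, of "\<lambda>x. exp (- s * K x p)"]
  show ?thesis
    by (rule pd_on_cong) (simp add: exp_add[symmetric] field_simps)
qed (simp add: pd_on_def)

section \<open>Compression and speed\<close>

definition compresses ::
  "('a, 'b) monoid_scheme \<Rightarrow> 'a set \<Rightarrow> ('a \<Rightarrow> real \<Rightarrow> real) \<Rightarrow> real \<Rightarrow> bool" where
  "compresses G S f \<alpha> \<longleftrightarrow> L2_lipschitz G S f \<and>
     (\<exists>c>0. \<forall>x\<in>carrier G. \<forall>y\<in>carrier G. x \<noteq> y \<longrightarrow>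
        c * real (word_dist G S x y) powr \<alpha> \<le> L2_norm (\<lambda>t. f x t - f y t))"

definition has_speed :: "('a, 'b) monoid_scheme \<Rightarrow> 'a set \<Rightarrow> real \<Rightarrow> bool" where
  "has_speed G S \<beta> \<longleftrightarrow> (\<exists>c>0. \<forall>t. c * real t powr \<beta> \<le>
     measure_pmf.expectation (srw G S t) (\<lambda>w. real (word_dist G S w \<one>\<^bsub>G\<^esub>)))"

definition compression_exponents :: "('a, 'b) monoid_scheme \<Rightarrow> real set" where
  "compression_exponents G = {\<alpha>. \<alpha> \<ge> 0 \<and> (\<exists>S f. sym_gen_set G S \<and> compresses G S f \<alpha>)}"

definition speed_exponents :: "('a, 'b) monoid_scheme \<Rightarrow> real set" where
  "speed_exponents G = {\<beta>. \<beta> \<ge> 0 \<and> (\<exists>S. sym_gen_set G S \<and> has_speed G S \<beta>)}"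

lemma alpha_star_Sup: "alpha_star G = Sup (ereal ` compression_exponents G)"
  by (simp add: alpha_star_def compression_exponents_def compresses_def)

lemma beta_star_Sup: "beta_star G = Sup (ereal ` speed_exponents G)"
  by (simp add: beta_star_def speed_exponents_def has_speed_def)

context cayley
begin

text \<open>The passage from embeddings to kernels, and back in the next lemma.\<close>

lemma kernel_of_compression:
  assumes "compresses G S f \<alpha>"
  obtains K L c where "cnd_on (carrier G) K" "L \<ge> 0" "c > 0"
    "\<And>x y. x \<in> carrier G \<Longrightarrow> y \<in> carrier G \<Longrightarrow> K x y \<le> L\<^sup>2 * (real (word_dist G S x y))\<^sup>2"
    "\<And>x y. x \<in> carrier G \<Longrightarrow> y \<in> carrier G \<Longrightarrow> c * real (word_dist G S x y) powr (2 * \<alpha>) \<le> K x y"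
proof -
  obtain L where L: "L \<ge> 0" "\<And>x y. x \<in> carrier G \<Longrightarrow> y \<in> carrier G \<Longrightarrow>
      L2_norm (\<lambda>t. f x t - f y t) \<le> L * real (word_dist G S x y)"
    and fL: "\<And>x. x \<in> carrier G \<Longrightarrow> f x \<in> L2_funs"
    using assms[unfolded compresses_def, THEN conjunct1] unfolding L2_lipschitz_def by blast
  obtain c where c: "c > 0" "\<And>x y. x \<in> carrier G \<Longrightarrow> y \<in> carrier G \<Longrightarrow> x \<noteq> y \<Longrightarrow>
      c * real (word_dist G S x y) powr \<alpha> \<le> L2_norm (\<lambda>t. f x t - f y t)"
    using assms[unfolded compresses_def, THEN conjunct2] by blast
  define K where "K x y = (L2_norm (\<lambda>t. f x t - f y t))\<^sup>2" for x y
  show ?thesis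
  proof (rule that)
    show K: "cnd_on (carrier G) K" unfolding K_def by (rule cnd_on_L2_distance) (rule fL)
    show "c\<^sup>2 > 0" using c by simp
    fix x y assume xy: "x \<in> carrier G" "y \<in> carrier G"
    show "K x y \<le> L\<^sup>2 * (real (word_dist G S x y))\<^sup>2"
      unfolding K_def power_mult_distrib[symmetric]
      using L(2)[OF xy] by (intro power_mono) (auto simp: L2_norm_def)
    show "c\<^sup>2 * real (word_dist G S x y) powr (2 * \<alpha>) \<le> K x y"
    proof (cases "x = y")
      case False
      then have "(c * real (word_dist G S x y) powr \<alpha>)\<^sup>2 \<le> K x y"
        unfolding K_def using c xy by (intro power_mono) auto
      moreover have "(real (word_dist G S x y) powr \<alpha>)\<^sup>2 = real (word_dist G S x y) powr (2 * \<alpha>)"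
        by (simp add: power2_eq_square powr_add[symmetric])
      ultimately show ?thesis by (simp add: power_mult_distrib)
    qed (use xy cnd_on_nonneg[OF K xy] dist_eq_0[OF xy] in simp)
  qed (rule L(1))
qed

lemma compression_of_kernel:
  assumes K: "cnd_on (carrier G) K" and "C \<ge> 0" "b > 0"
    and upper: "\<And>x y. x \<in> carrier G \<Longrightarrow> y \<in> carrier G \<Longrightarrow> K x y \<le> C * (real (word_dist G S x y))\<^sup>2"
    and lower: "\<And>x y. x \<in> carrier G \<Longrightarrow> y \<in> carrier G \<Longrightarrow> x \<noteq> y \<Longrightarrow>
       b * real (word_dist G S x y) powr (2 * \<alpha>) \<le> K x y"
  obtains f where "compresses G S f \<alpha>"
proof -
  obtain f where f: "\<And>x. x \<in> carrier G \<Longrightarrow> f x \<in> L2_funs"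
    "\<And>x y. x \<in> carrier G \<Longrightarrow> y \<in> carrier G \<Longrightarrow> L2_norm (\<lambda>t. f x t - f y t) = sqrt (K x y)"
    using cnd_realization[OF countable_carrier K] by blast
  have "L2_lipschitz G S f"
    unfolding L2_lipschitz_def
  proof (intro conjI ballI exI[of _ "sqrt C"])
    fix x y assume xy: "x \<in> carrier G" "y \<in> carrier G"
    have "sqrt (K x y) \<le> sqrt (C * (real (word_dist G S x y))\<^sup>2)" using upper[OF xy] by simp
    then show "L2_norm (\<lambda>t. f x t - f y t) \<le> sqrt C * real (word_dist G S x y)"
      using f(2)[OF xy] by (simp add: real_sqrt_mult)
  qed (use f(1) assms(2) in auto)
  moreover have "sqrt b * real (word_dist G S x y) powr \<alpha> \<le> L2_norm (\<lambda>t. f x t - f y t)"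
    if xy: "x \<in> carrier G" "y \<in> carrier G" "x \<noteq> y" for x y
  proof -
    have "b * (real (word_dist G S x y) powr \<alpha>)\<^sup>2 \<le> K x y"
      using lower[OF xy] by (simp add: power2_eq_square powr_add[symmetric])
    then have "sqrt (b * (real (word_dist G S x y) powr \<alpha>)\<^sup>2) \<le> sqrt (K x y)" by simp
    then show ?thesis using f(2)[OF xy(1,2)] by (simp add: real_sqrt_mult)
  qed
  ultimately have "compresses G S f \<alpha>"
    unfolding compresses_def using assms(3) by (intro conjI exI[of _ "sqrt b"]) auto
  then show ?thesis by (rule that)
qed

end

section \<open>Almost invariant means\<close>

definition mean_on :: "'a set \<Rightarrow> (('a \<Rightarrow> real) \<Rightarrow> real) \<Rightarrow> bool" where
  "mean_on A m \<longleftrightarrow>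
     (\<forall>f h. bounded (f ` A) \<longrightarrow> bounded (h ` A) \<longrightarrow> m (\<lambda>x. f x + h x) = m f + m h) \<and>
     (\<forall>f a. bounded (f ` A) \<longrightarrow> m (\<lambda>x. a * f x) = a * m f) \<and>
     (\<forall>f. bounded (f ` A) \<longrightarrow> (\<forall>x\<in>A. 0 \<le> f x) \<longrightarrow> 0 \<le> m f) \<and>
     m (\<lambda>x. 1) = 1"

definition almost_invariant ::
  "('a, 'b) monoid_scheme \<Rightarrow> 'a set \<Rightarrow> real \<Rightarrow> (('a \<Rightarrow> real) \<Rightarrow> real) \<Rightarrow> bool" where
  "almost_invariant G F \<epsilon> m \<longleftrightarrow>
     (\<forall>g\<in>F. \<forall>\<phi> B. (\<forall>x\<in>carrier G. \<bar>\<phi> x\<bar> \<le> B) \<longrightarrow> \<bar>m (\<lambda>z. \<phi> (z \<otimes>\<^bsub>G\<^esub> g)) - m \<phi>\<bar> \<le> \<epsilon> * B)"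

text \<open>Invariance up to \<open>\<epsilon>\<close> under finitely many translations suffices for arguments that involve
  the walk up to a bounded time. An invariant mean on \<open>G \<wr> \<int>\<close> would require a limit point, whereas
  an almost invariant one is given by a finite formula in terms of one on \<open>G\<close>.\<close>

definition approx_amenable :: "('a, 'b) monoid_scheme \<Rightarrow> bool" where
  "approx_amenable G \<longleftrightarrow> (\<forall>F \<epsilon>. finite F \<longrightarrow> F \<subseteq> carrier G \<longrightarrow> \<epsilon> > 0 \<longrightarrow>
     (\<exists>m. mean_on (carrier G) m \<and> almost_invariant G F \<epsilon> m))"

lemma bounded_imageI: "(\<And>x. x \<in> A \<Longrightarrow> \<bar>f x\<bar> \<le> B) \<Longrightarrow> bounded (f ` A :: real set)"
  unfolding bounded_iff by auto

lemma mean_onD: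
  assumes "mean_on A m"
  shows mean_add: "bounded (f ` A) \<Longrightarrow> bounded (h ` A) \<Longrightarrow> m (\<lambda>x. f x + h x) = m f + m h"
    and mean_mult: "bounded (f ` A) \<Longrightarrow> m (\<lambda>x. a * f x) = a * m f"
    and mean_nonneg: "bounded (f ` A) \<Longrightarrow> (\<And>x. x \<in> A \<Longrightarrow> 0 \<le> f x) \<Longrightarrow> 0 \<le> m f"
    and mean_one: "m (\<lambda>x. 1) = 1"
  using assms unfolding mean_on_def by blast+

lemma mean_const: assumes "mean_on A m" shows "m (\<lambda>x. a) = a"
  using mean_mult[OF assms, of "\<lambda>x. 1" a] mean_one[OF assms] by (auto simp: image_constant_conv)

lemma mean_mono:
  assumes m: "mean_on A m" and f: "bounded (f ` A)" and h: "bounded (h ` A)"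
    and le: "\<And>x. x \<in> A \<Longrightarrow> f x \<le> h x"
  shows "m f \<le> m h"
proof -
  have neg: "bounded ((\<lambda>x. (-1) * f x) ` A)"
    using f unfolding bounded_iff by auto
  have "bounded ((\<lambda>x. h x + (-1) * f x) ` A)"
    using bounded_plus_comp[OF h neg] by simp
  then have "0 \<le> m (\<lambda>x. h x + (-1) * f x)"
    using le by (intro mean_nonneg[OF m]) auto
  also have "\<dots> = m h + (-1) * m f"
    using mean_add[OF m h neg] mean_mult[OF m f, of "-1"] by simp
  finally show ?thesis by simp
qed

lemma mean_cong:
  assumes m: "mean_on A m" and f: "bounded (f ` A)" and eq: "\<And>x. x \<in> A \<Longrightarrow> f x = h x"
  shows "m f = m h"
proof -
  have h: "bounded (h ` A)" using f image_cong[OF refl eq, of A] by simp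
  show ?thesis
    by (rule antisym) (auto intro!: mean_mono[OF m] f h simp: eq)
qed

lemma mean_abs_le:
  assumes m: "mean_on A m" and "\<And>x. x \<in> A \<Longrightarrow> \<bar>f x\<bar> \<le> B"
  shows "\<bar>m f\<bar> \<le> B"
proof -
  have f: "bounded (f ` A)" by (rule bounded_imageI) (rule assms)
  have "m f \<le> m (\<lambda>_. B)" "m (\<lambda>_. - B) \<le> m f"
    using assms(2) by (auto intro!: mean_mono[OF m f] mean_mono[OF m _ f] bounded_imageI simp: abs_le_iff)
       (metis minus_le_iff)
  then show ?thesis by (simp add: mean_const[OF m] abs_le_iff)
qed

lemma mean_sum:
  assumes m: "mean_on A m" and "finite I" "\<And>i. i \<in> I \<Longrightarrow> bounded (f i ` A)"
  shows "bounded ((\<lambda>x. \<Sum>i\<in>I. a i * f i x) ` A) \<and> m (\<lambda>x. \<Sum>i\<in>I. a i * f i x) = (\<Sum>i\<in>I. a i * m (f i))"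
  using assms(2,3)
proof (induction I)
  case empty
  then show ?case by (auto simp: mean_const[OF m] image_constant_conv)
next
  case (insert i I)
  have 1: "bounded ((\<lambda>x. a i * f i x) ` A)"
    using insert.prems[of i] bounded_scaling[of "f i ` A" "a i"] by (simp add: image_image)
  have 2: "bounded ((\<lambda>x. \<Sum>i\<in>I. a i * f i x) ` A)" using insert by simp
  show ?case
    using bounded_plus_comp[OF 1 2] mean_add[OF m 1 2] mean_mult[OF m insert.prems[of i], of "a i"]
      insert by simp
qed

lemma approx_amenable_of_amenable:
  assumes "group G" "amenable G"
  shows "approx_amenable G"
proof -
  interpret group G by fact
  obtain m :: "('a \<Rightarrow> real) \<Rightarrow> real" where
    add: "\<And>f h. f \<in> bounded_funs G \<Longrightarrow> h \<in> bounded_funs G \<Longrightarrow> m (\<lambda>x. f x + h x) = m f + m h" and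
    mult: "\<And>f a. f \<in> bounded_funs G \<Longrightarrow> m (\<lambda>x. a * f x) = a * m f" and
    nonneg: "\<And>f. f \<in> bounded_funs G \<Longrightarrow> \<forall>x\<in>carrier G. 0 \<le> f x \<Longrightarrow> 0 \<le> m f" and
    one: "m (\<lambda>x. 1) = 1" and
    inv: "\<And>f g. f \<in> bounded_funs G \<Longrightarrow> g \<in> carrier G \<Longrightarrow> m (\<lambda>x. f (g \<otimes>\<^bsub>G\<^esub> x)) = m f"
    using assms(2) unfolding amenable_def by blast
  have bdd: "f \<in> bounded_funs G \<longleftrightarrow> bounded (f ` carrier G)" for f :: "'a \<Rightarrow> real"
    by (simp add: bounded_funs_def)
  have mean: "mean_on (carrier G) m"
    unfolding mean_on_def using add mult nonneg one by (simp add: bdd)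
  \<comment> \<open>Inversion turns the left invariant mean into a right invariant one.\<close>
  define r where "r = (\<lambda>\<phi>. m (\<lambda>z. \<phi> (inv\<^bsub>G\<^esub> z)))"
  have bdd_inv: "bounded ((\<lambda>z. \<phi> (inv\<^bsub>G\<^esub> z)) ` carrier G)" if "bounded (\<phi> ` carrier G)" for \<phi> :: "'a \<Rightarrow> real"
    by (rule bounded_subset[OF that]) auto
  have mean_r: "mean_on (carrier G) r"
    unfolding mean_on_def r_def using add mult nonneg one bdd_inv by (simp add: bdd)
  have invar: "r (\<lambda>z. \<phi> (z \<otimes>\<^bsub>G\<^esub> g)) = r \<phi>" if g: "g \<in> carrier G" and \<phi>: "bounded (\<phi> ` carrier G)" for \<phi> g
  proof -
    have "r (\<lambda>z. \<phi> (z \<otimes>\<^bsub>G\<^esub> g)) = m (\<lambda>z. \<phi> (inv\<^bsub>G\<^esub> (inv\<^bsub>G\<^esub> g \<otimes>\<^bsub>G\<^esub> z)))"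
      unfolding r_def
    proof (rule mean_cong[OF mean])
      show "bounded ((\<lambda>z. \<phi> (inv\<^bsub>G\<^esub> z \<otimes>\<^bsub>G\<^esub> g)) ` carrier G)"
        by (rule bounded_subset[OF \<phi>]) (use g in auto)
    qed (use g in \<open>simp add: inv_mult_group\<close>)
    also have "\<dots> = r \<phi>"
      using inv[of "\<lambda>z. \<phi> (inv\<^bsub>G\<^esub> z)" "inv\<^bsub>G\<^esub> g"] g bdd_inv[OF \<phi>] by (simp add: bdd r_def)
    finally show ?thesis .
  qed
  have B_nonneg: "0 \<le> B" if "\<And>x. x \<in> carrier G \<Longrightarrow> \<bar>\<phi> x\<bar> \<le> B" for \<phi> :: "'a \<Rightarrow> real" and B
    using that[of "\<one>\<^bsub>G\<^esub>"] by auto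
  show ?thesis
    unfolding approx_amenable_def almost_invariant_def
  proof (intro allI impI exI[of _ r] conjI ballI)
    fix F g \<phi> and \<epsilon> B :: real
    assume *: "F \<subseteq> carrier G" "0 < \<epsilon>" "g \<in> F" "\<forall>x\<in>carrier G. \<bar>\<phi> x\<bar> \<le> B"
    have "r (\<lambda>z. \<phi> (z \<otimes>\<^bsub>G\<^esub> g)) = r \<phi>"
      using * by (intro invar bounded_imageI) auto
    then show "\<bar>r (\<lambda>z. \<phi> (z \<otimes>\<^bsub>G\<^esub> g)) - r \<phi>\<bar> \<le> \<epsilon> * B"
      using * B_nonneg[of \<phi> B] by simp
  qed (use mean_r in simp)
qed

text \<open>Translations compose, so almost invariance only has to be checked on generators.\<close>

lemma (in cayley) approx_amenable_if_generators:
  assumes "\<And>\<epsilon>. \<epsilon> > 0 \<Longrightarrow> \<exists>m. mean_on (carrier G) m \<and> almost_invariant G S \<epsilon> m"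
  shows "approx_amenable G"
  unfolding approx_amenable_def
proof (intro allI impI)
  fix F and \<epsilon> :: real
  assume F: "finite F" "F \<subseteq> carrier G" and \<epsilon>: "\<epsilon> > 0"
  obtain n where n: "\<And>g. g \<in> F \<Longrightarrow> len g \<le> n"
    using finite_nat_set_iff_bounded_le[of "len ` F"] F by auto
  define \<delta> where "\<delta> = \<epsilon> / (n + 1)"
  have \<delta>: "\<delta> > 0" "\<delta> * n \<le> \<epsilon>" using \<epsilon> by (auto simp: \<delta>_def field_simps)
  obtain m where m: "mean_on (carrier G) m" "almost_invariant G S \<delta> m"
    using assms[OF \<delta>(1)] by blast
  have words: "\<bar>m (\<lambda>z. \<phi> (z \<otimes> foldr (mult G) ws \<one>)) - m \<phi>\<bar> \<le> \<delta> * length ws * B"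
    if "set ws \<subseteq> S" and \<phi>: "\<And>x. x \<in> carrier G \<Longrightarrow> \<bar>\<phi> x\<bar> \<le> B" for ws \<phi> B
    using that(1)
  proof (induction ws)
    case Nil
    have "m (\<lambda>z. \<phi> (z \<otimes> \<one>)) = m \<phi>"
      by (rule mean_cong[OF m(1)]) (auto intro!: bounded_imageI \<phi>)
    then show ?case by simp
  next
    case (Cons s ws)
    let ?w = "foldr (mult G) ws \<one>"
    have w: "?w \<in> carrier G" "s \<in> carrier G" using Cons.prems by auto
    have "m (\<lambda>z. \<phi> (z \<otimes> (s \<otimes> ?w))) = m (\<lambda>z. \<phi> (z \<otimes> s \<otimes> ?w))"
      by (rule mean_cong[OF m(1)]) (use w in \<open>auto intro!: bounded_imageI \<phi> simp: m_assoc\<close>)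
    moreover have "\<bar>m (\<lambda>z. \<phi> (z \<otimes> s \<otimes> ?w)) - m (\<lambda>z. \<phi> (z \<otimes> ?w))\<bar> \<le> \<delta> * B"
      using m(2)[unfolded almost_invariant_def, rule_format, of s "\<lambda>z. \<phi> (z \<otimes> ?w)" B] \<phi> w Cons.prems
      by auto
    moreover have "\<bar>m (\<lambda>z. \<phi> (z \<otimes> ?w)) - m \<phi>\<bar> \<le> \<delta> * length ws * B"
      using Cons by auto
    ultimately show ?case by (simp add: algebra_simps)
  qed
  have "almost_invariant G F \<epsilon> m"
    unfolding almost_invariant_def
  proof (intro ballI allI impI)
    fix g \<phi> and B :: real assume g: "g \<in> F" and \<phi>: "\<forall>x\<in>carrier G. \<bar>\<phi> x\<bar> \<le> B"
    then have "g \<in> carrier G" using F by auto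
    then obtain ws where ws: "set ws \<subseteq> S" "length ws = len g" "foldr (mult G) ws \<one> = g"
      by (rule len_attained)
    have B: "0 \<le> B" using \<phi> one_closed by (metis abs_ge_zero order_trans)
    have "\<bar>m (\<lambda>z. \<phi> (z \<otimes> g)) - m \<phi>\<bar> \<le> \<delta> * len g * B"
      using words[OF ws(1), of \<phi> B] \<phi> ws by auto
    also have "\<dots> \<le> \<delta> * n * B"
      using n[OF g] \<delta>(1) B by (intro mult_right_mono mult_left_mono) auto
    also have "\<dots> \<le> \<epsilon> * B"
      using \<delta>(2) B by (intro mult_right_mono)
    finally show "\<bar>m (\<lambda>z. \<phi> (z \<otimes> g)) - m \<phi>\<bar> \<le> \<epsilon> * B" .
  qed
  then show "\<exists>m. mean_on (carrier G) m \<and> almost_invariant G F \<epsilon> m"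
    using m(1) by blast
qed

section \<open>Compression bounds speed\<close>

text \<open>A linear lower bound of a power, with a free parameter \<open>l\<close>. If \<open>l\<close> is a fixed fraction of the
  mean of \<open>d\<close>, summing or integrating it gives Jensen's inequality up to a constant.\<close>

lemma powr_ge_linear:
  fixes d l p :: real
  assumes "d \<ge> 0" "l > 0" "p \<ge> 1"
  shows "d * l powr (p - 1) - l powr p \<le> d powr p"
proof (cases "d \<ge> l")
  case True
  have "d powr p = d * d powr (p - 1)"
    using True assms by (simp add: powr_diff)
  moreover have "l powr (p - 1) \<le> d powr (p - 1)"
    using True assms by (intro powr_mono2) auto
  ultimately have "d * l powr (p - 1) \<le> d powr p"
    using assms by (simp add: mult_left_mono)
  then show ?thesis using powr_ge_zero[of l p] by linarith
next
  case False
  have "d * l powr (p - 1) \<le> l * l powr (p - 1)"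
    using False by (intro mult_right_mono) auto
  also have "\<dots> = l powr p" using assms by (simp add: powr_diff)
  finally show ?thesis using powr_ge_zero[of d p] by linarith
qed

lemma exponent_le_if_dyadic_bound:
  fixes a b x y :: real
  assumes "a > 0" and le: "\<And>k::nat. a * 2 powr (real k * x) \<le> b * 2 powr (real k * y)"
  shows "x \<le> y"
proof (rule ccontr)
  assume "\<not> x \<le> y"
  then have "1 < 2 powr (x - y)" by (simp add: gr_one_powr)
  then obtain k where k: "b / a < (2 powr (x - y)) ^ k"
    using real_arch_pow by blast
  have "(2 powr (x - y)) ^ k = 2 powr (real k * x) / 2 powr (real k * y)"
    by (simp add: powr_realpow[symmetric] powr_powr powr_diff[symmetric] algebra_simps)
  also have "\<dots> \<le> b / a"
    using le[of k] assms(1) by (simp add: field_simps)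
  finally show False using k by simp
qed

context cayley_walk
begin

lemma mean_expectation:
  assumes m: "mean_on A m" and "\<And>x. x \<in> carrier G \<Longrightarrow> bounded ((\<lambda>z. \<phi> z x) ` A)"
  shows "bounded ((\<lambda>z. E t (\<phi> z)) ` A)" "m (\<lambda>z. E t (\<phi> z)) = E t (\<lambda>x. m (\<lambda>z. \<phi> z x))"
  unfolding E_sum_support
  using mean_sum[OF m finite_set_srw, of t "\<lambda>x z. \<phi> z x" "pmf (srw G S t)"] assms(2) set_srw[of t]
  by auto

text \<open>Negative definiteness tested on the signed measure \<open>law (W t) - \<delta>\<^sub>1\<close>.\<close>

lemma cnd_walk_inequality:
  assumes K: "cnd_on (carrier G) K"
  shows "E t (\<lambda>x. E t (K x)) \<le> 2 * E t (K \<one>)"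
proof -
  define F where "F = insert \<one> (set_pmf (srw G S t))"
  define c where "c x = pmf (srw G S t) x - (if x = \<one> then 1 else 0)" for x
  have F: "finite F" "F \<subseteq> carrier G" using set_srw[of t] by (auto simp: F_def)
  have sum_c: "(\<Sum>x\<in>F. c x * h x) = E t h - h \<one>" for h
  proof -
    have "(\<Sum>x\<in>F. (if x = \<one> then 1 else 0) * h x) = (\<Sum>x\<in>F. if x = \<one> then h x else 0)"
      by (intro sum.cong) auto
    also have "\<dots> = h \<one>" using F by (simp add: sum.delta) (simp add: F_def)
    finally have "(\<Sum>x\<in>F. (if x = \<one> then 1 else 0) * h x) = h \<one>" .
    moreover have "E t h = (\<Sum>x\<in>F. pmf (srw G S t) x * h x)"
      by (subst integral_measure_pmf[of F]) (auto simp: F_def)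
    ultimately show ?thesis by (simp add: c_def left_diff_distrib sum_subtractf)
  qed
  have "sum c F = 0" using sum_c[of "\<lambda>_. 1"] by simp
  then have "(\<Sum>x\<in>F. \<Sum>y\<in>F. c x * c y * K x y) \<le> 0" by (rule cnd_onD(3)[OF K F])
  also have "(\<Sum>x\<in>F. \<Sum>y\<in>F. c x * c y * K x y) = (\<Sum>x\<in>F. c x * (\<Sum>y\<in>F. c y * K x y))"
    by (simp add: sum_distrib_left mult_ac)
  also have "\<dots> = E t (\<lambda>x. E t (K x) - K x \<one>) - (E t (K \<one>) - K \<one> \<one>)"
    by (simp only: sum_c)
  also have "\<dots> = E t (\<lambda>x. E t (K x)) - E t (\<lambda>x. K x \<one>) - E t (K \<one>)"
    using cnd_onD(2)[OF K one_closed] by simp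
  also have "E t (\<lambda>x. K x \<one>) = E t (K \<one>)"
    using cnd_onD(1)[OF K] by (intro E_cong) auto
  finally show ?thesis by simp
qed

text \<open>Averaging \<open>K\<close> over left translates makes it almost a function \<open>\<psi>\<close> of \<open>x\<inverse>y\<close>. As
  \<open>x\<inverse>y\<close> for two independent copies of \<open>W t\<close> is distributed like \<open>W (2 t)\<close>, the previous
  inequality says that, up to a small error, the expectation of \<open>\<psi>\<close> at most doubles when the
  time doubles.\<close>

lemma averaged_kernel_doubling:
  assumes K: "cnd_on (carrier G) K"
    and bound: "\<And>x y. x \<in> carrier G \<Longrightarrow> y \<in> carrier G \<Longrightarrow> K x y \<le> M * (real (len (inv x \<otimes> y)))\<^sup>2"
    and m: "mean_on (carrier G) m" and inv: "almost_invariant G {g \<in> carrier G. len g \<le> n} \<epsilon> m"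
    and "\<epsilon> \<ge> 0" "M \<ge> 0" "t \<le> n"
  defines "\<psi> \<equiv> \<lambda>h. m (\<lambda>z. K z (z \<otimes> h))"
  shows "E (2 * t) \<psi> \<le> 2 * E t \<psi> + \<epsilon> * (M * (2 * real n)\<^sup>2)"
proof -
  define \<delta> where "\<delta> = \<epsilon> * (M * (2 * real n)\<^sup>2)"
  define \<Psi> where "\<Psi> x y = m (\<lambda>z. K (z \<otimes> x) (z \<otimes> y))" for x y
  have K_abs: "\<bar>K (z \<otimes> x) (z \<otimes> y)\<bar> \<le> M * (real (len (inv x \<otimes> y)))\<^sup>2"
    if "z \<in> carrier G" "x \<in> carrier G" "y \<in> carrier G" for x y z
    using bound[of "z \<otimes> x" "z \<otimes> y"] cnd_on_nonneg[OF K, of "z \<otimes> x" "z \<otimes> y"] that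
      dist_left_mult[of z x y] by (simp add: word_dist_def)
  have bdd: "bounded ((\<lambda>z. K (z \<otimes> x) (z \<otimes> y)) ` carrier G)"
    if "x \<in> carrier G" "y \<in> carrier G" for x y
    using K_abs that by (intro bounded_imageI) auto
  have cnd_z: "cnd_on (carrier G) (\<lambda>x y. K (z \<otimes> x) (z \<otimes> y))" if "z \<in> carrier G" for z
    by (rule cnd_on_pullback[OF K]) (use that in simp)
  have "E t (\<lambda>x. E t (\<lambda>y. \<psi> (inv x \<otimes> y))) \<le> E t (\<lambda>x. E t (\<lambda>y. \<Psi> x y + \<delta>))"
  proof (intro E_mono)
    fix x y assume x: "x \<in> carrier G" "len x \<le> t" and y: "y \<in> carrier G" "len y \<le> t"
    let ?h = "inv x \<otimes> y"
    have h: "?h \<in> carrier G" using x y by simp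
    have "len ?h \<le> 2 * n" using len_mult[of "inv x" y] x y assms(7) by simp
    then have "(real (len ?h))\<^sup>2 \<le> (2 * real n)\<^sup>2" by (intro power_mono) auto
    then have "\<epsilon> * (M * (real (len ?h))\<^sup>2) \<le> \<delta>"
      unfolding \<delta>_def using assms(5,6) by (intro mult_left_mono)
    moreover have "\<bar>m (\<lambda>z. K (z \<otimes> x) (z \<otimes> x \<otimes> ?h)) - \<psi> ?h\<bar> \<le> \<epsilon> * (M * (real (len ?h))\<^sup>2)"
    proof -
      have "\<bar>K z (z \<otimes> ?h)\<bar> \<le> M * (real (len ?h))\<^sup>2" if "z \<in> carrier G" for z
        using K_abs[of z \<one> ?h] h that by simp
      moreover have "x \<in> {g \<in> carrier G. len g \<le> n}" using x assms(7) by auto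
      ultimately show ?thesis
        unfolding \<psi>_def by (intro inv[unfolded almost_invariant_def, rule_format]) auto
    qed
    moreover have "m (\<lambda>z. K (z \<otimes> x) (z \<otimes> x \<otimes> ?h)) = \<Psi> x y"
      unfolding \<Psi>_def
    proof (rule mean_cong[OF m, symmetric, OF bdd])
      fix z assume z: "z \<in> carrier G"
      have "z \<otimes> x \<otimes> ?h = z \<otimes> y" using x y z
        by (simp add: m_assoc) (simp add: m_assoc[symmetric])
      then show "K (z \<otimes> x) (z \<otimes> y) = K (z \<otimes> x) (z \<otimes> x \<otimes> ?h)" by simp
    qed (use x y in auto)
    ultimately show "\<psi> ?h \<le> \<Psi> x y + \<delta>" by linarith
  qed
  also have "\<dots> = E t (\<lambda>x. E t (\<Psi> x)) + \<delta>" by simp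
  finally have upper: "E t (\<lambda>x. E t (\<lambda>y. \<psi> (inv x \<otimes> y))) \<le> E t (\<lambda>x. E t (\<Psi> x)) + \<delta>" .
  have swap: "E t (\<lambda>x. E t (\<Psi> x)) = m (\<lambda>z. E t (\<lambda>x. E t (\<lambda>y. K (z \<otimes> x) (z \<otimes> y))))"
    and bdd2: "bounded ((\<lambda>z. E t (\<lambda>x. E t (\<lambda>y. K (z \<otimes> x) (z \<otimes> y)))) ` carrier G)"
  proof -
    have 1: "bounded ((\<lambda>z. E t (\<lambda>y. K (z \<otimes> x) (z \<otimes> y))) ` carrier G)"
      "m (\<lambda>z. E t (\<lambda>y. K (z \<otimes> x) (z \<otimes> y))) = E t (\<Psi> x)" if "x \<in> carrier G" for x
      using mean_expectation[OF m, of "\<lambda>z y. K (z \<otimes> x) (z \<otimes> y)" t] bdd[OF that] by (auto simp: \<Psi>_def[abs_def])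
    have 2: "m (\<lambda>z. E t (\<lambda>x. E t (\<lambda>y. K (z \<otimes> x) (z \<otimes> y)))) =
        E t (\<lambda>x. m (\<lambda>z. E t (\<lambda>y. K (z \<otimes> x) (z \<otimes> y))))"
      by (rule mean_expectation(2)[OF m]) (rule 1)
    show "E t (\<lambda>x. E t (\<Psi> x)) = m (\<lambda>z. E t (\<lambda>x. E t (\<lambda>y. K (z \<otimes> x) (z \<otimes> y))))"
      unfolding 2 using 1(2) by (intro E_cong) auto
    show "bounded ((\<lambda>z. E t (\<lambda>x. E t (\<lambda>y. K (z \<otimes> x) (z \<otimes> y)))) ` carrier G)"
      by (rule mean_expectation(1)[OF m]) (rule 1)
  qed
  note swap
  also have "m (\<lambda>z. E t (\<lambda>x. E t (\<lambda>y. K (z \<otimes> x) (z \<otimes> y)))) \<le> m (\<lambda>z. 2 * E t (\<lambda>x. K z (z \<otimes> x)))"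
  proof (rule mean_mono[OF m bdd2])
    have bx: "bounded ((\<lambda>z. K z (z \<otimes> x)) ` carrier G)" if "x \<in> carrier G" for x
      using K_abs[of _ \<one> x] that by (intro bounded_imageI) auto
    have "bounded ((\<lambda>z. E t (\<lambda>x. K z (z \<otimes> x))) ` carrier G)"
      by (rule mean_expectation(1)[OF m]) (rule bx)
    from bounded_scaling[OF this, of 2]
    show "bounded ((\<lambda>z. 2 * E t (\<lambda>x. K z (z \<otimes> x))) ` carrier G)" by (simp add: image_image)
    show "E t (\<lambda>x. E t (\<lambda>y. K (z \<otimes> x) (z \<otimes> y))) \<le> 2 * E t (\<lambda>x. K z (z \<otimes> x))" if "z \<in> carrier G" for z
      using cnd_walk_inequality[OF cnd_z[OF that], of t] that by simp
  qed
  also have "m (\<lambda>z. 2 * E t (\<lambda>x. K z (z \<otimes> x))) = 2 * E t \<psi>"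
  proof -
    have bx: "bounded ((\<lambda>z. K z (z \<otimes> x)) ` carrier G)" if "x \<in> carrier G" for x
      using K_abs[of _ \<one> x] that by (intro bounded_imageI) auto
    note mE = mean_expectation[OF m, of "\<lambda>z x. K z (z \<otimes> x)" t, OF bx]
    show ?thesis using mE(2) mean_mult[OF m mE(1), of 2] by (simp add: \<psi>_def)
  qed
  finally have "E t (\<lambda>x. E t (\<Psi> x)) \<le> 2 * E t \<psi>" .
  moreover have "E t (\<lambda>x. E t (\<lambda>y. \<psi> (inv x \<otimes> y))) = E (2 * t) \<psi>"
    using walk_reversal[of t "\<lambda>x. E t (\<lambda>y. \<psi> (x \<otimes> y))"] walk_restart[of t t \<psi>]
    by (simp add: mult_2)
  ultimately show ?thesis using upper by (simp add: \<delta>_def)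
qed

text \<open>The almost invariant mean is chosen after the time \<open>2\<^sup>k\<close>, so that each of the \<open>k\<close> doublings
  costs an error of at most \<open>1\<close>; the induction then bounds the expectation by
  \<open>2\<^sup>j (M + 1) - 1\<close>.\<close>

lemma averaged_kernel_linear_growth:
  assumes amen: "approx_amenable G" and K: "cnd_on (carrier G) K" and "M \<ge> 0"
    and bound: "\<And>x y. x \<in> carrier G \<Longrightarrow> y \<in> carrier G \<Longrightarrow> K x y \<le> M * (real (len (inv x \<otimes> y)))\<^sup>2"
    and lower: "\<And>z h. z \<in> carrier G \<Longrightarrow> h \<in> carrier G \<Longrightarrow> b h \<le> K z (z \<otimes> h)"
  shows "E (2 ^ k) b \<le> 2 ^ k * (M + 1)"
proof -
  define n :: nat where "n = 2 ^ k"
  define \<epsilon> where "\<epsilon> = 1 / (M * (2 * real n)\<^sup>2 + 1)"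
  have pos: "M * (2 * real n)\<^sup>2 + 1 > 0" using assms(3) by (simp add: add_nonneg_pos)
  then have \<epsilon>: "\<epsilon> > 0" "\<epsilon> * (M * (2 * real n)\<^sup>2) \<le> 1" by (auto simp: \<epsilon>_def divide_le_eq)
  obtain m where m: "mean_on (carrier G) m" "almost_invariant G {g \<in> carrier G. len g \<le> n} \<epsilon> m"
    using amen finite_ball[of n] \<epsilon>(1) unfolding approx_amenable_def
    by (metis (no_types, lifting) mem_Collect_eq subsetI)
  define \<psi> where "\<psi> h = m (\<lambda>z. K z (z \<otimes> h))" for h
  have K_abs: "\<bar>K z (z \<otimes> h)\<bar> \<le> M * (real (len h))\<^sup>2" if "z \<in> carrier G" "h \<in> carrier G" for z h
    using bound[of z "z \<otimes> h"] cnd_on_nonneg[OF K, of z "z \<otimes> h"] that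
    by (simp add: m_assoc[symmetric])
  have "E (2 ^ j) \<psi> \<le> 2 ^ j * (M + 1) - 1" if "j \<le> k" for j
    using that
  proof (induction j)
    case 0
    have "\<psi> h \<le> M" if "h \<in> carrier G" "len h \<le> 1" for h
    proof -
      have "\<psi> h \<le> M * (real (len h))\<^sup>2"
        using mean_abs_le[OF m(1), of "\<lambda>z. K z (z \<otimes> h)"] K_abs[OF _ that(1)]
        by (auto simp: \<psi>_def abs_le_iff)
      also have "\<dots> \<le> M * 1\<^sup>2"
        using that assms(3) by (intro mult_left_mono power_mono) auto
      finally show ?thesis by simp
    qed
    then have "E 1 \<psi> \<le> M" by (rule E_le_bound)
    then show ?case by simp
  next
    case (Suc j)
    have "(2::nat) ^ j \<le> n" unfolding n_def using Suc.prems by (intro power_increasing) auto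
    then have "E (2 * 2 ^ j) \<psi> \<le> 2 * E (2 ^ j) \<psi> + \<epsilon> * (M * (2 * real n)\<^sup>2)"
      unfolding \<psi>_def using averaged_kernel_doubling[OF K bound m, of "2 ^ j"] \<epsilon>(1) assms(3) by simp
    also have "\<dots> \<le> 2 * (2 ^ j * (M + 1) - 1) + 1"
      using Suc \<epsilon>(2) by (intro add_mono mult_left_mono) auto
    finally show ?case by (simp add: algebra_simps)
  qed
  from this[of k] have "E (2 ^ k) \<psi> \<le> 2 ^ k * (M + 1)" by linarith
  moreover have "E (2 ^ k) b \<le> E (2 ^ k) \<psi>"
  proof (rule E_mono)
    fix h assume h: "h \<in> carrier G"
    have "b h = m (\<lambda>_. b h)" by (simp add: mean_const[OF m(1)])
    also have "\<dots> \<le> \<psi> h" unfolding \<psi>_def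
      using K_abs h lower by (intro mean_mono[OF m(1)] bounded_imageI) auto
    finally show "b h \<le> \<psi> h" .
  qed
  ultimately show ?thesis by (rule order_trans[rotated])
qed

lemma speed_exponent_le_1:
  assumes "has_speed G S \<beta>" shows "\<beta> \<le> 1"
proof -
  obtain c where c: "c > 0" "\<And>t. c * real t powr \<beta> \<le> E t (\<lambda>w. real (word_dist G S w \<one>))"
    using assms unfolding has_speed_def by blast
  show ?thesis
  proof (rule exponent_le_if_dyadic_bound[OF c(1), where b = 1])
  fix k :: nat
  have "E (2 ^ k) (\<lambda>w. real (word_dist G S w \<one>)) \<le> 2 ^ k"
  proof (rule E_le_bound)
    fix x assume "x \<in> carrier G" "len x \<le> 2 ^ k"
    then show "real (word_dist G S x \<one>) \<le> 2 ^ k"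
      using of_nat_mono[of "len x" "2 ^ k", where ?'a = real] by simp
  qed
  moreover have "real (2 ^ k) powr \<beta> = 2 powr (real k * \<beta>)"
    by (simp add: powr_realpow[symmetric] powr_powr)
  ultimately show "c * 2 powr (real k * \<beta>) \<le> 1 * 2 powr (real k * 1)"
    using c(2)[of "2 ^ k"] by (simp add: powr_realpow)
  qed
qed

end

text \<open>The averaged distance grows at most linearly in time along the walk and dominates
  \<open>d\<^bsup>2\<alpha>\<^esup>\<close>, whereas \<open>d\<close> itself is of order \<open>t\<^bsup>\<beta>\<^esup>\<close>.\<close>

theorem compression_times_speed_le:
  assumes "group G" "infinite (carrier G)" and amen: "approx_amenable G"
    and S: "sym_gen_set G S" "compresses G S f \<alpha>" "\<alpha> \<ge> 0"
    and T: "sym_gen_set G T" "has_speed G T \<beta>" "\<beta> \<ge> 0"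
  shows "2 * \<alpha> * \<beta> \<le> 1"
proof -
  interpret S: cayley G S using assms by (simp add: cayley_def cayley_axioms_def)
  interpret T: cayley_walk G T
    using assms by (simp add: cayley_walk_def cayley_walk_axioms_def cayley_def cayley_axioms_def)
  obtain c' where c': "c' > 0" "\<And>t. c' * real t powr \<beta> \<le> T.E t (\<lambda>w. real (word_dist G T w \<one>\<^bsub>G\<^esub>))"
    using T(2) unfolding has_speed_def by blast
  have \<beta>1: "\<beta> \<le> 1" using T.speed_exponent_le_1[OF T(2)] .
  define p where "p = 2 * \<alpha>"
  obtain K L c where K: "cnd_on (carrier G) K" and "L \<ge> 0" and c: "c > 0"
    and K_upper: "\<And>x y. x \<in> carrier G \<Longrightarrow> y \<in> carrier G \<Longrightarrow> K x y \<le> L\<^sup>2 * (real (word_dist G S x y))\<^sup>2"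
    and K_lower: "\<And>x y. x \<in> carrier G \<Longrightarrow> y \<in> carrier G \<Longrightarrow> c * real (word_dist G S x y) powr p \<le> K x y"
    using S.kernel_of_compression[OF S(2)] unfolding p_def by blast
  obtain A :: real where A: "A > 0" "\<And>g. g \<in> carrier G \<Longrightarrow> S.len g \<le> A * T.len g"
    using word_length_bilipschitz[OF assms(1) T(1) S(1)] by blast
  obtain B :: real where B: "B > 0" "\<And>g. g \<in> carrier G \<Longrightarrow> T.len g \<le> B * S.len g"
    using word_length_bilipschitz[OF assms(1) S(1) T(1)] by blast
  define M where "M = (L * A)\<^sup>2"
  have bound: "K x y \<le> M * (real (T.len (inv\<^bsub>G\<^esub> x \<otimes>\<^bsub>G\<^esub> y)))\<^sup>2" if "x \<in> carrier G" "y \<in> carrier G" for x y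
  proof -
    have "K x y \<le> L\<^sup>2 * (A * real (T.len (inv\<^bsub>G\<^esub> x \<otimes>\<^bsub>G\<^esub> y)))\<^sup>2"
      using A(2)[of "inv\<^bsub>G\<^esub> x \<otimes>\<^bsub>G\<^esub> y"] that
      by (intro order_trans[OF K_upper[OF that]] mult_left_mono power_mono) (auto simp: word_dist_def)
    then show ?thesis by (simp add: M_def power_mult_distrib mult_ac)
  qed
  define c2 where "c2 = c * (1 / B) powr p"
  have c2: "c2 > 0" using c B(1) by (simp add: c2_def)
  have lower: "c2 * real (T.len h) powr p \<le> K z (z \<otimes>\<^bsub>G\<^esub> h)" if zh: "z \<in> carrier G" "h \<in> carrier G" for z h
  proof -
    have "(1 / B * real (T.len h)) powr p \<le> real (S.len h) powr p"
      using B(2)[OF zh(2)] B(1) S(3) by (intro powr_mono2) (auto simp: p_def field_simps)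
    then have "c * ((1 / B) powr p * real (T.len h) powr p) \<le> c * real (S.len h) powr p"
      using c by (intro mult_left_mono) (simp_all only: powr_mult less_imp_le)
    then show ?thesis using K_lower[of z "z \<otimes>\<^bsub>G\<^esub> h"] zh by (simp add: c2_def mult.assoc)
  qed
  show ?thesis
  proof (cases "p \<ge> 1")
    case False
    \<comment> \<open>Speed is at most linear, which settles small \<open>p\<close>.\<close>
    then have "p * \<beta> \<le> 1 * 1" using \<beta>1 T(3) S(3) by (intro mult_mono) (auto simp: p_def)
    then show ?thesis by (simp add: p_def)
  next
    case True
    have "p * \<beta> \<le> 1"
    proof (rule exponent_le_if_dyadic_bound)
      show "c2 * (c' / 2) powr p > 0" using c2 c'(1) by simp
    next
      fix k :: nat
      define u where "u = T.E (2 ^ k) (\<lambda>h. real (T.len h))"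
      have "T.E (2 ^ k) (\<lambda>w. real (word_dist G T w \<one>\<^bsub>G\<^esub>)) = u"
        unfolding u_def by (rule T.E_cong) simp
      then have "c' * real (2 ^ k) powr \<beta> \<le> u" using c'(2) by metis
      then have u: "c' * 2 powr (real k * \<beta>) \<le> u"
        by (simp add: powr_realpow[symmetric] powr_powr)
      then have u0: "u > 0" using c'(1) by (smt (verit) mult_pos_pos powr_gt_zero)
      \<comment> \<open>The linear lower bound of \<open>d powr p\<close> with \<open>l = u / 2\<close> loses only a constant.\<close>
      have "c2 * (u / 2) powr p = c2 * (u * (u / 2) powr (p - 1) - (u / 2) powr p)"
        using u0 by (simp add: powr_diff field_simps)
      also have "\<dots> = T.E (2 ^ k) (\<lambda>h. c2 * (real (T.len h) * (u / 2) powr (p - 1) - (u / 2) powr p))"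
        by (simp add: u_def)
      also have "\<dots> \<le> T.E (2 ^ k) (\<lambda>h. c2 * real (T.len h) powr p)"
        using u0 True c2 by (intro T.E_mono mult_left_mono powr_ge_linear) auto
      also have "\<dots> \<le> 2 ^ k * (M + 1)"
        by (rule T.averaged_kernel_linear_growth[OF amen K _ bound lower]) (auto simp: M_def)
      finally have "c2 * (u / 2) powr p \<le> (M + 1) * 2 powr (real k * 1)"
        by (simp add: powr_realpow mult.commute)
      moreover have "(c' * 2 powr (real k * \<beta>) / 2) powr p \<le> (u / 2) powr p"
        using u c'(1) S(3) by (intro powr_mono2) (auto simp: p_def)
      moreover have "(c' * 2 powr (real k * \<beta>) / 2) powr p = (c' / 2) powr p * 2 powr (real k * (p * \<beta>))"
      proof -
        have "(c' * 2 powr (real k * \<beta>) / 2) powr p = ((c' / 2) * 2 powr (real k * \<beta>)) powr p" by simp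
        also have "\<dots> = (c' / 2) powr p * (2 powr (real k * \<beta>)) powr p"
          by (rule powr_mult)
        finally show ?thesis by (simp add: powr_powr mult_ac)
      qed
      ultimately show "c2 * (c' / 2) powr p * 2 powr (real k * (p * \<beta>)) \<le> (M + 1) * 2 powr (real k * 1)"
        using c2 by (smt (verit, ccfv_SIG) mult.assoc mult_left_mono)
    qed
    then show ?thesis by (simp add: p_def)
  qed
qed

section \<open>The wreath product with the integers\<close>

context cayley
begin

abbreviation W where "W \<equiv> wreath_product G integer_group"

definition lamp where "lamp g = (\<lambda>z::int. if z = 0 then g else \<one>, 0::int)"

definition shift where "shift n = (\<lambda>z::int. \<one>, n::int)"

text \<open>Each generator either changes the lamp at the marker by a generator of \<open>G\<close> or moves the marker,
  so along the walk the lamps are random walks for the generating set \<open>S\<close> itself.\<close>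

definition wreath_gens where "wreath_gens = lamp ` S \<union> {shift 1, shift (-1)}"

lemma W_carrier:
  "(f, x) \<in> carrier W \<longleftrightarrow> (\<forall>z. f z \<in> carrier G) \<and> finite {z. f z \<noteq> \<one>}"
  by (auto simp: wreath_product_def PiE_def Pi_def)

lemma W_carrierD: "(f, x) \<in> carrier W \<Longrightarrow> f z \<in> carrier G"
  by (simp add: W_carrier)

lemma W_carrier_shift: "(f, x) \<in> carrier W \<longleftrightarrow> (f, y) \<in> carrier W"
  by (simp add: W_carrier)

lemma W_mult: "(f, x) \<otimes>\<^bsub>W\<^esub> (g, y) = (\<lambda>z. f z \<otimes> g (z - x), x + y)"
  by (simp add: wreath_product_def fun_eq_iff)

lemma W_one: "\<one>\<^bsub>W\<^esub> = (\<lambda>z. \<one>, 0)"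
  by (simp add: wreath_product_def fun_eq_iff)

lemma group_W: "group W"
  by (intro group_wreath_product) (auto intro: group_axioms)

lemma W_upd: "(f, x) \<in> carrier W \<Longrightarrow> g \<in> carrier G \<Longrightarrow> (f(k := g), y) \<in> carrier W"
  unfolding W_carrier by (auto intro: rev_finite_subset[of "insert k {z. f z \<noteq> \<one>}"])

lemma lamp_carrier: "g \<in> carrier G \<Longrightarrow> lamp g \<in> carrier W"
  unfolding lamp_def W_carrier by (auto intro: finite_subset[of _ "{0}"])

lemma shift_carrier: "shift n \<in> carrier W"
  unfolding shift_def W_carrier by simp

lemma mult_lamp:
  assumes "(f, x) \<in> carrier W" "g \<in> carrier G"
  shows "(f, x) \<otimes>\<^bsub>W\<^esub> lamp g = (f(x := f x \<otimes> g), x)"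
  using W_carrierD[OF assms(1)] by (auto simp: lamp_def W_mult fun_eq_iff)

lemma mult_shift:
  assumes "(f, x) \<in> carrier W"
  shows "(f, x) \<otimes>\<^bsub>W\<^esub> shift n = (f, x + n)"
  using W_carrierD[OF assms(1)] by (auto simp: shift_def W_mult fun_eq_iff)

lemma W_inv_mult:
  assumes "(f, x) \<in> carrier W" "(g, y) \<in> carrier W"
  shows "inv\<^bsub>W\<^esub> (f, x) \<otimes>\<^bsub>W\<^esub> (g, y) = (\<lambda>z. inv f (z + x) \<otimes> g (z + x), y - x)"
proof -
  interpret W: group W by (rule group_W)
  let ?i = "(\<lambda>z. inv f (z + x), - x)"
  have f: "f z \<in> carrier G" for z using W_carrierD[OF assms(1)] .
  have "finite ((\<lambda>z. z + x) -` {z. f z \<noteq> \<one>})"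
    using assms(1) by (intro finite_vimageI) (auto simp: W_carrier intro: injI)
  then have "?i \<in> carrier W"
    unfolding W_carrier using f by (auto simp: vimage_def)
  moreover have "?i \<otimes>\<^bsub>W\<^esub> (f, x) = \<one>\<^bsub>W\<^esub>"
    using f by (simp add: W_mult W_one)
  ultimately have "inv\<^bsub>W\<^esub> (f, x) = ?i"
    using W.inv_equality assms(1) by blast
  then show ?thesis by (simp add: W_mult)
qed

lemma lamp_mult: "g \<in> carrier G \<Longrightarrow> h \<in> carrier G \<Longrightarrow> lamp (g \<otimes> h) = lamp g \<otimes>\<^bsub>W\<^esub> lamp h"
  by (auto simp: lamp_def W_mult fun_eq_iff)

lemma lamp_inv: "g \<in> carrier G \<Longrightarrow> inv\<^bsub>W\<^esub> (lamp g) = lamp (inv g)"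
  using group.inv_equality[OF group_W, of "lamp (inv g)" "lamp g"]
  by (auto simp: lamp_carrier lamp_mult[symmetric]) (auto simp: lamp_def W_one fun_eq_iff)

lemma shift_inv: "inv\<^bsub>W\<^esub> (shift n) = shift (- n)"
proof -
  have "shift (- n) \<otimes>\<^bsub>W\<^esub> shift n = \<one>\<^bsub>W\<^esub>" by (auto simp: shift_def W_mult W_one)
  from group.inv_equality[OF group_W this shift_carrier shift_carrier] show ?thesis .
qed

lemma wreath_gens_carrier: "wreath_gens \<subseteq> carrier W"
  by (auto simp: wreath_gens_def lamp_carrier shift_carrier)

lemma W_generate: "generate W wreath_gens = carrier W"
proof
  interpret W: group W by (rule group_W)
  show "generate W wreath_gens \<subseteq> carrier W"
    using W.generate_incl[OF wreath_gens_carrier] .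
  have lamp: "lamp g \<in> generate W wreath_gens" if "g \<in> carrier G" for g
    using that
  proof (induction g rule: word_induct)
    case one
    have "lamp \<one> = \<one>\<^bsub>W\<^esub>" by (auto simp: lamp_def W_one)
    then show ?case by (simp add: generate.one)
  next
    case (step g s)
    have "lamp s \<in> generate W wreath_gens"
      using step(2) by (intro generate.incl) (simp add: wreath_gens_def)
    then show ?case
      using step by (simp add: lamp_mult generate.eng)
  qed
  have shift_nat: "shift (int n) \<in> generate W wreath_gens \<and> shift (- int n) \<in> generate W wreath_gens" for n
  proof (induction n)
    case 0
    have "shift 0 = \<one>\<^bsub>W\<^esub>" by (auto simp: shift_def W_one)
    then show ?case by (simp add: generate.one)
  next
    case (Suc n)
    have "shift (int n) \<otimes>\<^bsub>W\<^esub> shift 1 = shift (int (Suc n))"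
      "shift (- int n) \<otimes>\<^bsub>W\<^esub> shift (-1) = shift (- int (Suc n))"
      by (auto simp: shift_def W_mult)
    then show ?case
      using Suc generate.incl[of "shift 1" wreath_gens W] generate.incl[of "shift (-1)" wreath_gens W]
        generate.eng[of "shift (int n)" W wreath_gens "shift 1"]
        generate.eng[of "shift (- int n)" W wreath_gens "shift (-1)"]
      by (simp add: wreath_gens_def)
  qed
  have shift: "shift n \<in> generate W wreath_gens" for n
    using shift_nat[of "nat n"] shift_nat[of "nat (- n)"] by (cases "n \<ge> 0") auto
  have "(f, x) \<in> generate W wreath_gens" if "(f, x) \<in> carrier W" for f x
  proof -
    have "finite {z. f z \<noteq> \<one>}" using that by (simp add: W_carrier)
    then show ?thesis using that
    proof (induction "{z. f z \<noteq> \<one>}" arbitrary: f x rule: finite_induct)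
      case empty
      then have "(f, x) = shift x" by (auto simp: shift_def)
      then show ?case using shift by simp
    next
      case (insert k F)
      \<comment> \<open>Write the lamp at \<open>k\<close> last.\<close>
      let ?f = "f(k := \<one>)"
      have *: "(?f, y) \<in> carrier W" for y by (rule W_upd[OF insert.prems]) simp
      have fk: "f k \<in> carrier G" using W_carrierD[OF insert.prems] .
      have "F = {z. ?f z \<noteq> \<one>}" using insert(2,4) by auto
      from insert(3)[OF this *] have "(?f, k) \<in> generate W wreath_gens" .
      moreover have "(?f, k) \<otimes>\<^bsub>W\<^esub> lamp (f k) \<otimes>\<^bsub>W\<^esub> shift (x - k) = (f, x)"
        using mult_lamp[OF * fk] mult_shift[of f k "x - k"] insert.prems fk
        by (simp add: W_carrier_shift[of f k x])
      ultimately show ?case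
        using lamp[OF fk] shift[of "x - k"] by (metis generate.eng)
    qed
  qed
  then show "carrier W \<subseteq> generate W wreath_gens" by auto
qed

lemma cayley_W: "cayley W wreath_gens"
proof -
  have "\<forall>s\<in>wreath_gens. inv\<^bsub>W\<^esub> s \<in> wreath_gens"
    using S_inv by (auto simp: wreath_gens_def lamp_inv shift_inv)
  then show ?thesis
    using group_W W_generate wreath_gens_carrier
    by (auto simp: cayley_def cayley_axioms_def sym_gen_set_def) (simp add: wreath_gens_def)
qed

interpretation W: cayley W wreath_gens by (rule cayley_W)

lemma infinite_W: "infinite (carrier W)"
proof -
  have "inj shift" by (auto simp: inj_def shift_def)
  then have "infinite (range shift)" by (simp add: finite_image_iff)
  then show ?thesis using shift_carrier by (metis finite_subset image_subsetI)
qed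

lemma cayley_walk_W: "cayley_walk W wreath_gens"
  by (intro cayley_walk.intro cayley_W) (simp add: cayley_walk_axioms_def infinite_W)

section \<open>Word length in the wreath product\<close>

lemma len_lamp: "g \<in> carrier G \<Longrightarrow> W.len (lamp g) \<le> len g"
proof -
  assume g: "g \<in> carrier G"
  have "real (W.len (lamp g)) \<le> 1 * real (len g)"
  proof (rule edge_growth_bound[OF g])
    have "lamp \<one> = \<one>\<^bsub>W\<^esub>" by (auto simp: lamp_def W_one)
    then show "real (W.len (lamp \<one>)) \<le> 0" by simp
  next
    fix g s assume gs: "g \<in> carrier G" "s \<in> S"
    have "lamp s \<in> wreath_gens" using gs by (simp add: wreath_gens_def)
    then show "real (W.len (lamp (g \<otimes> s))) \<le> real (W.len (lamp g)) + 1"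
      using W.len_mult[of "lamp g" "lamp s"] W.len_gen[of "lamp s"] gs
      by (simp add: lamp_mult lamp_carrier)
  qed
  then show ?thesis by simp
qed

lemma len_shift_nat: "W.len (shift (int n)) \<le> n" "W.len (shift (- int n)) \<le> n"
proof (induction n)
  case 0
  have "shift 0 = \<one>\<^bsub>W\<^esub>" by (auto simp: shift_def W_one)
  then show "W.len (shift (int 0)) \<le> 0" "W.len (shift (- int 0)) \<le> 0" by simp_all
next
  case (Suc n)
  have eq: "shift (int (Suc n)) = shift (int n) \<otimes>\<^bsub>W\<^esub> shift 1"
    "shift (- int (Suc n)) = shift (- int n) \<otimes>\<^bsub>W\<^esub> shift (-1)"
    by (auto simp: shift_def W_mult)
  have "shift 1 \<in> wreath_gens" "shift (-1) \<in> wreath_gens" by (simp_all add: wreath_gens_def)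
  then have "W.len (shift 1) \<le> 1" "W.len (shift (-1)) \<le> 1" using W.len_gen by blast+
  then show "W.len (shift (int (Suc n))) \<le> Suc n" "W.len (shift (- int (Suc n))) \<le> Suc n"
    unfolding eq using Suc W.len_mult[OF shift_carrier shift_carrier, of "int n" 1]
      W.len_mult[OF shift_carrier shift_carrier, of "- int n" "-1"] by linarith+
qed

lemma len_shift: "W.len (shift n) \<le> nat \<bar>n\<bar>"
  using len_shift_nat[of "nat \<bar>n\<bar>"] by (cases "n \<ge> 0") auto

text \<open>The marker walks to the left end of an interval, sweeps it once to the right while setting
  the lamps, and walks back to its final position.\<close>

lemma len_W_upper:
  assumes W: "(f, x) \<in> carrier W" and x: "\<bar>x\<bar> \<le> int R" and f: "\<And>k. f k \<noteq> \<one> \<Longrightarrow> \<bar>k\<bar> \<le> int R"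
  shows "W.len (f, x) \<le> 5 * R + (\<Sum>k\<in>{- int R..int R}. len (f k))"
proof -
  let ?r = "int R"
  have sweep: "W.len (g, - ?r + int m) \<le> R + m + (\<Sum>k\<in>{- ?r..- ?r + int m}. len (g k))"
    if "(g, - ?r + int m) \<in> carrier W" "\<And>k. g k \<noteq> \<one> \<Longrightarrow> k \<in> {- ?r..- ?r + int m}" for g m
    using that
  proof (induction m arbitrary: g)
    case 0
    let ?g = "g (- ?r)"
    have g: "?g \<in> carrier G" using W_carrierD[OF 0(1)] .
    have "shift (- ?r) \<otimes>\<^bsub>W\<^esub> lamp ?g = (g, - ?r)"
    proof -
      have "(\<lambda>_. \<one>)(- ?r := \<one> \<otimes> ?g) = g"
      proof
        fix z show "((\<lambda>_. \<one>)(- ?r := \<one> \<otimes> ?g)) z = g z"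
          using 0(2)[of z] g by (cases "z = - ?r") auto
      qed
      then show ?thesis
        using mult_lamp[of "\<lambda>_. \<one>" "- ?r" ?g] shift_carrier[of "- ?r"] g by (simp add: shift_def)
    qed
    moreover have "W.len (shift (- ?r)) \<le> R" using len_shift[of "- ?r"] by simp
    ultimately show ?case
      using W.len_mult[OF shift_carrier lamp_carrier[OF g], of "- ?r"] len_lamp[OF g] by simp
  next
    case (Suc m)
    let ?p = "- ?r + int (Suc m)" and ?q = "- ?r + int m"
    let ?h = "g(?p := \<one>)" and ?g = "g ?p"
    have h: "(?h, y) \<in> carrier W" for y by (rule W_upd[OF Suc.prems(1)]) simp
    have g: "?g \<in> carrier G" using W_carrierD[OF Suc.prems(1)] .
    have "(?h, ?q) \<otimes>\<^bsub>W\<^esub> shift 1 = (?h, ?p)" using mult_shift[OF h, of ?q 1] by simp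
    moreover have "(?h, ?p) \<otimes>\<^bsub>W\<^esub> lamp ?g = (g, ?p)" using mult_lamp[OF h g, of ?p] g by simp
    moreover have "W.len ((?h, ?q) \<otimes>\<^bsub>W\<^esub> shift 1) \<le> W.len (?h, ?q) + 1"
      using W.len_mult[OF h shift_carrier, of ?q 1] len_shift[of 1] by simp
    moreover have "W.len ((?h, ?p) \<otimes>\<^bsub>W\<^esub> lamp ?g) \<le> W.len (?h, ?p) + len ?g"
      using W.len_mult[OF h lamp_carrier[OF g], of ?p] len_lamp[OF g] by simp
    moreover have "W.len (?h, ?q) \<le> R + m + (\<Sum>k\<in>{- ?r..?q}. len (?h k))"
    proof (rule Suc.IH[OF h])
      fix k assume "?h k \<noteq> \<one>"
      then show "k \<in> {- ?r..?q}" using Suc.prems(2)[of k] by (auto split: if_splits)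
    qed
    moreover have "(\<Sum>k\<in>{- ?r..?q}. len (?h k)) = (\<Sum>k\<in>{- ?r..?q}. len (g k))"
      by (intro sum.cong) auto
    moreover have "{- ?r..?p} = insert ?p {- ?r..?q}" by auto
    ultimately show ?case by simp
  qed
  have W': "(f, y) \<in> carrier W" for y using W W_carrier_shift by blast
  have "W.len (f, ?r) \<le> 3 * R + (\<Sum>k\<in>{- ?r..?r}. len (f k))"
  proof -
    have eq: "- ?r + int (2 * R) = ?r" by simp
    have "f k \<noteq> \<one> \<Longrightarrow> k \<in> {- ?r..?r}" for k using f[of k] by auto
    from sweep[of f "2 * R", unfolded eq, OF W' this] show ?thesis by simp
  qed
  moreover have "(f, ?r) \<otimes>\<^bsub>W\<^esub> shift (x - ?r) = (f, x)"
    using mult_shift[OF W', of ?r "x - ?r"] by simp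
  moreover have "W.len (shift (x - ?r)) \<le> 2 * R"
    using len_shift[of "x - ?r"] x by linarith
  ultimately show ?thesis
    using W.len_mult[OF W' shift_carrier, of ?r "x - ?r"] by simp
qed

lemma W_gen_cases:
  assumes "s \<in> wreath_gens" "(f, x) \<in> carrier W"
  obtains (Lamp) u where "u \<in> S" "s = lamp u" "(f, x) \<otimes>\<^bsub>W\<^esub> s = (f(x := f x \<otimes> u), x)"
  | (Right) "s = shift 1" "(f, x) \<otimes>\<^bsub>W\<^esub> s = (f, x + 1)"
  | (Left) "s = shift (-1)" "(f, x) \<otimes>\<^bsub>W\<^esub> s = (f, x - 1)"
  using assms mult_lamp[OF assms(2)] mult_shift[OF assms(2), of 1] mult_shift[OF assms(2), of "-1"]
  unfolding wreath_gens_def by auto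

text \<open>A generator changes one lamp at most, and this lamp by a single step.\<close>

lemma len_W_lower:
  assumes W: "(f, x) \<in> carrier W" and A: "finite A"
  shows "(\<Sum>k\<in>A. len (f k)) \<le> W.len (f, x)"
proof -
  have "real (\<Sum>k\<in>A. len (fst (f, x) k)) \<le> 1 * real (W.len (f, x))"
  proof (rule W.edge_growth_bound[OF W])
    show "real (\<Sum>k\<in>A. len (fst \<one>\<^bsub>W\<^esub> k)) \<le> 0" by (simp add: W_one)
  next
    fix p s assume p: "p \<in> carrier W" and s: "s \<in> wreath_gens"
    obtain g y where gy: "p = (g, y)" by (cases p)
    have g: "g k \<in> carrier G" for k using W_carrierD p by (simp add: gy)
    have "(\<Sum>k\<in>A. len ((g(y := g y \<otimes> u)) k)) \<le> (\<Sum>k\<in>A. len (g k) + (if k = y then 1 else 0))"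
      if "u \<in> S" for u
      using len_mult[of "g y" u] len_gen[OF that] that g by (intro sum_mono) auto
    also have "\<dots> \<le> (\<Sum>k\<in>A. len (g k)) + 1"
      using A by (simp add: sum.distrib sum.delta)
    finally have "(\<Sum>k\<in>A. len (fst (p \<otimes>\<^bsub>W\<^esub> s) k)) \<le> (\<Sum>k\<in>A. len (fst p k)) + 1"
      using p s unfolding gy by (cases rule: W_gen_cases[OF s p[unfolded gy]]) auto
    then show "real (\<Sum>k\<in>A. len (fst (p \<otimes>\<^bsub>W\<^esub> s) k)) \<le> real (\<Sum>k\<in>A. len (fst p k)) + 1"
      by linarith
  qed
  then show ?thesis by (simp only: fst_conv mult_1 of_nat_le_iff)
qed

section \<open>Approximate amenability of the wreath product\<close>

abbreviation configs where "configs \<equiv> {c. (c, 0) \<in> carrier W}"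

text \<open>The mean of independent lamps at the sites \<open>0, \<dots>, k - 1\<close>, as an iterated mean; the other lamps
  are trivial.\<close>

primrec lamp_mean :: "(('a \<Rightarrow> real) \<Rightarrow> real) \<Rightarrow> nat \<Rightarrow> ((int \<Rightarrow> 'a) \<Rightarrow> real) \<Rightarrow> real" where
  "lamp_mean m 0 \<Phi> = \<Phi> (\<lambda>_. \<one>)"
| "lamp_mean m (Suc k) \<Phi> = lamp_mean m k (\<lambda>c. m (\<lambda>z. \<Phi> (c(int k := z))))"

lemma configs_upd: "c \<in> configs \<Longrightarrow> z \<in> carrier G \<Longrightarrow> c(k := z) \<in> configs"
  using W_upd by simp

lemma mean_on_lamp_mean:
  assumes m: "mean_on (carrier G) m"
  shows "mean_on configs (lamp_mean m k)"
proof (induction k)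
  case 0
  have "(\<lambda>_. \<one>) \<in> configs" by (simp add: W_carrier)
  then show ?case unfolding mean_on_def by simp
next
  case (Suc k)
  let ?P = "\<lambda>\<Phi> c. m (\<lambda>z. \<Phi> (c(int k := z)))"
  have bdd: "bounded ((\<lambda>z. \<Phi> (c(int k := z))) ` carrier G)"
    if "bounded (\<Phi> ` configs)" "c \<in> configs" for \<Phi> :: "_ \<Rightarrow> real" and c
    by (rule bounded_subset[OF that(1)]) (use configs_upd[OF that(2)] in blast)
  have bddP: "bounded (?P \<Phi> ` configs)" if \<Phi>: "bounded (\<Phi> ` configs)" for \<Phi> :: "_ \<Rightarrow> real"
  proof -
    obtain B where B: "\<And>c. c \<in> configs \<Longrightarrow> \<bar>\<Phi> c\<bar> \<le> B"
      using \<Phi> unfolding bounded_iff by auto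
    show ?thesis
      using B configs_upd by (intro bounded_imageI mean_abs_le[OF m]) blast
  qed
  show ?case
    unfolding mean_on_def lamp_mean.simps
  proof (intro conjI allI impI)
    fix f h :: "(int \<Rightarrow> 'a) \<Rightarrow> real" assume f: "bounded (f ` configs)" and h: "bounded (h ` configs)"
    have "lamp_mean m k (?P (\<lambda>x. f x + h x)) = lamp_mean m k (\<lambda>c. ?P f c + ?P h c)"
    proof (rule mean_cong[OF Suc bddP])
      show "bounded ((\<lambda>x. f x + h x) ` configs)" by (rule bounded_plus_comp[OF f h])
      fix c assume c: "c \<in> configs"
      show "?P (\<lambda>x. f x + h x) c = ?P f c + ?P h c"
        by (rule mean_add[OF m bdd[OF f c] bdd[OF h c]])
    qed
    also have "\<dots> = lamp_mean m k (?P f) + lamp_mean m k (?P h)"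
      by (rule mean_add[OF Suc bddP[OF f] bddP[OF h]])
    finally show "lamp_mean m k (?P (\<lambda>x. f x + h x)) = lamp_mean m k (?P f) + lamp_mean m k (?P h)" .
  next
    fix f :: "(int \<Rightarrow> 'a) \<Rightarrow> real" and a assume f: "bounded (f ` configs)"
    have "bounded ((\<lambda>x. a * f x) ` configs)" using bounded_scaling[OF f, of a] by (simp add: image_image)
    then have "lamp_mean m k (?P (\<lambda>x. a * f x)) = lamp_mean m k (\<lambda>c. a * ?P f c)"
      by (rule mean_cong[OF Suc bddP]) (rule mean_mult[OF m bdd[OF f]])
    also have "\<dots> = a * lamp_mean m k (?P f)"
      by (rule mean_mult[OF Suc bddP[OF f]])
    finally show "lamp_mean m k (?P (\<lambda>x. a * f x)) = a * lamp_mean m k (?P f)" .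
  next
    fix f :: "(int \<Rightarrow> 'a) \<Rightarrow> real" assume f: "bounded (f ` configs)" "\<forall>x\<in>configs. 0 \<le> f x"
    show "0 \<le> lamp_mean m k (?P f)"
    proof (rule mean_nonneg[OF Suc bddP[OF f(1)]])
      fix c assume c: "c \<in> configs"
      show "0 \<le> ?P f c"
        by (rule mean_nonneg[OF m bdd[OF f(1) c]]) (use f(2) configs_upd[OF c] in blast)
    qed
  next
    show "lamp_mean m k (\<lambda>c. m (\<lambda>z. 1)) = 1"
      by (simp add: mean_one[OF m] mean_one[OF Suc])
  qed
qed

lemma mean_diff_abs_le:
  assumes m: "mean_on A m" and f: "bounded (f ` A)" and h: "bounded (h ` A)"
    and le: "\<And>x. x \<in> A \<Longrightarrow> \<bar>f x - h x\<bar> \<le> (B::real)"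
  shows "\<bar>m f - m h\<bar> \<le> B"
proof -
  have 1: "bounded ((\<lambda>x. (-1) * h x) ` A)" using h unfolding bounded_iff by auto
  have "m (\<lambda>x. f x + (-1) * h x) = m f + (-1) * m h"
    using mean_add[OF m f 1] mean_mult[OF m h, of "-1"] by simp
  moreover have "\<bar>m (\<lambda>x. f x + (-1) * h x)\<bar> \<le> B"
    using le by (intro mean_abs_le[OF m]) auto
  ultimately show ?thesis by simp
qed

text \<open>Multiplying the lamp at \<open>y\<close> only affects the factor of the iterated mean that belongs to \<open>y\<close>.\<close>

lemma lamp_mean_almost_invariant:
  assumes m: "mean_on (carrier G) m" "almost_invariant G S \<epsilon> m" and s: "s \<in> S"
    and "y < k" and \<Phi>: "\<And>c. c \<in> configs \<Longrightarrow> \<bar>\<Phi> c\<bar> \<le> B"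
  shows "\<bar>lamp_mean m k (\<lambda>c. \<Phi> (c(int y := c (int y) \<otimes> s))) - lamp_mean m k \<Phi>\<bar> \<le> \<epsilon> * B"
  using assms(4) \<Phi>
proof (induction k arbitrary: \<Phi>)
  case (Suc k)
  have abs: "\<bar>\<Phi> ((c(int k := z)))\<bar> \<le> B" if "c \<in> configs" "z \<in> carrier G" for c z
    using Suc.prems(2) configs_upd[OF that] .
  let ?P = "\<lambda>c. m (\<lambda>z. \<Phi> (c(int k := z)))"
  have absP: "\<bar>?P c\<bar> \<le> B" if "c \<in> configs" for c
    by (rule mean_abs_le[OF m(1)]) (rule abs[OF that])
  show ?case
  proof (cases "y = k")
    case True
    let ?Q = "\<lambda>c. m (\<lambda>z. \<Phi> (c(int k := z \<otimes> s)))"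
    have absQ: "\<bar>?Q c\<bar> \<le> B" if "c \<in> configs" for c
      by (rule mean_abs_le[OF m(1)]) (use abs[OF that] s in auto)
    have "\<bar>?Q c - ?P c\<bar> \<le> \<epsilon> * B" if "c \<in> configs" for c
      using m(2)[unfolded almost_invariant_def, rule_format, OF s, of "\<lambda>z. \<Phi> (c(int k := z))" B]
        abs[OF that] by auto
    then have "\<bar>lamp_mean m k ?Q - lamp_mean m k ?P\<bar> \<le> \<epsilon> * B"
      using absP absQ
      by (intro mean_diff_abs_le[OF mean_on_lamp_mean[OF m(1)]]) (auto intro!: bounded_imageI)
    moreover have "(c(int k := z))(int y := (c(int k := z)) (int y) \<otimes> s) = c(int k := z \<otimes> s)" for c z
      using True by (simp add: fun_eq_iff)
    ultimately show ?thesis by (simp only: lamp_mean.simps)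
  next
    case False
    then have y: "y < k" using Suc.prems by simp
    have "\<bar>lamp_mean m k (\<lambda>c. ?P (c(int y := c (int y) \<otimes> s))) - lamp_mean m k ?P\<bar> \<le> \<epsilon> * B"
      by (rule Suc.IH[OF y absP])
    moreover have "(c(int k := z))(int y := (c(int k := z)) (int y) \<otimes> s) =
        (c(int y := c (int y) \<otimes> s))(int k := z)" for c z
      using y by (auto simp: fun_eq_iff)
    ultimately show ?thesis by (simp only: lamp_mean.simps)
  qed
qed simp

text \<open>The mean on the wreath product: a uniformly distributed position in \<open>{0..<R}\<close> and
  independent lamps in this window, each distributed according to a mean on \<open>G\<close>. Moving the
  marker changes the position by \<open>1\<close>, and switching changes one lamp inside the window.\<close>

theorem approx_amenable_W:
  assumes "approx_amenable G"
  shows "approx_amenable W"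
proof (rule W.approx_amenable_if_generators)
  fix \<epsilon> :: real assume \<epsilon>: "\<epsilon> > 0"
  obtain m where m: "mean_on (carrier G) m" "almost_invariant G S \<epsilon> m"
    using assms S_finite S_subset \<epsilon> unfolding approx_amenable_def by blast
  obtain R :: nat where R: "2 / \<epsilon> < R" using reals_Archimedean2 by blast
  have R0: "real R > 0" using R \<epsilon> by (smt (verit) divide_pos_pos)
  let ?L = "lamp_mean m R"
  have L: "mean_on configs ?L" by (rule mean_on_lamp_mean[OF m(1)])
  define M where "M \<Psi> = (\<Sum>y<R. ?L (\<lambda>c. \<Psi> (c, int y))) / R" for \<Psi>
  have conf: "(c, y) \<in> carrier W" if "c \<in> configs" for c y
    using that W_carrier_shift by blast
  have bdd: "bounded ((\<lambda>c. \<Psi> (c, y)) ` configs)" if "bounded (\<Psi> ` carrier W)" for \<Psi> :: "_ \<Rightarrow> real" and y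
    by (rule bounded_subset[OF that]) (use conf in blast)
  have "mean_on (carrier W) M"
    unfolding mean_on_def
  proof (intro conjI allI impI)
    fix f h :: "_ \<Rightarrow> real" assume fh: "bounded (f ` carrier W)" "bounded (h ` carrier W)"
    show "M (\<lambda>x. f x + h x) = M f + M h"
      unfolding M_def by (simp add: mean_add[OF L bdd[OF fh(1)] bdd[OF fh(2)]] sum.distrib add_divide_distrib)
  next
    fix f :: "_ \<Rightarrow> real" and a assume f: "bounded (f ` carrier W)"
    show "M (\<lambda>x. a * f x) = a * M f"
      unfolding M_def by (simp add: mean_mult[OF L bdd[OF f]] sum_distrib_left)
  next
    fix f :: "_ \<Rightarrow> real" assume f: "bounded (f ` carrier W)" "\<forall>x\<in>carrier W. 0 \<le> f x"
    show "0 \<le> M f"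
      unfolding M_def using f conf
      by (intro divide_nonneg_nonneg sum_nonneg mean_nonneg[OF L bdd[OF f(1)]]) auto
  next
    show "M (\<lambda>x. 1) = 1" using R0 by (simp add: M_def mean_one[OF L])
  qed
  moreover have "almost_invariant W wreath_gens \<epsilon> M"
    unfolding almost_invariant_def
  proof (intro ballI allI impI)
    fix s \<Psi> and B :: real
    assume s: "s \<in> wreath_gens" and \<Psi>: "\<forall>x\<in>carrier W. \<bar>\<Psi> x\<bar> \<le> B"
    have abs: "\<bar>\<Psi> (c, y)\<bar> \<le> B" if "c \<in> configs" for c y using \<Psi> conf[OF that] by blast
    have B: "0 \<le> B" using \<Psi> W.one_closed by (metis abs_ge_zero order_trans)
    have bdd': "bounded ((\<lambda>c. \<Psi> ((c, y) \<otimes>\<^bsub>W\<^esub> s)) ` configs)" for y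
    proof (rule bounded_imageI)
      fix c assume "c \<in> configs"
      then have "(c, y) \<otimes>\<^bsub>W\<^esub> s \<in> carrier W" using conf s W.S_carrier by blast
      then show "\<bar>\<Psi> ((c, y) \<otimes>\<^bsub>W\<^esub> s)\<bar> \<le> B" using \<Psi> by blast
    qed
    define l where "l y = ?L (\<lambda>c. \<Psi> (c, y))" for y
    have l: "\<bar>l y\<bar> \<le> B" for y unfolding l_def by (rule mean_abs_le[OF L]) (rule abs)
    have eps: "2 * B / R \<le> \<epsilon> * B"
    proof -
      have "2 \<le> \<epsilon> * R" using R \<epsilon> by (simp add: divide_less_eq mult.commute)
      then have "2 * B \<le> \<epsilon> * R * B" using B by (rule mult_right_mono)
      then show ?thesis using R0 by (simp add: divide_le_eq mult_ac)
    qed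
    have MM: "M \<Psi> = (\<Sum>y<R. l (int y)) / R" unfolding M_def l_def ..
    have M_shift: "M (\<lambda>z. \<Psi> (z \<otimes>\<^bsub>W\<^esub> shift n)) = (\<Sum>y<R. l (int y + n)) / R" if "s = shift n" for n
    proof -
      have "?L (\<lambda>c. \<Psi> ((c, y) \<otimes>\<^bsub>W\<^esub> shift n)) = l (y + n)" for y
        unfolding l_def
      proof (rule mean_cong[OF L])
        show "bounded ((\<lambda>c. \<Psi> ((c, y) \<otimes>\<^bsub>W\<^esub> shift n)) ` configs)"
          using bdd'[of y] that by simp
        fix c assume "c \<in> configs"
        then show "\<Psi> ((c, y) \<otimes>\<^bsub>W\<^esub> shift n) = \<Psi> (c, y + n)"
          using mult_shift[OF conf] by simp
      qed
      then show ?thesis unfolding M_def by simp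
    qed
    from s consider (Lamp) u where "u \<in> S" "s = lamp u" | (Right) "s = shift 1" | (Left) "s = shift (-1)"
      unfolding wreath_gens_def by blast
    then show "\<bar>M (\<lambda>z. \<Psi> (z \<otimes>\<^bsub>W\<^esub> s)) - M \<Psi>\<bar> \<le> \<epsilon> * B"
    proof cases
      case Right
      have "(\<Sum>y<R. l (int y + 1)) - (\<Sum>y<R. l (int y)) = l (int R) - l 0"
        using sum_lessThan_telescope[of "\<lambda>y. l (int y)" R] by (simp add: sum_subtractf add.commute)
      then have "M (\<lambda>z. \<Psi> (z \<otimes>\<^bsub>W\<^esub> s)) - M \<Psi> = (l (int R) - l 0) / R"
        using M_shift[OF Right] Right by (simp add: MM diff_divide_distrib[symmetric])
      also have "\<bar>\<dots>\<bar> \<le> 2 * B / R"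
        using l[of "int R"] l[of 0] R0 by (simp add: abs_divide divide_right_mono)
      finally show ?thesis using eps by simp
    next
      case Left
      have "(\<Sum>y<R. l (int y + - 1)) - (\<Sum>y<R. l (int y)) = - (l (int R - 1) - l (- 1))"
        using sum_lessThan_telescope[of "\<lambda>y. l (int y - 1)" R] by (simp add: sum_subtractf)
      then have "M (\<lambda>z. \<Psi> (z \<otimes>\<^bsub>W\<^esub> s)) - M \<Psi> = - (l (int R - 1) - l (- 1)) / R"
        using M_shift[OF Left] Left by (simp add: MM diff_divide_distrib[symmetric])
      also have "\<bar>\<dots>\<bar> \<le> 2 * B / R"
        using l[of "int R - 1"] l[of "-1"] R0 by (simp add: abs_divide divide_right_mono)
      finally show ?thesis using eps by simp
    next
      case Lamp
      have "?L (\<lambda>c. \<Psi> ((c, int y) \<otimes>\<^bsub>W\<^esub> s)) =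
          ?L (\<lambda>c. \<Psi> (c(int y := c (int y) \<otimes> u), int y))" for y
      proof (rule mean_cong[OF L bdd'])
        fix c assume "c \<in> configs"
        then show "\<Psi> ((c, int y) \<otimes>\<^bsub>W\<^esub> s) = \<Psi> (c(int y := c (int y) \<otimes> u), int y)"
          using mult_lamp[OF conf, of c u "int y"] Lamp by simp
      qed
      then have "\<bar>?L (\<lambda>c. \<Psi> ((c, int y) \<otimes>\<^bsub>W\<^esub> s)) - l (int y)\<bar> \<le> \<epsilon> * B" if "y < R" for y
        unfolding l_def
        using lamp_mean_almost_invariant[OF m Lamp(1) that, of "\<lambda>c. \<Psi> (c, int y)" B] abs by simp
      then have "\<bar>\<Sum>y<R. ?L (\<lambda>c. \<Psi> ((c, int y) \<otimes>\<^bsub>W\<^esub> s)) - l (int y)\<bar> \<le> R * (\<epsilon> * B)"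
        by (intro order_trans[OF sum_abs] order_trans[OF sum_bounded_above]) auto
      moreover have "M (\<lambda>z. \<Psi> (z \<otimes>\<^bsub>W\<^esub> s)) - M \<Psi> =
          (\<Sum>y<R. ?L (\<lambda>c. \<Psi> ((c, int y) \<otimes>\<^bsub>W\<^esub> s)) - l (int y)) / R"
        by (simp add: M_def l_def sum_subtractf diff_divide_distrib)
      ultimately show ?thesis
        using R0 by (simp add: abs_divide divide_le_eq mult.commute)
    qed
  qed
  ultimately show "\<exists>m. mean_on (carrier W) m \<and> almost_invariant W wreath_gens \<epsilon> m" by blast
qed

end

section \<open>Local times of a lazy walk on the integers\<close>

text \<open>Expectation with respect to a walk on the integers which in each step stays put with
  probability \<open>p\<close> and then marks its current site, and moves to a uniformly chosen neighbour
  otherwise; the list records the marks, so \<open>count_list ys k\<close> is the local time at \<open>k\<close>.\<close>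

primrec site_mean :: "real \<Rightarrow> nat \<Rightarrow> (int list \<Rightarrow> int \<Rightarrow> real) \<Rightarrow> real" where
  "site_mean p 0 h = h [] 0"
| "site_mean p (Suc t) h = site_mean p t (\<lambda>ys x.
     p * h (x # ys) x + (1 - p) / 2 * (h ys (x + 1) + h ys (x - 1)))"

lemma site_mean_add: "site_mean p t (\<lambda>ys x. f ys x + g ys x) = site_mean p t f + site_mean p t g"
proof (induction t arbitrary: f g)
  case (Suc t)
  show ?case
    unfolding site_mean.simps Suc[symmetric]
    by (rule arg_cong[of _ _ "site_mean p t"]) (simp add: fun_eq_iff algebra_simps)
qed simp

lemma site_mean_mult: "site_mean p t (\<lambda>ys x. a * f ys x) = a * site_mean p t f"
proof (induction t arbitrary: f)
  case (Suc t)
  show ?case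
    unfolding site_mean.simps Suc[symmetric]
    by (rule arg_cong[of _ _ "site_mean p t"]) (simp add: fun_eq_iff algebra_simps)
qed simp

lemma site_mean_const: "site_mean p t (\<lambda>ys x. a) = a"
  by (induction t) (simp_all add: field_simps)

lemma site_mean_sum: "finite I \<Longrightarrow> site_mean p t (\<lambda>ys x. \<Sum>i\<in>I. f i ys x) = (\<Sum>i\<in>I. site_mean p t (f i))"
  by (induction I rule: finite_induct) (simp_all add: site_mean_const site_mean_add)

lemma site_mean_mono:
  assumes "0 \<le> p" "p \<le> 1"
    and "\<And>ys x. set ys \<subseteq> {- int t..int t} \<Longrightarrow> \<bar>x\<bar> \<le> int t \<Longrightarrow> f ys x \<le> g ys x"
  shows "site_mean p t f \<le> site_mean p t g"
  using assms(3)
proof (induction t arbitrary: f g)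
  case (Suc t)
  show ?case
    unfolding site_mean.simps
  proof (rule Suc.IH)
    fix ys x assume *: "set ys \<subseteq> {- int t..int t}" "\<bar>x\<bar> \<le> int t"
    then have "set ys \<subseteq> {- int (Suc t)..int (Suc t)}" by auto
    then show "p * f (x # ys) x + (1 - p) / 2 * (f ys (x + 1) + f ys (x - 1)) \<le>
        p * g (x # ys) x + (1 - p) / 2 * (g ys (x + 1) + g ys (x - 1))"
      using * assms(1,2) by (intro add_mono mult_left_mono Suc.prems) auto
  qed
qed simp

lemma site_mean_cong: "(\<And>ys x. f ys x = g ys x) \<Longrightarrow> site_mean p t f = site_mean p t g"
  by (metis ext)

definition spread :: "int list \<Rightarrow> int \<Rightarrow> real" where
  "spread ys x = (\<Sum>y\<leftarrow>ys. \<bar>real_of_int (x - y)\<bar>)"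

definition spread_sq :: "int list \<Rightarrow> int \<Rightarrow> real" where
  "spread_sq ys x = (\<Sum>y\<leftarrow>ys. (real_of_int (x - y))\<^sup>2)"

text \<open>The sum of the squares of the local times.\<close>

definition self_intersection :: "int list \<Rightarrow> real" where
  "self_intersection ys = (\<Sum>y\<leftarrow>ys. real (count_list ys y))"

lemma self_intersection_Cons:
  "self_intersection (x # ys) = self_intersection ys + 2 * real (count_list ys x) + 1"
proof -
  have "(\<Sum>y\<leftarrow>zs. real (count_list (x # ys) y)) =
      (\<Sum>y\<leftarrow>zs. real (count_list ys y)) + real (count_list zs x)" for zs
    by (induction zs) auto
  then show ?thesis by (simp add: self_intersection_def)
qed

lemma spread_move:
  "(spread ys (x + 1) + spread ys (x - 1)) / 2 = spread ys x + real (count_list ys x)"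
proof -
  have *: "(\<bar>real_of_int (x + 1 - y)\<bar> + \<bar>real_of_int (x - 1 - y)\<bar>) / 2 =
      \<bar>real_of_int (x - y)\<bar> + (if y = x then 1 else 0)" for y
    by (cases "y = x"; cases "y < x") (auto simp: abs_if)
  show ?thesis
    unfolding spread_def
  proof (induction ys)
    case (Cons a ys)
    then show ?case using *[of a] by (auto simp: field_simps)
  qed simp
qed

lemma spread_sq_move:
  "(spread_sq ys (x + 1) + spread_sq ys (x - 1)) / 2 = spread_sq ys x + length ys"
  unfolding spread_sq_def by (induction ys) (simp_all add: power2_eq_square field_simps)

lemma site_mean_length: "site_mean p t (\<lambda>ys x. real (length ys)) = p * t"
proof (induction t)
  case (Suc t)
  have "site_mean p (Suc t) (\<lambda>ys x. real (length ys)) = site_mean p t (\<lambda>ys x. real (length ys) + p)"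
    unfolding site_mean.simps by (rule site_mean_cong) (simp add: field_simps)
  then show ?case using Suc by (simp add: site_mean_add site_mean_const algebra_simps)
qed simp

text \<open>Each mark is made at distance \<open>0\<close> from the walker; afterwards its squared distance grows
  on average by \<open>1\<close> with every move.\<close>

lemma site_mean_spread_sq_le:
  assumes "0 \<le> p" "p \<le> 1"
  shows "site_mean p t spread_sq \<le> p * (real t)\<^sup>2"
proof (induction t)
  case (Suc t)
  have "site_mean p (Suc t) spread_sq =
      site_mean p t (\<lambda>ys x. spread_sq ys x + (1 - p) * real (length ys))"
    unfolding site_mean.simps
  proof (rule site_mean_cong)
    fix ys x
    have "spread_sq (x # ys) x = spread_sq ys x" by (simp add: spread_sq_def)
    then show "p * spread_sq (x # ys) x + (1 - p) / 2 * (spread_sq ys (x + 1) + spread_sq ys (x - 1))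
        = spread_sq ys x + (1 - p) * real (length ys)"
      using spread_sq_move[of ys x] by (simp add: field_simps)
  qed
  also have "\<dots> = site_mean p t spread_sq + (1 - p) * (p * t)"
    by (simp add: site_mean_add site_mean_mult site_mean_length)
  also have "\<dots> \<le> p * (real t)\<^sup>2 + 1 * (p * t)"
    using Suc assms by (intro add_mono mult_right_mono) auto
  also have "\<dots> \<le> p * (real (Suc t))\<^sup>2"
    using assms by (simp add: power2_eq_square algebra_simps)
  finally show ?case .
qed (simp add: spread_sq_def)

text \<open>A discrete Tanaka formula: on average, a move increases the sum of the distances to all marks
  by the local time of the current site, and a new mark increases the self-intersection count by
  twice this local time plus \<open>1\<close>.\<close>

lemma site_mean_self_intersection:
  assumes "p < 1"
  shows "site_mean p t (\<lambda>ys x. self_intersection ys) =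
    2 * p / (1 - p) * site_mean p t spread + p * t"
proof (induction t)
  case (Suc t)
  let ?C = "site_mean p t (\<lambda>ys x. real (count_list ys x))"
  have "site_mean p (Suc t) (\<lambda>ys x. self_intersection ys) =
      site_mean p t (\<lambda>ys x. self_intersection ys + ((2 * p) * real (count_list ys x) + p))"
    unfolding site_mean.simps
    by (rule site_mean_cong) (simp add: self_intersection_Cons field_simps)
  also have "\<dots> = site_mean p t (\<lambda>ys x. self_intersection ys) + (2 * p * ?C + p)"
    by (simp only: site_mean_add site_mean_mult site_mean_const)
  finally have 1: "site_mean p (Suc t) (\<lambda>ys x. self_intersection ys) =
      site_mean p t (\<lambda>ys x. self_intersection ys) + (2 * p * ?C + p)" .
  have "site_mean p (Suc t) spread =
      site_mean p t (\<lambda>ys x. spread ys x + (1 - p) * real (count_list ys x))"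
    unfolding site_mean.simps
  proof (rule site_mean_cong)
    fix ys x
    have "spread (x # ys) x = spread ys x" by (simp add: spread_def)
    then show "p * spread (x # ys) x + (1 - p) / 2 * (spread ys (x + 1) + spread ys (x - 1))
        = spread ys x + (1 - p) * real (count_list ys x)"
      using spread_move[of ys x] by (simp add: field_simps)
  qed
  also have "\<dots> = site_mean p t spread + (1 - p) * ?C"
    by (simp only: site_mean_add site_mean_mult)
  finally have 2: "site_mean p (Suc t) spread = site_mean p t spread + (1 - p) * ?C" .
  show ?case
    unfolding 1 2 Suc using assms by (simp add: field_simps)
qed (simp add: self_intersection_def spread_def)

lemma site_mean_self_intersection_le:
  assumes "0 \<le> p" "p < 1" "t > 0"
  shows "site_mean p t (\<lambda>ys x. self_intersection ys) \<le> (2 * p\<^sup>2 / (1 - p) + p) * (t * sqrt t)"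
proof -
  have st: "sqrt t > 0" "sqrt t \<ge> 1" using assms(3) by auto
  have tt: "real t = sqrt t * sqrt t" by simp
  have "spread ys x \<le> 1 / (2 * sqrt t) * spread_sq ys x + sqrt t / 2 * real (length ys)" for ys x
  proof -
    have "\<bar>z\<bar> \<le> 1 / (2 * sqrt t) * z\<^sup>2 + sqrt t / 2" for z :: real
    proof -
      have "0 \<le> (\<bar>z\<bar> - sqrt t)\<^sup>2" by simp
      then have "2 * sqrt t * \<bar>z\<bar> \<le> z\<^sup>2 + sqrt t * sqrt t"
        by (simp add: power2_diff algebra_simps power2_eq_square)
      then show ?thesis using st by (simp add: field_simps)
    qed
    then have "spread ys x \<le> (\<Sum>y\<leftarrow>ys. 1 / (2 * sqrt t) * (real_of_int (x - y))\<^sup>2 + sqrt t / 2)"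
      unfolding spread_def by (intro sum_list_mono)
    also have "\<dots> = 1 / (2 * sqrt t) * spread_sq ys x + sqrt t / 2 * real (length ys)"
      unfolding spread_sq_def by (induction ys) (simp_all add: algebra_simps)
    finally show ?thesis .
  qed
  then have "site_mean p t spread \<le>
      site_mean p t (\<lambda>ys x. 1 / (2 * sqrt t) * spread_sq ys x + sqrt t / 2 * real (length ys))"
    using assms by (intro site_mean_mono) auto
  also have "\<dots> = 1 / (2 * sqrt t) * site_mean p t spread_sq + sqrt t / 2 * (p * t)"
    by (simp only: site_mean_add site_mean_mult site_mean_length)
  also have "\<dots> \<le> 1 / (2 * sqrt t) * (p * (real t)\<^sup>2) + sqrt t / 2 * (p * t)"
    using site_mean_spread_sq_le[of p t] assms by (intro add_mono mult_left_mono) auto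
  also have "1 / (2 * sqrt t) * (p * (real t)\<^sup>2) = sqrt t / 2 * (p * t)"
  proof -
    have "(real t)\<^sup>2 = sqrt t * sqrt t * t" by (simp add: power2_eq_square)
    then show ?thesis using st by (simp only: ) (simp add: field_simps)
  qed
  also have "sqrt t / 2 * (p * t) + sqrt t / 2 * (p * t) = p * (t * sqrt t)" by simp
  finally have U: "site_mean p t spread \<le> p * (t * sqrt t)" .
  have "site_mean p t (\<lambda>ys x. self_intersection ys) \<le>
      2 * p / (1 - p) * (p * (t * sqrt t)) + p * (t * sqrt t)"
    unfolding site_mean_self_intersection[OF assms(2)]
    using U st assms by (intro add_mono mult_left_mono) auto
  also have "\<dots> = (2 * p\<^sup>2 / (1 - p) + p) * (t * sqrt t)"
    by (simp add: power2_eq_square algebra_simps)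
  finally show ?thesis .
qed

text \<open>A lower bound of \<open>n powr \<beta>\<close> that only involves the first two moments of \<open>n\<close>; it is sharp up to
  constants if \<open>n\<close> is mostly of order \<open>l\<close>.\<close>

lemma powr_ge_quadratic:
  fixes n l \<beta> :: real
  assumes "n > 0" "l > 0" "0 \<le> \<beta>" "\<beta> \<le> 1"
  shows "l powr (\<beta> - 1) * (n - n\<^sup>2 / (4 * l)) \<le> n powr \<beta>"
proof -
  define u where "u = n / l"
  have u: "u > 0" "n = l * u" using assms by (auto simp: u_def)
  have "u - u\<^sup>2 / 4 \<le> u powr \<beta>"
  proof (cases "u \<le> 1")
    case True
    have "u powr 1 \<le> u powr \<beta>" using True u assms by (intro powr_mono') auto
    moreover have "u - u\<^sup>2 / 4 \<le> u powr 1" using u by simp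
    ultimately show ?thesis by linarith
  next
    case False
    have "0 \<le> (u / 2 - 1)\<^sup>2" by simp
    then have "u - u\<^sup>2 / 4 \<le> 1" by (simp add: power2_diff power_divide)
    also have "1 \<le> u powr \<beta>" using False assms by (intro ge_one_powr_ge_zero) auto
    finally show ?thesis .
  qed
  then have "l powr \<beta> * (u - u\<^sup>2 / 4) \<le> l powr \<beta> * u powr \<beta>"
    by (intro mult_left_mono) auto
  also have "\<dots> = n powr \<beta>" using assms u by (simp add: powr_mult)
  also have "l powr \<beta> * (u - u\<^sup>2 / 4) = l powr (\<beta> - 1) * (n - n\<^sup>2 / (4 * l))"
    using assms u by (simp add: powr_diff power2_eq_square field_simps)
  finally show ?thesis .
qed

text \<open>The local times add up to about \<open>p * t\<close>, and the bound on the sum of their squares shows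
  that they are mostly of order at most \<open>\<surd>t\<close>.\<close>

lemma site_mean_local_time_powr:
  assumes "0 < p" "p < 1" "0 \<le> \<beta>" "\<beta> \<le> 1"
  obtains c where "c > 0"
    "\<And>t. c * real t powr ((1 + \<beta>) / 2) \<le>
       site_mean p t (\<lambda>ys x. \<Sum>k\<in>set ys. real (count_list ys k) powr \<beta>)"
proof -
  define C where "C = 2 * p\<^sup>2 / (1 - p) + p"
  define D where "D = C / (2 * p)"
  have C: "C > 0" unfolding C_def using assms by (intro add_nonneg_pos) auto
  have D: "D > 0" using C assms by (simp add: D_def)
  define c where "c = D powr (\<beta> - 1) * p / 2"
  have "c * real t powr ((1 + \<beta>) / 2) \<le>
       site_mean p t (\<lambda>ys x. \<Sum>k\<in>set ys. real (count_list ys k) powr \<beta>)" for t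
  proof (cases "t = 0")
    case False
    \<comment> \<open>With this \<open>D\<close> the second moment term takes away exactly half of the main term \<open>p * t\<close>.\<close>
    define l where "l = D * sqrt t"
    have st: "sqrt t > 0" using False by simp
    have l: "l > 0" using D st by (simp add: l_def)
    have "l powr (\<beta> - 1) * (real (length ys) - 1 / (4 * l) * self_intersection ys) \<le>
        (\<Sum>k\<in>set ys. real (count_list ys k) powr \<beta>)" for ys
    proof -
      have "real (length ys) = (\<Sum>k\<in>set ys. real (count_list ys k))"
        using sum_list_map_eq_sum_count[of "\<lambda>_. 1::nat" ys] by (simp add: sum_list_triv flip: of_nat_sum)
      moreover have "self_intersection ys = (\<Sum>k\<in>set ys. (real (count_list ys k))\<^sup>2)"
      proof -
        have "(\<Sum>y\<leftarrow>zs. real (count_list ys y)) = real (\<Sum>y\<leftarrow>zs. count_list ys y)" for zs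
          by (induction zs) auto
        then show ?thesis
          using sum_list_map_eq_sum_count[of "\<lambda>y. count_list ys y" ys]
          by (simp add: self_intersection_def power2_eq_square)
      qed
      ultimately have "l powr (\<beta> - 1) * (real (length ys) - 1 / (4 * l) * self_intersection ys) =
          (\<Sum>k\<in>set ys. l powr (\<beta> - 1) * (real (count_list ys k) - (real (count_list ys k))\<^sup>2 / (4 * l)))"
        by (simp add: sum_distrib_left[symmetric] sum_subtractf sum_divide_distrib[symmetric])
      also have "\<dots> \<le> (\<Sum>k\<in>set ys. real (count_list ys k) powr \<beta>)"
      proof (intro sum_mono powr_ge_quadratic l assms(3,4))
        fix k assume "k \<in> set ys"
        then show "0 < real (count_list ys k)" using count_list_0_iff[of ys k] by (simp add: neq0_conv[symmetric] del: neq0_conv)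
      qed
      finally show ?thesis .
    qed
    then have "site_mean p t (\<lambda>ys x. l powr (\<beta> - 1) * (real (length ys) + (- 1 / (4 * l)) * self_intersection ys))
        \<le> site_mean p t (\<lambda>ys x. \<Sum>k\<in>set ys. real (count_list ys k) powr \<beta>)"
      using assms by (intro site_mean_mono) auto
    moreover have "site_mean p t (\<lambda>ys x. l powr (\<beta> - 1) * (real (length ys) + (- 1 / (4 * l)) * self_intersection ys)) =
        l powr (\<beta> - 1) * (p * t + (- 1 / (4 * l)) * site_mean p t (\<lambda>ys x. self_intersection ys))"
      by (simp only: site_mean_add site_mean_mult site_mean_length)
    moreover have "l powr (\<beta> - 1) * (p * t / 2) \<le>
        l powr (\<beta> - 1) * (p * t + (- 1 / (4 * l)) * site_mean p t (\<lambda>ys x. self_intersection ys))"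
    proof (intro mult_left_mono)
      have "1 / (4 * l) * site_mean p t (\<lambda>ys x. self_intersection ys) \<le> 1 / (4 * l) * (C * (t * sqrt t))"
        unfolding C_def using site_mean_self_intersection_le[of p t] assms False l
        by (intro mult_left_mono) auto
      also have "\<dots> = p * t / 2"
        using C assms st by (simp add: l_def D_def field_simps)
      finally show "p * t / 2 \<le> p * t + (- 1 / (4 * l)) * site_mean p t (\<lambda>ys x. self_intersection ys)"
        by simp
    qed simp
    moreover have "c * real t powr ((1 + \<beta>) / 2) = l powr (\<beta> - 1) * (p * t / 2)"
    proof -
      have "l powr (\<beta> - 1) = D powr (\<beta> - 1) * real t powr ((\<beta> - 1) / 2)"
        using D by (simp add: l_def powr_mult powr_half_sqrt[symmetric] powr_powr)
      moreover have "real t powr ((1 + \<beta>) / 2) = real t powr ((\<beta> - 1) / 2) * real t"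
        using False powr_add[of "real t" "(\<beta> - 1) / 2" 1] by (simp add: field_simps)
      ultimately show ?thesis by (simp add: c_def)
    qed
    ultimately show ?thesis by linarith
  qed simp
  moreover have "c > 0" using D assms by (simp add: c_def)
  ultimately show ?thesis by (rule that[rotated])
qed

section \<open>Speed in the wreath product\<close>

context cayley_walk
begin

interpretation W: cayley_walk W wreath_gens by (rule cayley_walk_W)

lemma sum_wreath_gens:
  fixes h :: "_ \<Rightarrow> real"
  shows "(\<Sum>s\<in>wreath_gens. h s) = (\<Sum>s\<in>S. h (lamp s)) + h (shift 1) + h (shift (-1))"
proof -
  have inj: "inj_on lamp S" by (auto simp: inj_on_def lamp_def fun_eq_iff split: if_splits)
  have "lamp ` S \<inter> {shift 1, shift (-1)} = {}" "shift 1 \<noteq> shift (-1)"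
    by (auto simp: lamp_def shift_def)
  then show ?thesis
    unfolding wreath_gens_def by (subst sum.union_disjoint) (simp_all add: sum.reindex[OF inj])
qed

lemma card_wreath_gens: "real (card wreath_gens) = real (card S) + 2"
  using sum_wreath_gens[of "\<lambda>_. 1"] by simp

definition lamp_rate where "lamp_rate = card S / (real (card S) + 2)"

lemma lamp_rate: "0 < lamp_rate" "lamp_rate < 1"
  using card_S_pos by (auto simp: lamp_rate_def)

text \<open>Given the path of the marker, the lamp at \<open>k\<close> is a simple random walk on \<open>G\<close> run for the
  local time at \<open>k\<close>.\<close>

lemma lamp_process:
  "W.E t (\<lambda>w. \<phi> (fst w k) (snd w)) =
    site_mean lamp_rate t (\<lambda>ys x. E (count_list ys k) (\<lambda>g. \<phi> g x))"
proof (induction t arbitrary: \<phi>)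
  case 0
  then show ?case by (simp add: W_one)
next
  case (Suc t)
  let ?N = "real (card S) + 2"
  let ?\<phi> = "\<lambda>g x. ((\<Sum>s\<in>S. \<phi> (if x = k then g \<otimes> s else g) x) + \<phi> g (x + 1) + \<phi> g (x - 1)) / ?N"
  have "W.E (Suc t) (\<lambda>w. \<phi> (fst w k) (snd w)) = W.E t (\<lambda>w. ?\<phi> (fst w k) (snd w))"
    unfolding W.E_Suc sum_wreath_gens card_wreath_gens
  proof (rule W.E_cong)
    fix w assume w: "w \<in> carrier W"
    obtain f x where fx: "w = (f, x)" by (cases w)
    have "(\<Sum>s\<in>S. \<phi> (fst (w \<otimes>\<^bsub>W\<^esub> lamp s) k) (snd (w \<otimes>\<^bsub>W\<^esub> lamp s))) =
        (\<Sum>s\<in>S. \<phi> (if x = k then f k \<otimes> s else f k) x)"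
      using w mult_lamp[of f x] by (intro sum.cong) (auto simp: fx)
    then show "((\<Sum>s\<in>S. \<phi> (fst (w \<otimes>\<^bsub>W\<^esub> lamp s) k) (snd (w \<otimes>\<^bsub>W\<^esub> lamp s)))
        + \<phi> (fst (w \<otimes>\<^bsub>W\<^esub> shift 1) k) (snd (w \<otimes>\<^bsub>W\<^esub> shift 1))
        + \<phi> (fst (w \<otimes>\<^bsub>W\<^esub> shift (-1)) k) (snd (w \<otimes>\<^bsub>W\<^esub> shift (-1)))) / ?N = ?\<phi> (fst w k) (snd w)"
      using w mult_shift[of f x 1] mult_shift[of f x "-1"] unfolding fx by (simp cong: if_cong)
  qed
  also have "\<dots> = site_mean lamp_rate t (\<lambda>ys x. E (count_list ys k) (\<lambda>g. ?\<phi> g x))"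
    by (rule Suc)
  also have "\<dots> = site_mean lamp_rate (Suc t) (\<lambda>ys x. E (count_list ys k) (\<lambda>g. \<phi> g x))"
    unfolding site_mean.simps
  proof (rule site_mean_cong)
    fix ys x
    let ?n = "count_list ys k"
    have N: "?N > 0" by simp
    have half: "(1 - lamp_rate) / 2 = 1 / ?N" by (simp add: lamp_rate_def field_simps)
    have "E ?n (\<lambda>g. \<Sum>s\<in>S. \<phi> (if x = k then g \<otimes> s else g) x) =
        card S * E (count_list (x # ys) k) (\<lambda>g. \<phi> g x)"
    proof (cases "x = k")
      case True
      then show ?thesis using card_S_pos E_Suc[of ?n "\<lambda>g. \<phi> g x"] by simp
    qed simp
    moreover have "E ?n (\<lambda>g. ?\<phi> g x) = (E ?n (\<lambda>g. \<Sum>s\<in>S. \<phi> (if x = k then g \<otimes> s else g) x)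
        + E ?n (\<lambda>g. \<phi> g (x + 1)) + E ?n (\<lambda>g. \<phi> g (x - 1))) / ?N"
      by simp
    ultimately show "E ?n (\<lambda>g. ?\<phi> g x) = lamp_rate * E (count_list (x # ys) k) (\<lambda>g. \<phi> g x) +
        (1 - lamp_rate) / 2 * (E ?n (\<lambda>g. \<phi> g (x + 1)) + E ?n (\<lambda>g. \<phi> g (x - 1)))"
      unfolding half by (simp add: lamp_rate_def add_divide_distrib)
  qed
  finally show ?case .
qed

text \<open>The word length in the wreath product is at least the sum of the lengths of the lamps. The lamp
  at \<open>k\<close> contributes the \<open>\<beta>\<close>-th power of the local time at \<open>k\<close>.\<close>

theorem speed_W:
  assumes "has_speed G S \<beta>" "0 \<le> \<beta>"
  shows "has_speed W wreath_gens ((1 + \<beta>) / 2)"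
proof -
  obtain c where c: "c > 0" and speed: "\<And>t. c * real t powr \<beta> \<le> E t (\<lambda>g. real (word_dist G S g \<one>))"
    using assms(1) unfolding has_speed_def by blast
  note \<beta> = assms(2) speed_exponent_le_1[OF assms(1)]
  obtain b where b: "b > 0" "\<And>t. b * real t powr ((1 + \<beta>) / 2) \<le>
      site_mean lamp_rate t (\<lambda>ys x. \<Sum>k\<in>set ys. real (count_list ys k) powr \<beta>)"
    using site_mean_local_time_powr[OF lamp_rate \<beta>] by blast
  have "c * b * real t powr ((1 + \<beta>) / 2) \<le> W.E t (\<lambda>w. real (word_dist W wreath_gens w \<one>\<^bsub>W\<^esub>))" for t
  proof -
    let ?I = "{- int t..int t}"
    have "c * b * real t powr ((1 + \<beta>) / 2) \<le>
        c * site_mean lamp_rate t (\<lambda>ys x. \<Sum>k\<in>set ys. real (count_list ys k) powr \<beta>)"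
      using b(2)[of t] c by (simp add: mult.assoc mult_left_mono)
    also have "\<dots> = site_mean lamp_rate t (\<lambda>ys x. c * (\<Sum>k\<in>set ys. real (count_list ys k) powr \<beta>))"
      by (rule site_mean_mult[symmetric])
    also have "\<dots> \<le> site_mean lamp_rate t (\<lambda>ys x. \<Sum>k\<in>?I. E (count_list ys k) (\<lambda>g. real (len g)))"
    proof (rule site_mean_mono)
      fix ys x assume "set ys \<subseteq> ?I"
      then have "(\<Sum>k\<in>set ys. real (count_list ys k) powr \<beta>) \<le> (\<Sum>k\<in>?I. real (count_list ys k) powr \<beta>)"
        by (intro sum_mono2) auto
      then have "c * (\<Sum>k\<in>set ys. real (count_list ys k) powr \<beta>) \<le> (\<Sum>k\<in>?I. c * real (count_list ys k) powr \<beta>)"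
        using c by (simp add: sum_distrib_left[symmetric])
      also have "\<dots> \<le> (\<Sum>k\<in>?I. E (count_list ys k) (\<lambda>g. real (len g)))"
      proof (rule sum_mono)
        fix k
        have "E n (\<lambda>g. real (word_dist G S g \<one>)) = E n (\<lambda>g. real (len g))" for n
          by (rule E_cong) simp
        then show "c * real (count_list ys k) powr \<beta> \<le> E (count_list ys k) (\<lambda>g. real (len g))"
          using speed[of "count_list ys k"] by simp
      qed
      finally show "c * (\<Sum>k\<in>set ys. real (count_list ys k) powr \<beta>) \<le>
          (\<Sum>k\<in>?I. E (count_list ys k) (\<lambda>g. real (len g)))" .
    qed (use lamp_rate in auto)
    also have "\<dots> = (\<Sum>k\<in>?I. W.E t (\<lambda>w. real (len (fst w k))))"
      by (simp add: site_mean_sum lamp_process[of t "\<lambda>g x. real (len g)"])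
    also have "\<dots> = W.E t (\<lambda>w. \<Sum>k\<in>?I. real (len (fst w k)))"
      by (rule W.E_sum[symmetric])
    also have "\<dots> \<le> W.E t (\<lambda>w. real (word_dist W wreath_gens w \<one>\<^bsub>W\<^esub>))"
    proof (rule W.E_mono)
      fix w assume w: "w \<in> carrier W"
      obtain f x where fx: "w = (f, x)" by (cases w)
      have "(\<Sum>k\<in>?I. len (f k)) \<le> W.len (f, x)" using w by (intro len_W_lower) (auto simp: fx)
      then show "(\<Sum>k\<in>?I. real (len (fst w k))) \<le> real (word_dist W wreath_gens w \<one>\<^bsub>W\<^esub>)"
        using w by (simp add: fx flip: of_nat_sum)
    qed
    finally show ?thesis .
  qed
  then show ?thesis
    unfolding has_speed_def using c b(1) by (intro exI[of _ "c * b"]) simp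
qed

end

section \<open>Kernels on Cayley graphs\<close>

context cayley
begin

text \<open>A squared Hilbert distance that is bounded along edges grows at most quadratically.\<close>

lemma cnd_edge_bound:
  assumes K: "cnd_on (carrier G) K" and C: "C \<ge> 0"
    and edge: "\<And>g s. g \<in> carrier G \<Longrightarrow> s \<in> S \<Longrightarrow> K g (g \<otimes> s) \<le> C"
    and x: "x \<in> carrier G" and y: "y \<in> carrier G"
  shows "K x y \<le> C * (real (word_dist G S x y))\<^sup>2"
proof -
  have "K x (x \<otimes> foldr (mult G) ws \<one>) \<le> C * (real (length ws))\<^sup>2" if "set ws \<subseteq> S" for ws
    using that
  proof (induction ws rule: rev_induct)
    case Nil
    then show ?case using x cnd_onD(2)[OF K x] by simp
  next
    case (snoc s ws)
    let ?w = "foldr (mult G) ws \<one>" and ?n = "real (length ws)"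
    have s: "s \<in> S" and w: "?w \<in> carrier G" using snoc.prems by auto
    have IH: "K x (x \<otimes> ?w) \<le> C * ?n\<^sup>2" using snoc by simp
    have last: "K (x \<otimes> ?w) (x \<otimes> (?w \<otimes> s)) \<le> C"
      using edge[of "x \<otimes> ?w" s] x w s by (simp add: m_assoc)
    have "K x (x \<otimes> (?w \<otimes> s)) \<le> C * (?n + 1)\<^sup>2"
    proof (cases "ws = []")
      case True
      then show ?thesis using last x s by simp
    next
      case False
      then have n: "?n > 0" by simp
      have "K x (x \<otimes> (?w \<otimes> s)) \<le>
          (1 + ?n) * (K x (x \<otimes> ?w) / ?n + K (x \<otimes> ?w) (x \<otimes> (?w \<otimes> s)) / 1)"
        using x w s n by (intro cnd_three_points[OF K]) auto
      also have "\<dots> \<le> (1 + ?n) * (C * ?n\<^sup>2 / ?n + C / 1)"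
        using IH last n by (intro mult_left_mono add_mono divide_right_mono) auto
      also have "\<dots> = C * (?n + 1)\<^sup>2"
        using n by (simp add: power2_eq_square algebra_simps)
      finally show ?thesis .
    qed
    then show ?case
      using snoc.prems s foldr_mult_right[of ws s] by (simp add: add.commute)
  qed
  moreover have "inv x \<otimes> y \<in> carrier G" using x y by simp
  moreover have "x \<otimes> (inv x \<otimes> y) = y" using x y by (simp add: m_assoc[symmetric])
  ultimately show ?thesis
    unfolding word_dist_def by (metis len_attained)
qed

text \<open>Superposition of kernels living on the scales \<open>2\<^sup>m\<close>, damped geometrically.\<close>

lemma cnd_scale_sum:
  assumes k: "\<And>m::nat. cnd_on (carrier G) (k m)" and C: "C \<ge> 0"
    and edge: "\<And>m g s. g \<in> carrier G \<Longrightarrow> s \<in> S \<Longrightarrow> k m g (g \<otimes> s) \<le> C"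
    and \<theta>: "0 < \<theta>" "\<theta> < 1"
  defines "K \<equiv> \<lambda>x y. suminf (\<lambda>m. \<theta> ^ m * k m x y)"
  shows "cnd_on (carrier G) K"
    and "\<And>g s. g \<in> carrier G \<Longrightarrow> s \<in> S \<Longrightarrow> K g (g \<otimes> s) \<le> C / (1 - \<theta>)"
    and "\<And>m x y. x \<in> carrier G \<Longrightarrow> y \<in> carrier G \<Longrightarrow> \<theta> ^ m * k m x y \<le> K x y"
proof -
  have nn: "0 \<le> \<theta> ^ m * k m x y" if "x \<in> carrier G" "y \<in> carrier G" for m x y
    using cnd_on_nonneg[OF k that] \<theta> by simp
  have geo: "summable (\<lambda>m. \<theta> ^ m * B)" for B
    using \<theta> by (intro summable_mult2 summable_geometric) simp
  have summ: "summable (\<lambda>m. \<theta> ^ m * k m x y)" if "x \<in> carrier G" "y \<in> carrier G" for x y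
  proof (rule summable_comparison_test'[OF geo])
    show "norm (\<theta> ^ m * k m x y) \<le> \<theta> ^ m * (C * (real (word_dist G S x y))\<^sup>2)" for m
      using cnd_edge_bound[OF k C edge that, of m] nn[OF that, of m] \<theta> by (simp add: mult_left_mono)
  qed
  show "cnd_on (carrier G) K"
  proof (rule cnd_on_limit)
    show "cnd_on (carrier G) (\<lambda>x y. \<Sum>m<n. \<theta> ^ m * k m x y)" for n
      using \<theta> by (intro cnd_on_sum cnd_on_const_mult k) auto
    show "(\<lambda>n. \<Sum>m<n. \<theta> ^ m * k m x y) \<longlonglongrightarrow> K x y" if "x \<in> carrier G" "y \<in> carrier G" for x y
      unfolding K_def using summable_LIMSEQ[OF summ[OF that]] .
  qed
  show "K g (g \<otimes> s) \<le> C / (1 - \<theta>)" if "g \<in> carrier G" "s \<in> S" for g s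
  proof -
    have "K g (g \<otimes> s) \<le> suminf (\<lambda>m. \<theta> ^ m * C)"
      unfolding K_def using that edge \<theta> by (intro suminf_le summ geo mult_left_mono) auto
    also have "\<dots> = C / (1 - \<theta>)"
      using \<theta> suminf_mult2[of "\<lambda>m. \<theta> ^ m" C] by (simp add: suminf_geometric)
    finally show ?thesis .
  qed
  show "\<theta> ^ m * k m x y \<le> K x y" if "x \<in> carrier G" "y \<in> carrier G" for m x y
    unfolding K_def using sum_le_suminf[OF summ[OF that], of "{m}"] nn[OF that] by simp
qed

end

section \<open>Profile kernels\<close>

text \<open>The squared distance of the vectors \<open>(f, i) \<mapsto> \<Oplus>\<^sub>k w (k - i) v\<^sub>k(f)\<close>, where \<open>v\<^sub>k(f)\<close> are
  unit vectors with inner products \<open>E k f g\<close>: a weight profile is carried along by the marker.\<close>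

definition profile_term ::
  "(int \<Rightarrow> real) \<Rightarrow> (int \<Rightarrow> 'c \<Rightarrow> 'c \<Rightarrow> real) \<Rightarrow> 'c \<times> int \<Rightarrow> 'c \<times> int \<Rightarrow> int \<Rightarrow> real" where
  "profile_term w E x y k = (w (k - snd x) - w (k - snd y))\<^sup>2 +
     2 * (w (k - snd x) * w (k - snd y)) * (1 - E k (fst x) (fst y))"

definition profile ::
  "nat \<Rightarrow> (int \<Rightarrow> real) \<Rightarrow> (int \<Rightarrow> 'c \<Rightarrow> 'c \<Rightarrow> real) \<Rightarrow> 'c \<times> int \<Rightarrow> 'c \<times> int \<Rightarrow> real" where
  "profile r w E x y =
     (\<Sum>k\<in>{min (snd x) (snd y) - int r..max (snd x) (snd y) + int r}. profile_term w E x y k)"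

lemma profile_extend:
  assumes "\<And>n. \<bar>n\<bar> > int r \<Longrightarrow> w n = 0" "finite B"
    and "{min (snd x) (snd y) - int r..max (snd x) (snd y) + int r} \<subseteq> B"
  shows "profile r w E x y = sum (profile_term w E x y) B"
  unfolding profile_def
proof (rule sum.mono_neutral_left[OF assms(2,3)], rule ballI)
  fix k assume "k \<in> B - {min (snd x) (snd y) - int r..max (snd x) (snd y) + int r}"
  then have "w (k - snd x) = 0" "w (k - snd y) = 0" by (auto intro!: assms(1))
  then show "profile_term w E x y k = 0" by (simp add: profile_term_def)
qed

lemma profile_ge:
  assumes "\<And>n. \<bar>n\<bar> > int r \<Longrightarrow> w n = 0" and "\<And>n. w n \<ge> 0"
    and "\<And>k. E k (fst x) (fst y) \<le> 1" and "finite A"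
  shows "sum (profile_term w E x y) A \<le> profile r w E x y"
proof -
  let ?I = "{min (snd x) (snd y) - int r..max (snd x) (snd y) + int r}"
  have "sum (profile_term w E x y) A \<le> sum (profile_term w E x y) (A \<union> ?I)"
    using assms by (intro sum_mono2) (auto simp: profile_term_def)
  also have "\<dots> = profile r w E x y"
    using assms(1,4) by (intro profile_extend[symmetric]) auto
  finally show ?thesis .
qed

lemma cnd_on_profile:
  assumes w: "\<And>n. \<bar>n\<bar> > int r \<Longrightarrow> w n = 0"
    and pd: "\<And>k. pd_on A (\<lambda>x y. E k (fst x) (fst y))" and one: "\<And>k x. x \<in> A \<Longrightarrow> E k (fst x) (fst x) = 1"
  shows "cnd_on A (profile r w E)"
proof (rule cnd_on_limit)
  fix M
  let ?I = "{- int M..int M}"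
  let ?p = "\<lambda>x y. \<Sum>k\<in>?I. w (k - snd x) * w (k - snd y) * E k (fst x) (fst y)"
  have "cnd_on A (\<lambda>x y. ?p x x + ?p y y - 2 * ?p x y)"
    by (intro cnd_on_of_pd pd_on_sum pd_on_weighted pd)
  then show "cnd_on A (\<lambda>x y. sum (profile_term w E x y) ?I)"
    by (rule cnd_on_cong)
      (simp add: one profile_term_def sum.distrib[symmetric] sum_distrib_left sum_subtractf[symmetric]
        power2_eq_square algebra_simps)
next
  fix x y :: "'a \<times> int"
  have "\<forall>\<^sub>F M in sequentially. sum (profile_term w E x y) {- int M..int M} = profile r w E x y"
  proof (rule eventually_sequentiallyI)
    fix M assume "nat (\<bar>snd x\<bar> + \<bar>snd y\<bar>) + r \<le> M"
    then show "sum (profile_term w E x y) {- int M..int M} = profile r w E x y"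
      using w by (intro profile_extend[symmetric]) auto
  qed
  then show "(\<lambda>M. sum (profile_term w E x y) {- int M..int M}) \<longlonglongrightarrow> profile r w E x y"
    by (rule tendsto_eventually)
qed

text \<open>Moving the marker shifts the weights; it costs the Dirichlet energy of the profile.\<close>

lemma profile_move_le:
  assumes one: "\<And>k. E k f f = 1" and slope: "\<And>n. \<bar>w n - w (n - 1)\<bar> \<le> b"
  shows "profile r w E (f, i) (f, i + 1) \<le> (2 * real r + 2) * b\<^sup>2"
proof -
  have "profile r w E (f, i) (f, i + 1) \<le> (\<Sum>k\<in>{i - int r..i + 1 + int r}. b\<^sup>2)"
    unfolding profile_def
  proof (rule order_trans[OF _ sum_mono])
    show "(\<Sum>k\<in>{min (snd (f, i)) (snd (f, i + 1)) - int r..max (snd (f, i)) (snd (f, i + 1)) + int r}.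
        profile_term w E (f, i) (f, i + 1) k) \<le>
      (\<Sum>k\<in>{i - int r..i + 1 + int r}. profile_term w E (f, i) (f, i + 1) k)"
      by (simp add: min_def max_def)
    fix k
    have "\<bar>w (k - i) - w (k - i - 1)\<bar>\<^sup>2 \<le> b\<^sup>2" using slope by (intro power_mono) auto
    then show "profile_term w E (f, i) (f, i + 1) k \<le> b\<^sup>2"
      by (simp add: profile_term_def one diff_diff_eq)
  qed
  then show ?thesis by (simp add: algebra_simps)
qed

lemma profile_switch_le:
  assumes "\<And>k. k \<noteq> i \<Longrightarrow> w (k - i) = 0 \<or> E k f g = 1"
  shows "profile r w E (f, i) (g, i) \<le> 2 * (w 0)\<^sup>2 * \<bar>1 - E i f g\<bar>"
proof -
  have "profile r w E (f, i) (g, i) = (\<Sum>k\<in>{i - int r..i + int r}. profile_term w E (f, i) (g, i) k)"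
    by (simp add: profile_def)
  also have "\<dots> = (\<Sum>k\<in>{i}. profile_term w E (f, i) (g, i) k)"
    using assms by (intro sum.mono_neutral_right) (auto simp: profile_term_def)
  also have "\<dots> = 2 * (w 0)\<^sup>2 * (1 - E i f g)"
    by (simp add: profile_term_def power2_eq_square)
  also have "\<dots> \<le> 2 * (w 0)\<^sup>2 * \<bar>1 - E i f g\<bar>" by (intro mult_left_mono) auto
  finally show ?thesis .
qed

text \<open>The tail kernel detects differences far to the right of the marker. Its \<open>k\<close>-th vector depends on
  the whole configuration to the right of \<open>k\<close>, so that a single far away difference makes all the
  vectors on the way to it orthogonal. The profile \<open>bump\<close> vanishes up to the marker, hence
  switching the lamp at the marker is free.\<close>

definition bump :: "nat \<Rightarrow> int \<Rightarrow> real" where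
  "bump r n = max 0 (min (real_of_int n) (2 * real r - real_of_int n)) / sqrt (2 * real r)"

definition tail_equal :: "int \<Rightarrow> (int \<Rightarrow> 'a) \<Rightarrow> (int \<Rightarrow> 'a) \<Rightarrow> real" where
  "tail_equal k f g = (if \<forall>z\<ge>k. f z = g z then 1 else 0)"

definition tail_kernel :: "nat \<Rightarrow> (int \<Rightarrow> 'a) \<times> int \<Rightarrow> (int \<Rightarrow> 'a) \<times> int \<Rightarrow> real" where
  "tail_kernel r = profile (2 * r) (bump r) tail_equal"

lemma bump_nonneg: "bump r n \<ge> 0" by (simp add: bump_def)

lemma bump_outside: "n \<le> 0 \<Longrightarrow> bump r n = 0" "n > 2 * int r \<Longrightarrow> bump r n = 0"
  by (auto simp: bump_def max_def min_def)

lemma bump_slope: assumes "r > 0" shows "\<bar>bump r n - bump r (n - 1)\<bar> \<le> 1 / sqrt (2 * real r)"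
proof -
  have "\<bar>max 0 (min (real_of_int n) (2 * real r - real_of_int n)) -
      max 0 (min (real_of_int (n - 1)) (2 * real r - real_of_int (n - 1)))\<bar> \<le> 1"
    by (simp add: max_def min_def abs_if)
  then show ?thesis
    using assms by (simp add: bump_def diff_divide_distrib[symmetric] abs_divide divide_right_mono)
qed

lemma cnd_on_tail_kernel: "cnd_on A (tail_kernel r)"
  unfolding tail_kernel_def
proof (rule cnd_on_profile)
  show "\<bar>n\<bar> > int (2 * r) \<Longrightarrow> bump r n = 0" for n
    using bump_outside[where n = n and r = r] by (cases "n \<le> 0") auto
  show "pd_on A (\<lambda>x y. tail_equal k (fst x) (fst y))" for k
  proof (rule pd_on_cong[OF pd_on_pullback[OF pd_on_equality[of UNIV]]])
    fix x y :: "(int \<Rightarrow> 'a) \<times> int"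
    let ?e = "\<lambda>(x :: (int \<Rightarrow> 'a) \<times> int) z. if z \<ge> k then Some (fst x z) else None"
    show "(if ?e x = ?e y then 1 else 0) = tail_equal k (fst x) (fst y)"
      by (auto simp: tail_equal_def fun_eq_iff)
  qed simp
qed (simp add: tail_equal_def)

lemma tail_kernel_move: assumes "r > 0" shows "tail_kernel r (f, i) (f, i + 1) \<le> 4"
proof -
  have "tail_kernel r (f, i) (f, i + 1) \<le> (2 * real (2 * r) + 2) * (1 / sqrt (2 * real r))\<^sup>2"
    unfolding tail_kernel_def
    by (rule profile_move_le) (simp_all add: tail_equal_def bump_slope[OF assms])
  also have "\<dots> \<le> 4" using assms by (simp add: power_divide field_simps)
  finally show ?thesis .
qed

lemma tail_kernel_switch: "tail_kernel r (f, i) (f(i := u), i) \<le> 0"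
proof -
  have "bump r (k - i) = 0 \<or> tail_equal k f (f(i := u)) = 1" for k
    by (cases "k \<le> i") (auto simp: bump_outside tail_equal_def)
  then have "tail_kernel r (f, i) (f(i := u), i) \<le> 2 * (bump r 0)\<^sup>2 * \<bar>1 - tail_equal i f (f(i := u))\<bar>"
    unfolding tail_kernel_def by (intro profile_switch_le) blast
  then show ?thesis by (simp add: bump_outside)
qed

lemma cube_le_sum_squares: "real r ^ 3 \<le> 3 * (\<Sum>l\<in>{1..r}. (real l)\<^sup>2)"
proof (induction r)
  case (Suc r)
  have "real (Suc r) ^ 3 \<le> real r ^ 3 + 3 * (real (Suc r))\<^sup>2"
    by (simp add: power2_eq_square power3_eq_cube algebra_simps)
  then show ?case using Suc by (simp add: algebra_simps)
qed simp

text \<open>If \<open>f\<close> and \<open>g\<close> differ at distance at least \<open>r\<close> to the right of \<open>i\<close>, the vectors of \<open>f\<close>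
  and \<open>g\<close> at the first \<open>r\<close> sites to the right of \<open>i\<close> are orthogonal.\<close>

lemma tail_kernel_ge:
  assumes "r > 0" and z: "f z \<noteq> g z" "z \<ge> i + int r"
  shows "(real r)\<^sup>2 / 6 \<le> tail_kernel r (f, i) (g, j)"
proof -
  have "(\<Sum>l\<in>{1..r}. (real l)\<^sup>2 / (2 * real r)) \<le>
      (\<Sum>l\<in>{1..r}. profile_term (bump r) tail_equal (f, i) (g, j) (i + int l))"
  proof (rule sum_mono)
    fix l assume l: "l \<in> {1..r}"
    have "tail_equal (i + int l) f g = 0"
      using z l by (auto simp: tail_equal_def intro!: exI[of _ z])
    moreover have "(bump r (int l))\<^sup>2 = (real l)\<^sup>2 / (2 * real r)"
      using l by (simp add: bump_def power_divide)
    ultimately show "(real l)\<^sup>2 / (2 * real r) \<le> profile_term (bump r) tail_equal (f, i) (g, j) (i + int l)"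
      by (simp add: profile_term_def power2_diff)
  qed
  also have "\<dots> = sum (profile_term (bump r) tail_equal (f, i) (g, j)) ((\<lambda>l. i + int l) ` {1..r})"
    by (subst sum.reindex) (auto simp: inj_on_def)
  also have "\<dots> \<le> tail_kernel r (f, i) (g, j)"
    unfolding tail_kernel_def
  proof (rule profile_ge)
    show "\<bar>n\<bar> > int (2 * r) \<Longrightarrow> bump r n = 0" for n
      using bump_outside[where n = n and r = r] by (cases "n \<le> 0") auto
  qed (auto simp: bump_nonneg tail_equal_def)
  finally have "(\<Sum>l\<in>{1..r}. (real l)\<^sup>2) / (2 * real r) \<le> tail_kernel r (f, i) (g, j)"
    by (simp add: sum_divide_distrib)
  moreover have "(real r)\<^sup>2 / 6 = real r ^ 3 / 3 / (2 * real r)"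
    using assms(1) by (simp add: power2_eq_square power3_eq_cube)
  moreover have "real r ^ 3 / 3 / (2 * real r) \<le> (\<Sum>l\<in>{1..r}. (real l)\<^sup>2) / (2 * real r)"
    using cube_le_sum_squares[of r] by (intro divide_right_mono) auto
  ultimately show ?thesis by linarith
qed

text \<open>The sum of the distances of the lamps is seen through a tent of height \<open>T\<close> and width \<open>T\<^sup>2\<close>
  (so that its energy stays bounded), with the embedding of \<open>G\<close> truncated at distance \<open>T\<close> by
  the Gaussian: its vectors must be bounded by \<open>T\<close>, because moving the marker changes all weights.\<close>

definition tent :: "nat \<Rightarrow> int \<Rightarrow> real" where
  "tent m n = 2 ^ m * max 0 (1 - \<bar>real_of_int n\<bar> / 4 ^ m)"

definition gauss :: "('a \<Rightarrow> 'a \<Rightarrow> real) \<Rightarrow> nat \<Rightarrow> int \<Rightarrow> (int \<Rightarrow> 'a) \<Rightarrow> (int \<Rightarrow> 'a) \<Rightarrow> real" where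
  "gauss K m k f g = exp (- (1 / 4 ^ m) * K (f k) (g k))"

definition lamp_kernel ::
  "('a \<Rightarrow> 'a \<Rightarrow> real) \<Rightarrow> nat \<Rightarrow> (int \<Rightarrow> 'a) \<times> int \<Rightarrow> (int \<Rightarrow> 'a) \<times> int \<Rightarrow> real" where
  "lamp_kernel K m = profile (4 ^ m) (tent m) (gauss K m)"

lemma tent_nonneg: "tent m n \<ge> 0" by (simp add: tent_def)

lemma tent_outside: "\<bar>n\<bar> > int (4 ^ m) \<Longrightarrow> tent m n = 0"
proof -
  assume "\<bar>n\<bar> > int (4 ^ m)"
  then have "real_of_int \<bar>n\<bar> > real_of_int (int (4 ^ m))" by (simp only: of_int_less_iff)
  then have "\<bar>real_of_int n\<bar> > 4 ^ m" by simp
  then show ?thesis by (simp add: tent_def field_simps max_def)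
qed

lemma four_power: "(4::real) ^ m = 2 ^ m * 2 ^ m"
  by (simp add: power_mult_distrib[symmetric])

lemma tent_slope: "\<bar>tent m n - tent m (n - 1)\<bar> \<le> 1 / 2 ^ m"
proof -
  let ?a = "\<bar>real_of_int n\<bar> / 4 ^ m" and ?b = "\<bar>real_of_int (n - 1)\<bar> / 4 ^ m"
  have "\<bar>?a - ?b\<bar> \<le> 1 / 4 ^ m"
    by (simp add: diff_divide_distrib[symmetric] abs_divide divide_right_mono)
  have "\<bar>max 0 (1 - a) - max 0 (1 - b)\<bar> \<le> \<bar>a - b\<bar>" for a b :: real
    by (simp add: max_def abs_if)
  from order_trans[OF this \<open>\<bar>?a - ?b\<bar> \<le> 1 / 4 ^ m\<close>]
  have "2 ^ m * \<bar>max 0 (1 - ?a) - max 0 (1 - ?b)\<bar> \<le> 2 ^ m * (1 / 4 ^ m)"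
    by (rule mult_left_mono) simp
  then show ?thesis
    by (simp add: tent_def right_diff_distrib[symmetric] abs_mult four_power)
qed

lemma tent_ge: "2 * \<bar>n\<bar> \<le> 4 ^ m \<Longrightarrow> tent m n \<ge> 2 ^ m / 2"
proof -
  assume "2 * \<bar>n\<bar> \<le> 4 ^ m"
  then have "real_of_int (2 * \<bar>n\<bar>) \<le> real_of_int (4 ^ m)" by (simp only: of_int_le_iff)
  then have "1 / 2 \<le> max 0 (1 - \<bar>real_of_int n\<bar> / 4 ^ m)" by (simp add: field_simps max_def)
  then have "2 ^ m * (1 / 2) \<le> 2 ^ m * max 0 (1 - \<bar>real_of_int n\<bar> / 4 ^ m)"
    by (rule mult_left_mono) simp
  then show ?thesis by (simp add: tent_def)
qed

lemma lamp_kernel_move: assumes "\<And>k. K (f k) (f k) = 0" shows "lamp_kernel K m (f, i) (f, i + 1) \<le> 4"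
proof -
  have "lamp_kernel K m (f, i) (f, i + 1) \<le> (2 * real (4 ^ m) + 2) * (1 / 2 ^ m)\<^sup>2"
    unfolding lamp_kernel_def by (rule profile_move_le) (simp_all add: gauss_def assms tent_slope)
  also have "\<dots> = 2 + 2 / 4 ^ m"
    by (simp add: power_divide power2_eq_square four_power[symmetric] add_divide_distrib)
  also have "\<dots> \<le> 4" by (simp add: divide_le_eq)
  finally show ?thesis .
qed

lemma lamp_kernel_switch:
  assumes "\<And>k. K (f k) (f k) = 0" "0 \<le> K (f i) u"
  shows "lamp_kernel K m (f, i) (f(i := u), i) \<le> 2 * K (f i) u"
proof -
  let ?z = "(1 / 4 ^ m) * K (f i) u"
  have "lamp_kernel K m (f, i) (f(i := u), i) \<le> 2 * (tent m 0)\<^sup>2 * \<bar>1 - gauss K m i f (f(i := u))\<bar>"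
    unfolding lamp_kernel_def by (rule profile_switch_le) (simp add: gauss_def assms)
  also have "\<bar>1 - gauss K m i f (f(i := u))\<bar> = 1 - exp (- ?z)"
    using assms(2) by (simp add: gauss_def)
  also have "2 * (tent m 0)\<^sup>2 * (1 - exp (- ?z)) \<le> 2 * (tent m 0)\<^sup>2 * ?z"
    using exp_ge_add_one_self[of "- ?z"] by (intro mult_left_mono) auto
  also have "2 * (tent m 0)\<^sup>2 * ?z = 2 * K (f i) u"
    by (simp add: tent_def power2_eq_square four_power)
  finally show ?thesis .
qed

lemma one_minus_exp_ge: "0 \<le> z \<Longrightarrow> z \<le> 1 \<Longrightarrow> z / 2 \<le> 1 - exp (- z :: real)"
proof -
  assume z: "0 \<le> z" "z \<le> 1"
  have "exp (- z) = 1 / exp z" by (simp add: exp_minus field_simps)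
  also have "\<dots> \<le> 1 / (1 + z)"
    using z exp_ge_add_one_self[of z] by (intro divide_left_mono) auto
  also have "\<dots> \<le> 1 - z / 2"
  proof -
    have "z * z \<le> z * 1" using z by (intro mult_left_mono)
    then have "1 \<le> (1 - z / 2) * (1 + z)" by (simp add: algebra_simps)
    then show ?thesis using z by (simp add: divide_le_eq)
  qed
  finally show ?thesis by simp
qed

lemma lamp_kernel_ge:
  assumes A: "finite A" "\<And>k. k \<in> A \<Longrightarrow> 2 * \<bar>k - i\<bar> \<le> 4 ^ m" "\<And>k. k \<in> A \<Longrightarrow> 2 * \<bar>k - j\<bar> \<le> 4 ^ m"
    and K: "\<And>k. 0 \<le> K (f k) (g k)" "\<And>k. k \<in> A \<Longrightarrow> K (f k) (g k) \<le> 4 ^ m"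
  shows "(\<Sum>k\<in>A. K (f k) (g k)) / 4 \<le> lamp_kernel K m (f, i) (g, j)"
proof -
  have "(\<Sum>k\<in>A. K (f k) (g k) / 4) \<le> (\<Sum>k\<in>A. profile_term (tent m) (gauss K m) (f, i) (g, j) k)"
  proof (rule sum_mono)
    fix k assume k: "k \<in> A"
    let ?z = "(1 / 4 ^ m) * K (f k) (g k)"
    have exp: "?z / 2 \<le> 1 - exp (- ?z)"
      using K k by (intro one_minus_exp_ge) (auto simp: divide_le_eq)
    have tents: "(2 ^ m / 2) * (2 ^ m / 2) \<le> tent m (k - i) * tent m (k - j)"
      using tent_ge[OF A(2)[OF k]] tent_ge[OF A(3)[OF k]] by (intro mult_mono) (auto simp: tent_nonneg)
    have "2 * ((2 ^ m / 2) * (2 ^ m / 2)) * (?z / 2) \<le>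
        2 * (tent m (k - i) * tent m (k - j)) * (1 - exp (- ?z))"
      by (rule mult_mono[OF mult_left_mono[OF tents] exp]) (use K(1) in \<open>auto simp: tent_nonneg\<close>)
    moreover have "2 * ((2 ^ m / 2) * (2 ^ m / 2)) * (?z / 2) = K (f k) (g k) / 4"
      by (simp add: four_power)
    ultimately have "K (f k) (g k) / 4 \<le> 2 * (tent m (k - i) * tent m (k - j)) * (1 - exp (- ?z))"
      by (simp only:)
    then show "K (f k) (g k) / 4 \<le> profile_term (tent m) (gauss K m) (f, i) (g, j) k"
      unfolding profile_term_def gauss_def fst_conv snd_conv mult_minus_left
      using zero_le_power2[of "tent m (k - i) - tent m (k - j)"] by linarith
  qed
  also have "\<dots> \<le> lamp_kernel K m (f, i) (g, j)"
    unfolding lamp_kernel_def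
    using A(1) K(1) by (intro profile_ge tent_outside) (auto simp: tent_nonneg gauss_def)
  finally show ?thesis by (simp add: sum_divide_distrib)
qed

lemma cnd_on_lamp_kernel:
  assumes "countable B" "cnd_on B K" and A: "\<And>x k. x \<in> A \<Longrightarrow> fst x k \<in> B"
  shows "cnd_on A (lamp_kernel K m)"
  unfolding lamp_kernel_def
proof (rule cnd_on_profile)
  show "pd_on A (\<lambda>x y. gauss K m k (fst x) (fst y))" for k
    unfolding gauss_def
    by (rule pd_on_pullback[OF pd_on_exp_neg_cnd[OF assms(1,2)], of "1 / 4 ^ m" A "\<lambda>x. fst x k"])
       (use A in auto)
  show "gauss K m k (fst x) (fst x) = 1" if "x \<in> A" for k x
    using cnd_onD(2)[OF assms(2) A[OF that]] by (simp add: gauss_def)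
qed (rule tent_outside)

section \<open>Compression of the wreath product\<close>

text \<open>The exponent \<open>2 p / (2 p + 1)\<close> balances the two ways in which \<open>x\<close> and \<open>y\<close> can be at
  distance \<open>D\<close>. If some difference lies at distance \<open>D\<^sup>A\<close> of the marker, the tail kernels see it.
  Otherwise at most about \<open>D\<^sup>A\<close> lamps carry distances of total size about \<open>D\<close>, and the sum of the
  \<open>2 p\<close>-th powers is minimal when they are equal.\<close>

definition wreath_exponent :: "real \<Rightarrow> real" where
  "wreath_exponent p = (if p \<ge> 1 / 2 then 2 * p / (2 * p + 1) else p)"

lemma wreath_exponent_bounds: "p \<ge> 0 \<Longrightarrow> 0 \<le> wreath_exponent p" "p \<ge> 0 \<Longrightarrow> wreath_exponent p \<le> 1"
  by (auto simp: wreath_exponent_def divide_le_eq)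

lemma sum_powr_lower:
  fixes d :: "'i \<Rightarrow> real"
  assumes I: "finite I" "real (card I) \<le> 2 * D powr wreath_exponent p"
    and d: "\<And>i. i \<in> I \<Longrightarrow> 0 \<le> d i" "\<And>i. i \<in> I \<Longrightarrow> d i \<le> D" "D / 2 \<le> sum d I"
    and D: "D \<ge> 1" and p: "p \<ge> 0"
  shows "(1 / 8) powr (2 * p) / 4 * D powr (2 * wreath_exponent p) \<le> (\<Sum>i\<in>I. d i powr (2 * p))"
proof (cases "p \<ge> 1 / 2")
  case True
  define A where "A = wreath_exponent p"
  \<comment> \<open>Half of the smallest possible average of the \<open>d i\<close>.\<close>
  define l where "l = D powr (1 - A) / 8"
  have A: "A = 2 * p / (2 * p + 1)" using True by (simp add: A_def wreath_exponent_def)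
  have l: "l > 0" using D by (simp add: l_def)
  have Nl: "2 * D powr A * l = D / 4"
    using D by (simp add: l_def powr_diff)
  have "l powr (2 * p - 1) * (D / 2) - (2 * D powr A) * l powr (2 * p) \<le>
      l powr (2 * p - 1) * sum d I - real (card I) * l powr (2 * p)"
    using d(3) I(2) by (intro diff_mono mult_left_mono mult_right_mono) (auto simp: A_def)
  also have "\<dots> = (\<Sum>i\<in>I. d i * l powr (2 * p - 1) - l powr (2 * p))"
    by (simp add: sum_subtractf sum_distrib_right mult.commute)
  also have "\<dots> \<le> (\<Sum>i\<in>I. d i powr (2 * p))"
    using d(1) l True by (intro sum_mono powr_ge_linear) auto
  finally have 1: "l powr (2 * p - 1) * (D / 2) - (2 * D powr A) * l powr (2 * p) \<le> (\<Sum>i\<in>I. d i powr (2 * p))" .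
  have "(2 * D powr A) * l powr (2 * p) = (2 * D powr A * l) * l powr (2 * p - 1)"
    using l by (simp add: powr_diff)
  then have 2: "l powr (2 * p - 1) * (D / 2) - (2 * D powr A) * l powr (2 * p) = l powr (2 * p - 1) * D / 4"
    unfolding Nl by simp
  have "l powr (2 * p - 1) = D powr ((1 - A) * (2 * p - 1)) * (1 / 8) powr (2 * p - 1)"
    unfolding l_def using powr_mult[of "D powr (1 - A)" "1 / 8" "2 * p - 1"] by (simp add: powr_powr)
  moreover have "D powr ((1 - A) * (2 * p - 1)) * D = D powr (2 * A)"
  proof -
    have "(1 - A) * (2 * p - 1) + 1 = 2 * A" using True by (simp add: A field_simps)
    then show ?thesis using D powr_add[of D "(1 - A) * (2 * p - 1)" 1] by simp
  qed
  ultimately have "l powr (2 * p - 1) * D = (1 / 8) powr (2 * p - 1) * D powr (2 * A)"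
    by (simp add: mult_ac)
  moreover have "(1 / 8) powr (2 * p) \<le> (1 / 8 :: real) powr (2 * p - 1)"
    by (intro powr_mono') auto
  ultimately have "(1 / 8) powr (2 * p) * D powr (2 * A) \<le> l powr (2 * p - 1) * D"
    by (simp add: mult_right_mono)
  then show ?thesis using 1[unfolded 2] by (simp add: A_def)
next
  case False
  have "D powr (2 * p - 1) * d i \<le> d i powr (2 * p)" if "i \<in> I" for i
  proof (cases "d i = 0")
    case di: False
    then have "d i > 0" using d(1)[OF that] by simp
    moreover have "D powr (2 * p - 1) \<le> d i powr (2 * p - 1)"
      using False d(2)[OF that] \<open>d i > 0\<close> by (intro powr_mono2') auto
    ultimately have "D powr (2 * p - 1) * d i \<le> d i powr (2 * p - 1) * d i" by simp
    also have "\<dots> = d i powr (2 * p)" using \<open>d i > 0\<close> by (simp add: powr_diff)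
    finally show ?thesis .
  qed simp
  then have "D powr (2 * p - 1) * sum d I \<le> (\<Sum>i\<in>I. d i powr (2 * p))"
    unfolding sum_distrib_left by (rule sum_mono)
  moreover have "D powr (2 * p - 1) * (D / 2) \<le> D powr (2 * p - 1) * sum d I"
    using d(3) by (intro mult_left_mono) auto
  moreover have "D powr (2 * p - 1) * (D / 2) = 1 / 2 * D powr (2 * p)"
    using D by (simp add: powr_diff)
  moreover have "(1 / 8) powr (2 * p) / 4 * D powr (2 * p) \<le> 1 / 2 * D powr (2 * p)"
  proof (intro mult_right_mono)
    have "(1 / 8 :: real) powr (2 * p) \<le> 1" using p by (intro powr_le1) auto
    then show "(1 / 8) powr (2 * p) / 4 \<le> (1 / 2 :: real)" by simp
  qed simp
  ultimately have "(1 / 8) powr (2 * p) / 4 * D powr (2 * p) \<le> (\<Sum>i\<in>I. d i powr (2 * p))"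
    by linarith
  then show ?thesis using False by (simp add: wreath_exponent_def)
qed

lemma dyadic_floor:
  fixes y :: real
  assumes "y \<ge> 1"
  obtains m :: nat where "2 ^ m \<le> y" "y < 2 * 2 ^ m"
proof -
  define n where "n = (LEAST n. y < 2 ^ n)"
  have ex: "\<exists>n. y < 2 ^ n" using real_arch_pow[of 2 y] by simp
  have n: "y < 2 ^ n" unfolding n_def by (rule LeastI_ex[OF ex])
  obtain m where m: "n = Suc m" using n assms by (cases n) auto
  have "\<not> y < 2 ^ m" using not_less_Least[of m "\<lambda>n. y < 2 ^ n"] m by (simp add: n_def)
  then show ?thesis using n m by (intro that[of m]) auto
qed

definition reflect :: "(int \<Rightarrow> 'a) \<times> int \<Rightarrow> (int \<Rightarrow> 'a) \<times> int" where
  "reflect x = (\<lambda>z. fst x (- z), - snd x)"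

text \<open>Differences to the left of the marker are seen in the mirror image.\<close>

definition far_kernel :: "nat \<Rightarrow> (int \<Rightarrow> 'a) \<times> int \<Rightarrow> (int \<Rightarrow> 'a) \<times> int \<Rightarrow> real" where
  "far_kernel r x y = tail_kernel r x y + tail_kernel r (reflect x) (reflect y)"

lemma cnd_on_far_kernel: "cnd_on A (far_kernel r)"
  unfolding far_kernel_def
  by (intro cnd_on_add cnd_on_tail_kernel cnd_on_pullback[OF cnd_on_tail_kernel[of UNIV]]) simp

lemma tail_kernel_sym: "tail_kernel r x y = tail_kernel r y x"
  and tail_kernel_nonneg: "tail_kernel r x y \<ge> 0"
  by (rule cnd_onD(1)[OF cnd_on_tail_kernel[of UNIV]] cnd_on_nonneg[OF cnd_on_tail_kernel[of UNIV]]; simp)+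

lemma far_kernel_move: assumes "r > 0" shows "far_kernel r (f, i) (f, i + 1) \<le> 8"
proof -
  have "tail_kernel r (reflect (f, i)) (reflect (f, i + 1)) =
      tail_kernel r (\<lambda>z. f (- z), - i - 1) (\<lambda>z. f (- z), - i - 1 + 1)"
    by (subst tail_kernel_sym) (simp add: reflect_def)
  then show ?thesis
    using tail_kernel_move[OF assms, of f i] tail_kernel_move[OF assms, of "\<lambda>z. f (- z)" "- i - 1"]
    by (simp add: far_kernel_def)
qed

lemma far_kernel_switch: "far_kernel r (f, i) (f(i := u), i) \<le> 0"
proof -
  have "reflect (f(i := u), i) = ((\<lambda>z. f (- z))(- i := u), - i)"
    by (auto simp: reflect_def fun_eq_iff)
  then show ?thesis
    using tail_kernel_switch[of r f i u] tail_kernel_switch[of r "\<lambda>z. f (- z)" "- i" u]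
    by (simp add: far_kernel_def reflect_def)
qed

lemma far_kernel_ge:
  assumes "f k \<noteq> g k" "\<rho> > 0" "\<rho> \<le> \<bar>real_of_int (k - i)\<bar>"
  obtains m where "\<rho> / 2 \<le> 2 ^ m" "(2 ^ m)\<^sup>2 / 6 \<le> far_kernel (2 ^ m) (f, i) (g, j)"
proof -
  have "k \<noteq> i" using assms(2,3) by auto
  then have "1 \<le> \<bar>k - i\<bar>" by simp
  then have "real_of_int \<bar>k - i\<bar> \<ge> 1"
    using of_int_le_iff[of 1 "\<bar>k - i\<bar>", where ?'a = real] by simp
  then obtain m :: nat where m: "2 ^ m \<le> real_of_int \<bar>k - i\<bar>" "real_of_int \<bar>k - i\<bar> < 2 * 2 ^ m"
    by (rule dyadic_floor)
  have "real_of_int (int (2 ^ m)) \<le> real_of_int \<bar>k - i\<bar>" using m(1) by simp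
  then have le: "int (2 ^ m) \<le> \<bar>k - i\<bar>" by (simp only: of_int_le_iff)
  have "(real (2 ^ m))\<^sup>2 / 6 \<le> far_kernel (2 ^ m) (f, i) (g, j)"
  proof (cases "k \<ge> i")
    case True
    then have "k \<ge> i + int (2 ^ m)" using le by linarith
    from tail_kernel_ge[where r = "2 ^ m" and f = f and g = g and j = j, OF _ assms(1) this] show ?thesis
      using tail_kernel_nonneg[of "2 ^ m" "reflect (f, i)" "reflect (g, j)"] by (simp add: far_kernel_def)
  next
    case False
    then have "- k \<ge> - i + int (2 ^ m)" using le by linarith
    from tail_kernel_ge[where r = "2 ^ m" and f = "\<lambda>z. f (- z)" and g = "\<lambda>z. g (- z)" and j = "- j",
        OF _ _ this] show ?thesis
      using tail_kernel_nonneg[of "2 ^ m" "(f, i)" "(g, j)"] assms(1) by (simp add: far_kernel_def reflect_def)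
  qed
  then show ?thesis using m(2) assms(3) by (intro that[of m]) auto
qed

context cayley
begin

interpretation W: cayley W wreath_gens by (rule cayley_W)

lemma kernel_edges:
  assumes K: "cnd_on (carrier W) K"
    and move: "\<And>f i. (f, i) \<in> carrier W \<Longrightarrow> K (f, i) (f, i + 1) \<le> C"
    and switch: "\<And>f i u. (f, i) \<in> carrier W \<Longrightarrow> u \<in> S \<Longrightarrow> K (f, i) (f(i := f i \<otimes> u), i) \<le> C"
    and w: "w \<in> carrier W" and s: "s \<in> wreath_gens"
  shows "K w (w \<otimes>\<^bsub>W\<^esub> s) \<le> C"
proof -
  obtain f i where fi: "w = (f, i)" by (cases w)
  have fi': "(f, j) \<in> carrier W" for j using w W_carrier_shift unfolding fi by blast
  from s fi'[of i] show ?thesis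
  proof (cases rule: W_gen_cases)
    case (Lamp u)
    then show ?thesis using switch[OF fi' Lamp(1)] by (simp add: fi)
  next
    case Right
    then show ?thesis using move[OF fi'] by (simp add: fi)
  next
    case Left
    have "K (f, i) (f, i - 1) = K (f, i - 1) (f, i - 1 + 1)"
      using cnd_onD(1)[OF K fi' fi', of i "i - 1"] by simp
    then show ?thesis using Left move[OF fi', of "i - 1"] by (simp add: fi)
  qed
qed

text \<open>If all differences are close to the marker, only a few lamps differ, and their distances add up
  to at least half of \<open>D\<close> because moving the marker accounts for at most \<open>5 * \<rho> \<le> D / 2\<close>.\<close>

lemma lamp_kernel_near:
  assumes upper: "\<And>x y. x \<in> carrier G \<Longrightarrow> y \<in> carrier G \<Longrightarrow> K x y \<le> L\<^sup>2 * (real (word_dist G S x y))\<^sup>2"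
    and lower: "\<And>x y. x \<in> carrier G \<Longrightarrow> y \<in> carrier G \<Longrightarrow>
      c * real (word_dist G S x y) powr (2 * p) \<le> K x y"
    and "c > 0" "p \<ge> 0" "L \<ge> 0"
    and x: "(f, i) \<in> carrier W" and y: "(g, j) \<in> carrier W"
  defines "D \<equiv> real (word_dist W wreath_gens (f, i) (g, j))"
  assumes D: "D \<ge> 1" and m: "2 * D \<le> 2 ^ m" "L * D \<le> 2 ^ m"
    and \<rho>: "\<rho> = D powr wreath_exponent p / 10"
    and near: "\<bar>real_of_int (i - j)\<bar> < \<rho>" "\<And>k. f k \<noteq> g k \<Longrightarrow> \<bar>real_of_int (k - i)\<bar> < \<rho>"
  shows "c * ((1 / 8) powr (2 * p) / 4) / 4 * D powr (2 * wreath_exponent p) \<le> lamp_kernel K m (f, i) (g, j)"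
proof -
  define A where "A = wreath_exponent p"
  define R where "R = nat \<lfloor>\<rho>\<rfloor>"
  have A: "0 \<le> A" "A \<le> 1" using wreath_exponent_bounds assms(4) by (auto simp: A_def)
  have DA: "1 \<le> D powr A" using D A by (intro ge_one_powr_ge_zero)
  have "D powr A \<le> D powr 1" using D A by (intro powr_mono) auto
  then have \<rho>D: "\<rho> \<le> D / 10" using D by (simp add: \<rho> A_def)
  have \<rho>0: "\<rho> > 0" using D by (simp add: \<rho>)
  have R: "real R \<le> \<rho>" using \<rho>0 by (simp add: R_def)
  have small: "\<bar>n\<bar> \<le> int R" if "\<bar>real_of_int n\<bar> < \<rho>" for n
  proof -
    have "real_of_int \<bar>n\<bar> \<le> \<rho>" using that by simp
    then have "\<bar>n\<bar> \<le> \<lfloor>\<rho>\<rfloor>" by (simp only: le_floor_iff)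
    then show ?thesis using \<rho>0 by (simp add: R_def)
  qed
  have f: "f k \<in> carrier G" and g: "g k \<in> carrier G" for k
    using W_carrierD[OF x] W_carrierD[OF y] by auto
  define h where "h z = inv f (z + i) \<otimes> g (z + i)" for z
  have xy: "inv\<^bsub>W\<^esub> (f, i) \<otimes>\<^bsub>W\<^esub> (g, j) = (h, j - i)"
    using W_inv_mult[OF x y] by (simp add: h_def[abs_def])
  have hW: "(h, j - i) \<in> carrier W" unfolding xy[symmetric] using x y by simp
  have D_len: "D = W.len (h, j - i)" by (simp add: D_def word_dist_def xy)
  have len_h: "len (h (k - i)) = word_dist G S (f k) (g k)" for k
    by (simp add: h_def word_dist_def)
  have h1: "f (z + i) \<noteq> g (z + i)" if "h z \<noteq> \<one>" for z
    using that f[of "z + i"] by (auto simp: h_def)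
  let ?Z = "{- int R..int R}"
  have "W.len (h, j - i) \<le> 5 * R + (\<Sum>z\<in>?Z. len (h z))"
  proof (rule len_W_upper[OF hW])
    show "\<bar>j - i\<bar> \<le> int R" using small[of "i - j"] near(1) by (simp add: abs_minus_commute)
    show "\<bar>z\<bar> \<le> int R" if "h z \<noteq> \<one>" for z
      using small[of z] near(2)[OF h1[OF that]] by simp
  qed
  then have "D \<le> real (5 * R + (\<Sum>z\<in>?Z. len (h z)))" unfolding D_len by (simp only: of_nat_le_iff)
  also have "\<dots> = 5 * real R + (\<Sum>z\<in>?Z. real (len (h z)))" by simp
  finally have half: "D / 2 \<le> (\<Sum>z\<in>?Z. real (len (h z)))" using R \<rho>D by linarith
  have each: "real (len (h z)) \<le> D" for z
    unfolding D_len using len_W_lower[OF hW, of "{z}"] by simp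
  have card: "real (card ?Z) \<le> 2 * D powr wreath_exponent p"
    using R DA by (simp add: \<rho> A_def)
  have "(1 / 8) powr (2 * p) / 4 * D powr (2 * A) \<le> (\<Sum>z\<in>?Z. real (len (h z)) powr (2 * p))"
    unfolding A_def by (rule sum_powr_lower) (use half each card D assms(4) in auto)
  also have "\<dots> = (\<Sum>k\<in>(\<lambda>z. z + i) ` ?Z. real (word_dist G S (f k) (g k)) powr (2 * p))"
    by (subst sum.reindex) (auto simp: inj_on_def len_h[symmetric])
  finally have "c * ((1 / 8) powr (2 * p) / 4 * D powr (2 * A)) \<le>
      c * (\<Sum>k\<in>(\<lambda>z. z + i) ` ?Z. real (word_dist G S (f k) (g k)) powr (2 * p))"
    using assms(3) by (intro mult_left_mono) auto
  also have "\<dots> \<le> (\<Sum>k\<in>(\<lambda>z. z + i) ` ?Z. K (f k) (g k))"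
    unfolding sum_distrib_left by (intro sum_mono lower f g)
  finally have "c * ((1 / 8) powr (2 * p) / 4) / 4 * D powr (2 * A) \<le> (\<Sum>k\<in>(\<lambda>z. z + i) ` ?Z. K (f k) (g k)) / 4"
    by (simp add: mult_ac)
  also have "\<dots> \<le> lamp_kernel K m (f, i) (g, j)"
  proof (rule lamp_kernel_ge)
    \<comment> \<open>The lamps in question lie well inside the tent, and no truncation takes place.\<close>
    have "(2 * D) * (2 * D) \<le> 2 ^ m * 2 ^ m" using m(1) D by (intro mult_mono) auto
    then have "4 * (D * D) \<le> 4 ^ m" by (simp add: four_power)
    moreover have "1 * D \<le> D * D" using D by (intro mult_right_mono) auto
    ultimately have D4: "4 * D \<le> 4 ^ m" by linarith
    have in_tent: "2 * \<bar>n\<bar> \<le> 4 ^ m" if "\<bar>n\<bar> \<le> 2 * int R" for n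
    proof -
      have "real_of_int \<bar>n\<bar> \<le> real_of_int (2 * int R)" using that by (simp only: of_int_le_iff)
      then have "real_of_int (2 * \<bar>n\<bar>) \<le> real_of_int (4 ^ m)" using R \<rho>D D4 D by simp
      then show ?thesis by (simp only: of_int_le_iff)
    qed
    have ij: "\<bar>i - j\<bar> \<le> int R" using small near(1) .
    show "2 * \<bar>k - i\<bar> \<le> 4 ^ m" "2 * \<bar>k - j\<bar> \<le> 4 ^ m" if "k \<in> (\<lambda>z. z + i) ` ?Z" for k
      using that ij by (auto intro!: in_tent)
    show "0 \<le> K (f k) (g k)" for k
      using lower[OF f g, of k k] assms(3) by (smt (verit) mult_nonneg_nonneg powr_ge_zero)
    show "K (f k) (g k) \<le> 4 ^ m" for k
    proof -
      have "K (f k) (g k) \<le> (L * real (word_dist G S (f k) (g k)))\<^sup>2"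
        using upper[OF f g, of k k] by (simp add: power_mult_distrib)
      also have "\<dots> \<le> (2 ^ m)\<^sup>2"
      proof (intro power_mono)
        have "L * real (word_dist G S (f k) (g k)) \<le> L * D"
          using each[of "k - i"] assms(5) by (intro mult_left_mono) (auto simp: len_h)
        then show "L * real (word_dist G S (f k) (g k)) \<le> 2 ^ m" using m(2) by simp
      qed (use assms(5) in simp)
      finally show ?thesis by (simp add: power2_eq_square four_power)
    qed
  qed simp
  finally show ?thesis by (simp add: A_def)
qed

text \<open>The kernels of scale \<open>2\<^sup>m\<close> enter with the weight \<open>4\<^bsup>-\<epsilon>m\<^esup>\<close>. This makes the sum over all scales
  finite, and costs at distance \<open>D\<close> at most a factor of order \<open>D\<^bsup>-2\<epsilon>\<^esup>\<close>. The squared displacement of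
  the marker is a kernel of its own.\<close>

theorem wreath_kernel:
  assumes K: "cnd_on (carrier G) K"
    and upper: "\<And>x y. x \<in> carrier G \<Longrightarrow> y \<in> carrier G \<Longrightarrow> K x y \<le> L\<^sup>2 * (real (word_dist G S x y))\<^sup>2"
    and lower: "\<And>x y. x \<in> carrier G \<Longrightarrow> y \<in> carrier G \<Longrightarrow>
      c * real (word_dist G S x y) powr (2 * p) \<le> K x y"
    and c: "c > 0" and p: "p \<ge> 0" and L: "L \<ge> 0" and \<epsilon>: "0 < \<epsilon>" "\<epsilon> \<le> 1"
  obtains K' C b where "cnd_on (carrier W) K'" "C \<ge> 0"
    "\<And>w s. w \<in> carrier W \<Longrightarrow> s \<in> wreath_gens \<Longrightarrow> K' w (w \<otimes>\<^bsub>W\<^esub> s) \<le> C" "b > 0"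
    "\<And>x y. x \<in> carrier W \<Longrightarrow> y \<in> carrier W \<Longrightarrow> x \<noteq> y \<Longrightarrow>
       b * real (word_dist W wreath_gens x y) powr (2 * (wreath_exponent p - \<epsilon>)) \<le> K' x y"
proof -
  define A where "A = wreath_exponent p"
  have A: "0 \<le> A" "A \<le> 1" using wreath_exponent_bounds p by (auto simp: A_def)
  define \<theta> :: real where "\<theta> = 2 powr (- 2 * \<epsilon>)"
  have \<theta>: "0 < \<theta>" "\<theta> < 1" using \<epsilon> by (auto simp: \<theta>_def powr_less_one)
  have \<theta>_pow: "\<theta> ^ m = (2 ^ m) powr (- 2 * \<epsilon>)" for m
    by (simp add: \<theta>_def powr_realpow[symmetric] powr_powr mult_ac)
  define k where "k m x y = lamp_kernel K m x y + far_kernel (2 ^ m) x y" for m x y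
  define C where "C = 12 + 2 * L\<^sup>2"
  have cnd_lamp: "cnd_on (carrier W) (lamp_kernel K m)" for m
    by (rule cnd_on_lamp_kernel[OF countable_carrier K]) (metis W_carrierD prod.collapse)
  have cnd_k: "cnd_on (carrier W) (k m)" for m
    unfolding k_def by (intro cnd_on_add cnd_lamp cnd_on_far_kernel)
  have edge_k: "k m w (w \<otimes>\<^bsub>W\<^esub> s) \<le> C" if "w \<in> carrier W" "s \<in> wreath_gens" for m w s
  proof (rule kernel_edges[OF cnd_k _ _ that])
    fix f i assume W: "(f, i) \<in> carrier W"
    have f: "f z \<in> carrier G" for z using W_carrierD[OF W] .
    have f0: "K (f z) (f z) = 0" for z using cnd_onD(2)[OF K f] .
    show "k m (f, i) (f, i + 1) \<le> C"
      using lamp_kernel_move[where K = K and f = f and m = m and i = i, OF f0]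
        far_kernel_move[of "2 ^ m" f i]
      by (simp add: k_def C_def add_increasing2)
    fix u assume u: "u \<in> S"
    have "K (f i) (f i \<otimes> u) \<le> L\<^sup>2 * (real (len u))\<^sup>2"
      using upper[OF f m_closed[OF f S_carrier[OF u]], of i i] u f by simp
    also have "\<dots> \<le> L\<^sup>2 * 1\<^sup>2" using len_gen[OF u] by (intro mult_left_mono power_mono) auto
    finally have "K (f i) (f i \<otimes> u) \<le> L\<^sup>2" by simp
    moreover have "0 \<le> K (f i) (f i \<otimes> u)" using u f by (intro cnd_on_nonneg[OF K]) auto
    ultimately show "k m (f, i) (f(i := f i \<otimes> u), i) \<le> C"
      using lamp_kernel_switch[where K = K and f = f and m = m and i = i and u = "f i \<otimes> u", OF f0]
        far_kernel_switch[of "2 ^ m" f i "f i \<otimes> u"]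
      by (simp add: k_def C_def)
  qed
  have C: "C \<ge> 0" by (simp add: C_def)
  define Q where "Q x y = suminf (\<lambda>m. \<theta> ^ m * k m x y)" for x y
  have Q: "cnd_on (carrier W) Q"
    "\<And>w s. w \<in> carrier W \<Longrightarrow> s \<in> wreath_gens \<Longrightarrow> Q w (w \<otimes>\<^bsub>W\<^esub> s) \<le> C / (1 - \<theta>)"
    "\<And>m x y. x \<in> carrier W \<Longrightarrow> y \<in> carrier W \<Longrightarrow> \<theta> ^ m * k m x y \<le> Q x y"
    unfolding Q_def using W.cnd_scale_sum[of k C \<theta>, OF cnd_k C edge_k \<theta>] by blast+
  define P :: "(int \<Rightarrow> 'a) \<times> int \<Rightarrow> (int \<Rightarrow> 'a) \<times> int \<Rightarrow> real"
    where "P x y = (real_of_int (snd x) - real_of_int (snd y))\<^sup>2" for x y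
  have P: "cnd_on (carrier W) P" unfolding P_def by (rule cnd_on_square_diff)
  have edge_P: "P w (w \<otimes>\<^bsub>W\<^esub> s) \<le> 1" if "w \<in> carrier W" "s \<in> wreath_gens" for w s
    by (rule kernel_edges[OF P _ _ that]) (simp_all add: P_def)
  have cnd: "cnd_on (carrier W) (\<lambda>x y. P x y + Q x y)" by (rule cnd_on_add[OF P Q(1)])
  define B where "B = max 2 L"
  define b1 where "b1 = (4 * B) powr (- 2 * \<epsilon>) * (c * ((1 / 8) powr (2 * p) / 4) / 4)"
  \<comment> \<open>The constants come from lamps near the marker (\<open>b1\<close>) and from a far difference, where
    \<open>(\<rho> / 2)\<^sup>2 / 6 = D\<^bsup>2A\<^esup> / 2400\<close>.\<close>
  define b where "b = min b1 (1 / 2400)"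
  have B: "B \<ge> 2" "B \<ge> L" by (auto simp: B_def)
  have b1: "b1 > 0" using c B by (simp add: b1_def)
  have b: "b > 0" "b \<le> b1" "b \<le> 1 / 2400" using b1 by (auto simp: b_def)
  show ?thesis
  proof (rule that[OF cnd _ _ b(1)])
    show "0 \<le> 1 + C / (1 - \<theta>)" using C \<theta> by simp
    show "P w (w \<otimes>\<^bsub>W\<^esub> s) + Q w (w \<otimes>\<^bsub>W\<^esub> s) \<le> 1 + C / (1 - \<theta>)"
      if "w \<in> carrier W" "s \<in> wreath_gens" for w s
      using edge_P[OF that] Q(2)[OF that] by simp
    fix x y assume x: "x \<in> carrier W" and y: "y \<in> carrier W" and xy: "x \<noteq> y"
    obtain f i where fi: "x = (f, i)" by (cases x)
    obtain g j where gj: "y = (g, j)" by (cases y)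
    define D where "D = real (word_dist W wreath_gens x y)"
    define \<rho> where "\<rho> = D powr A / 10"
    have D: "D \<ge> 1" using W.dist_eq_0[OF x y] xy by (simp add: D_def)
    have \<rho>: "\<rho> > 0" using D by (simp add: \<rho>_def)
    have nnP: "P x y \<ge> 0" by (simp add: P_def)
    have nnQ: "Q x y \<ge> 0" using cnd_on_nonneg[OF Q(1) x y] .
    have goal_le: "D powr (2 * (A - \<epsilon>)) \<le> D powr (2 * A - 2 * \<epsilon> * A)"
      using D \<epsilon> A by (intro powr_mono) (auto simp: algebra_simps mult_left_le)
    consider (position) "\<bar>real_of_int (i - j)\<bar> \<ge> \<rho>"
      | (far) z where "f z \<noteq> g z" "\<rho> \<le> \<bar>real_of_int (z - i)\<bar>"
      | (near) "\<bar>real_of_int (i - j)\<bar> < \<rho>" "\<And>z. f z \<noteq> g z \<Longrightarrow> \<bar>real_of_int (z - i)\<bar> < \<rho>"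
      by force
    then have "b * D powr (2 * (A - \<epsilon>)) \<le> P x y + Q x y"
    proof cases
      case position
      have "b * D powr (2 * (A - \<epsilon>)) \<le> 1 / 100 * D powr (2 * A)"
      proof (rule mult_mono)
        show "D powr (2 * (A - \<epsilon>)) \<le> D powr (2 * A)" using D \<epsilon> by (intro powr_mono) auto
      qed (use b in auto)
      also have "\<dots> = \<rho>\<^sup>2"
        by (simp add: \<rho>_def power_divide power2_eq_square powr_add[symmetric])
      also have "\<dots> \<le> \<bar>real_of_int (i - j)\<bar>\<^sup>2" using position \<rho> by (intro power_mono) auto
      also have "\<dots> = P x y" by (simp add: P_def fi gj)
      finally show ?thesis using nnQ by simp
    next
      case far
      from far_kernel_ge[where f = f and g = g and j = j, OF far(1) \<rho> far(2)]
      obtain m where m: "\<rho> / 2 \<le> 2 ^ m" "(2 ^ m)\<^sup>2 / 6 \<le> far_kernel (2 ^ m) (f, i) (g, j)" .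
      have "b * D powr (2 * (A - \<epsilon>)) \<le> 1 / 2400 * D powr (2 * A - 2 * \<epsilon> * A)"
        using b goal_le by (intro mult_mono) auto
      also have "\<dots> = 1 / 400 * D powr (A * (2 - 2 * \<epsilon>)) / 6"
        by (simp add: algebra_simps)
      also have "\<dots> \<le> (1 / 20) powr (2 - 2 * \<epsilon>) * D powr (A * (2 - 2 * \<epsilon>)) / 6"
      proof (intro divide_right_mono mult_right_mono)
        have "(1 / 20) powr 2 \<le> (1 / 20 :: real) powr (2 - 2 * \<epsilon>)"
          using \<epsilon> by (intro powr_mono') auto
        then show "1 / 400 \<le> (1 / 20 :: real) powr (2 - 2 * \<epsilon>)" by (simp add: power2_eq_square)
      qed auto
      also have "\<dots> = (\<rho> / 2) powr (2 - 2 * \<epsilon>) / 6"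
        using powr_mult[of "1 / 20" "D powr A" "2 - 2 * \<epsilon>"] by (simp add: \<rho>_def powr_powr)
      also have "\<dots> \<le> (2 ^ m) powr (2 - 2 * \<epsilon>) / 6"
        using m(1) \<rho> \<epsilon> by (intro divide_right_mono powr_mono2) auto
      also have "\<dots> = \<theta> ^ m * ((2 ^ m)\<^sup>2 / 6)"
        unfolding \<theta>_pow by (simp add: powr_diff powr_minus field_simps)
      also have "\<dots> \<le> \<theta> ^ m * k m x y"
        using m(2) cnd_on_nonneg[OF cnd_lamp x y, of m] \<theta>
        by (intro mult_left_mono) (auto simp: k_def fi gj)
      also have "\<dots> \<le> Q x y" by (rule Q(3)[OF x y])
      finally show ?thesis using nnP by simp
    next
      case near
      have "B * D \<ge> 1 * 1" using B D by (intro mult_mono) auto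
      then obtain n :: nat where n: "2 ^ n \<le> B * D" "B * D < 2 * 2 ^ n"
        using dyadic_floor[of "B * D"] by auto
      let ?m = "Suc n"
      have BD: "2 * D \<le> B * D" "L * D \<le> B * D" using B D by (auto intro: mult_right_mono)
      have lamp: "c * ((1 / 8) powr (2 * p) / 4) / 4 * D powr (2 * A) \<le> lamp_kernel K ?m x y"
      proof -
        have Dfg: "real (word_dist W wreath_gens (f, i) (g, j)) = D" by (simp add: D_def fi gj)
        have m: "2 * D \<le> 2 ^ ?m" "L * D \<le> 2 ^ ?m" using BD n(2) by auto
        show ?thesis
          unfolding A_def fi gj
          by (rule lamp_kernel_near[OF upper lower c p L x[unfolded fi] y[unfolded gj], unfolded Dfg,
                where \<rho> = \<rho>])
            (assumption | rule D m near | erule near | simp add: \<rho>_def A_def)+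
      qed
      have "b * D powr (2 * (A - \<epsilon>)) \<le> b1 * D powr (2 * (A - \<epsilon>))"
        using b by (intro mult_right_mono) auto
      also have "\<dots> = (4 * B * D) powr (- 2 * \<epsilon>) * (c * ((1 / 8) powr (2 * p) / 4) / 4 * D powr (2 * A))"
      proof -
        have "(4 * B * D) powr (- 2 * \<epsilon>) = (4 * B) powr (- 2 * \<epsilon>) * D powr (- 2 * \<epsilon>)"
          by (rule powr_mult)
        moreover have "D powr (2 * (A - \<epsilon>)) = D powr (- 2 * \<epsilon>) * D powr (2 * A)"
          by (simp add: powr_add[symmetric] algebra_simps)
        ultimately show ?thesis by (simp only: b1_def mult_ac)
      qed
      also have "\<dots> \<le> (2 ^ ?m) powr (- 2 * \<epsilon>) * (c * ((1 / 8) powr (2 * p) / 4) / 4 * D powr (2 * A))"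
      proof (intro mult_right_mono powr_mono2')
        have "B * D \<ge> 0" using B D by simp
        then show "2 ^ ?m \<le> 4 * B * D" using n(1) by simp
      qed (use c \<epsilon> in auto)
      also have "\<dots> \<le> \<theta> ^ ?m * k ?m x y"
        unfolding \<theta>_pow using lamp cnd_on_nonneg[OF cnd_on_far_kernel[of "carrier W"] x y, of "2 ^ ?m"]
        by (intro mult_left_mono) (auto simp: k_def)
      also have "\<dots> \<le> Q x y" by (rule Q(3)[OF x y])
      finally show ?thesis using nnP by simp
    qed
    then show "b * real (word_dist W wreath_gens x y) powr (2 * (wreath_exponent p - \<epsilon>)) \<le> P x y + Q x y"
      by (simp add: D_def A_def)
  qed
qed

theorem compression_W:
  assumes f: "compresses G S f p" "p \<ge> 0" and q: "0 \<le> q" "q < wreath_exponent p"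
  obtains F where "compresses W wreath_gens F q"
proof -
  obtain K L c where K: "cnd_on (carrier G) K" "L \<ge> 0" "c > 0"
    "\<And>x y. x \<in> carrier G \<Longrightarrow> y \<in> carrier G \<Longrightarrow> K x y \<le> L\<^sup>2 * (real (word_dist G S x y))\<^sup>2"
    "\<And>x y. x \<in> carrier G \<Longrightarrow> y \<in> carrier G \<Longrightarrow> c * real (word_dist G S x y) powr (2 * p) \<le> K x y"
    by (rule kernel_of_compression[OF f(1)], rule that)
  let ?\<epsilon> = "wreath_exponent p - q"
  have \<epsilon>: "0 < ?\<epsilon>" "?\<epsilon> \<le> 1" using q wreath_exponent_bounds[OF f(2)] by auto
  obtain K' C b where K': "cnd_on (carrier W) K'" "C \<ge> 0"
    "\<And>w s. w \<in> carrier W \<Longrightarrow> s \<in> wreath_gens \<Longrightarrow> K' w (w \<otimes>\<^bsub>W\<^esub> s) \<le> C" "b > 0"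
    "\<And>x y. x \<in> carrier W \<Longrightarrow> y \<in> carrier W \<Longrightarrow> x \<noteq> y \<Longrightarrow>
       b * real (word_dist W wreath_gens x y) powr (2 * (wreath_exponent p - ?\<epsilon>)) \<le> K' x y"
    by (rule wreath_kernel[OF K(1,4,5,3) f(2) K(2) \<epsilon>]) (assumption | rule that)+
  have lower: "b * real (word_dist W wreath_gens x y) powr (2 * q) \<le> K' x y"
    if "x \<in> carrier W" "y \<in> carrier W" "x \<noteq> y" for x y
    using K'(5)[OF that] by simp
  show ?thesis
    by (rule W.compression_of_kernel[OF K'(1,2,4) W.cnd_edge_bound[OF K'(1,2,3)] lower])
      (assumption | rule that)+
qed

end

section \<open>Invariance under isomorphism\<close>

locale group_iso = G: group G + H: group H
  for G :: "('a, 'c) monoid_scheme" and H :: "('b, 'd) monoid_scheme" +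
  fixes h
  assumes iso: "h \<in> iso G H" and inf: "infinite (carrier G)"
begin

lemma h_hom: "h \<in> hom G H" and bij: "bij_betw h (carrier G) (carrier H)"
  using iso by (auto simp: iso_def)

sublocale group_hom G H h
  by unfold_locales (rule h_hom)

lemma inj: "inj_on h (carrier G)"
  using bij by (rule bij_betw_imp_inj_on)

lemma img: "h ` carrier G = carrier H"
  using bij by (rule bij_betw_imp_surj_on)

lemma infinite_image: "infinite (carrier H)"
  using inf bij_betw_finite[OF bij] by simp

lemma foldr_image:
  "set ws \<subseteq> carrier G \<Longrightarrow> foldr (mult H) (map h ws) \<one>\<^bsub>H\<^esub> = h (foldr (mult G) ws \<one>\<^bsub>G\<^esub>)
     \<and> foldr (mult G) ws \<one>\<^bsub>G\<^esub> \<in> carrier G"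
  by (induction ws) auto

lemma sym_gen_set_image: assumes "sym_gen_set G S" shows "sym_gen_set H (h ` S)"
proof -
  have S: "finite S" "S \<subseteq> carrier G" "\<forall>s\<in>S. inv\<^bsub>G\<^esub> s \<in> S" "generate G S = carrier G"
    using assms by (auto simp: sym_gen_set_def)
  have "inv\<^bsub>H\<^esub> (h s) \<in> h ` S" if "s \<in> S" for s
    using S that hom_inv[of s] by (metis imageI subsetD)
  moreover have "generate H (h ` S) = carrier H"
    using generate_img[OF S(2)] S(4) img by simp
  ultimately show ?thesis
    using S img by (auto simp: sym_gen_set_def)
qed

lemma word_length_image:
  assumes S: "S \<subseteq> carrier G" and g: "g \<in> carrier G"
  shows "word_length H (h ` S) (h g) = word_length G S g"
proof -
  have "(\<exists>ws. set ws \<subseteq> h ` S \<and> length ws = n \<and> foldr (mult H) ws \<one>\<^bsub>H\<^esub> = h g) \<longleftrightarrow>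
      (\<exists>ws. set ws \<subseteq> S \<and> length ws = n \<and> foldr (mult G) ws \<one>\<^bsub>G\<^esub> = g)" for n
  proof
    assume "\<exists>ws. set ws \<subseteq> h ` S \<and> length ws = n \<and> foldr (mult H) ws \<one>\<^bsub>H\<^esub> = h g"
    then obtain vs where vs: "set vs \<subseteq> h ` S" "length vs = n" "foldr (mult H) vs \<one>\<^bsub>H\<^esub> = h g" by blast
    have "vs \<in> lists (h ` S)" using vs(1) by blast
    then obtain ws where ws: "ws \<in> lists S" "vs = map h ws"
      unfolding lists_image by blast
    have sub: "set ws \<subseteq> S" using ws(1) by blast
    then have "set ws \<subseteq> carrier G" using S by blast
    from foldr_image[OF this] have "foldr (mult G) ws \<one>\<^bsub>G\<^esub> = g"
      using inj g vs(3) ws(2) by (auto dest: inj_onD)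
    then show "\<exists>ws. set ws \<subseteq> S \<and> length ws = n \<and> foldr (mult G) ws \<one>\<^bsub>G\<^esub> = g"
      using sub vs(2) ws(2) by (intro exI[of _ ws]) auto
  next
    assume "\<exists>ws. set ws \<subseteq> S \<and> length ws = n \<and> foldr (mult G) ws \<one>\<^bsub>G\<^esub> = g"
    then obtain ws where ws: "set ws \<subseteq> S" "length ws = n" "foldr (mult G) ws \<one>\<^bsub>G\<^esub> = g" by blast
    then show "\<exists>ws. set ws \<subseteq> h ` S \<and> length ws = n \<and> foldr (mult H) ws \<one>\<^bsub>H\<^esub> = h g"
      using foldr_image[of ws] S by (intro exI[of _ "map h ws"]) auto
  qed
  then show ?thesis unfolding word_length_def by presburger
qed

lemma word_dist_image:
  assumes "S \<subseteq> carrier G" "x \<in> carrier G" "y \<in> carrier G"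
  shows "word_dist H (h ` S) (h x) (h y) = word_dist G S x y"
proof -
  have "inv\<^bsub>H\<^esub> (h x) \<otimes>\<^bsub>H\<^esub> h y = h (inv\<^bsub>G\<^esub> x \<otimes>\<^bsub>G\<^esub> y)" using assms by simp
  moreover have "word_length H (h ` S) (h (inv\<^bsub>G\<^esub> x \<otimes>\<^bsub>G\<^esub> y)) = word_length G S (inv\<^bsub>G\<^esub> x \<otimes>\<^bsub>G\<^esub> y)"
    using assms by (intro word_length_image) auto
  ultimately show ?thesis unfolding word_dist_def by (simp only:)
qed

lemma srw_image:
  assumes "sym_gen_set G S"
  shows "srw H (h ` S) t = map_pmf h (srw G S t)"
proof -
  interpret S: cayley_walk G S
    using assms inf G.group_axioms by (simp add: cayley_walk_def cayley_walk_axioms_def cayley_def cayley_axioms_def)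
  have inj_S: "inj_on h S" using inj S.S_subset by (rule inj_on_subset)
  show ?thesis
  proof (induction t)
    case (Suc t)
    have step: "map_pmf (\<lambda>s. h w \<otimes>\<^bsub>H\<^esub> s) (pmf_of_set (h ` S)) = map_pmf h (map_pmf (\<lambda>s. w \<otimes>\<^bsub>G\<^esub> s) (pmf_of_set S))"
      if "w \<in> carrier G" for w
      unfolding map_pmf_of_set_inj[OF inj_S S.S_nonempty S.S_finite, symmetric] pmf.map_comp
      using that S.S_nonempty by (intro map_pmf_cong refl) auto
    show ?case
      unfolding srw.simps Suc map_bind_pmf bind_map_pmf
      using S.set_srw[of t] by (intro bind_pmf_cong refl step) blast
  qed simp
qed

lemma compresses_image:
  assumes S: "S \<subseteq> carrier G" and f: "compresses G S f \<alpha>"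
  shows "compresses H (h ` S) (\<lambda>x. f (inv_into (carrier G) h x)) \<alpha>"
proof -
  let ?k = "inv_into (carrier G) h"
  have k: "?k x \<in> carrier G" if "x \<in> carrier H" for x
    using that img by (metis inv_into_into)
  have k_inj: "?k x \<noteq> ?k y" if "x \<in> carrier H" "y \<in> carrier H" "x \<noteq> y" for x y
    using that img by (metis f_inv_into_f)
  have "word_dist H (h ` S) x y = word_dist G S (?k x) (?k y)" if "x \<in> carrier H" "y \<in> carrier H" for x y
    using word_dist_image[OF S k[OF that(1)] k[OF that(2)]] that img by (simp add: f_inv_into_f)
  then show ?thesis
    using f k k_inj unfolding compresses_def L2_lipschitz_def by auto
qed

lemma has_speed_image:
  assumes "sym_gen_set G S" "has_speed G S \<beta>"
  shows "has_speed H (h ` S) \<beta>"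
proof -
  interpret S: cayley_walk G S
    using assms(1) inf G.group_axioms by (simp add: cayley_walk_def cayley_walk_axioms_def cayley_def cayley_axioms_def)
  have "measure_pmf.expectation (srw H (h ` S) t) (\<lambda>w. real (word_dist H (h ` S) w \<one>\<^bsub>H\<^esub>)) =
      S.E t (\<lambda>w. real (word_dist G S w \<one>\<^bsub>G\<^esub>))" for t
    unfolding srw_image[OF assms(1)] integral_map_pmf
    using word_dist_image[OF S.S_subset _ G.one_closed] by (intro S.E_cong) simp
  then show ?thesis using assms(2) unfolding has_speed_def by simp
qed

lemma alpha_star_le: "alpha_star G \<le> alpha_star H"
  unfolding alpha_star_Sup
proof (intro Sup_subset_mono image_mono subsetI)
  fix \<alpha> assume "\<alpha> \<in> compression_exponents G"
  then obtain S f where *: "\<alpha> \<ge> 0" "sym_gen_set G S" "compresses G S f \<alpha>"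
    unfolding compression_exponents_def by blast
  moreover have "S \<subseteq> carrier G" using *(2) by (simp add: sym_gen_set_def)
  ultimately show "\<alpha> \<in> compression_exponents H"
    using compresses_image sym_gen_set_image unfolding compression_exponents_def by blast
qed

lemma beta_star_le: "beta_star G \<le> beta_star H"
  unfolding beta_star_Sup
  by (intro Sup_subset_mono image_mono subsetI)
    (use has_speed_image sym_gen_set_image in \<open>auto simp: speed_exponents_def\<close>)

lemma approx_amenable_image:
  assumes "approx_amenable G" shows "approx_amenable H"
  unfolding approx_amenable_def
proof (intro allI impI)
  fix F and \<epsilon> :: real assume F: "finite F" "F \<subseteq> carrier H" "\<epsilon> > 0"
  let ?F = "inv_into (carrier G) h ` F"
  have "?F \<subseteq> carrier G" using F(2) img inv_into_into[of _ h "carrier G"] by blast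
  then obtain m where m: "mean_on (carrier G) m" "almost_invariant G ?F \<epsilon> m"
    using assms F unfolding approx_amenable_def by (metis finite_imageI)
  define r where "r \<phi> = m (\<lambda>x. \<phi> (h x))" for \<phi> :: "'b \<Rightarrow> real"
  have bdd: "bounded ((\<lambda>x. \<phi> (h x)) ` carrier G)" if "bounded (\<phi> ` carrier H)" for \<phi> :: "'b \<Rightarrow> real"
    using that by (simp add: img[symmetric] image_image)
  have "mean_on (carrier H) r"
    unfolding mean_on_def r_def
    using mean_add[OF m(1) bdd bdd] mean_mult[OF m(1) bdd] mean_nonneg[OF m(1) bdd] mean_one[OF m(1)]
    by auto
  moreover have "almost_invariant H F \<epsilon> r"
    unfolding almost_invariant_def
  proof (intro ballI allI impI)
    fix g \<phi> and B :: real assume g: "g \<in> F" and \<phi>: "\<forall>x\<in>carrier H. \<bar>\<phi> x\<bar> \<le> B"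
    let ?g = "inv_into (carrier G) h g"
    have g': "?g \<in> carrier G" "h ?g = g"
      using g F(2) img inv_into_into[of g h "carrier G"] f_inv_into_f[of g h "carrier G"] by blast+
    have "\<bar>m (\<lambda>z. \<phi> (h (z \<otimes>\<^bsub>G\<^esub> ?g))) - m (\<lambda>z. \<phi> (h z))\<bar> \<le> \<epsilon> * B"
      using m(2)[unfolded almost_invariant_def, rule_format, of ?g "\<lambda>z. \<phi> (h z)" B] g \<phi> by auto
    moreover have "m (\<lambda>z. \<phi> (h (z \<otimes>\<^bsub>G\<^esub> ?g))) = m (\<lambda>z. \<phi> (h z \<otimes>\<^bsub>H\<^esub> g))"
      by (rule mean_cong[OF m(1)]) (use g' g F(2) \<phi> in \<open>auto intro!: bounded_imageI[of _ _ B]\<close>)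
    ultimately show "\<bar>r (\<lambda>z. \<phi> (z \<otimes>\<^bsub>H\<^esub> g)) - r \<phi>\<bar> \<le> \<epsilon> * B" by (simp add: r_def)
  qed
  ultimately show "\<exists>m. mean_on (carrier H) m \<and> almost_invariant H F \<epsilon> m" by blast
qed

end

section \<open>The exponents of the wreath product\<close>

lemma cayley_walkI: "group G \<Longrightarrow> sym_gen_set G S \<Longrightarrow> infinite (carrier G) \<Longrightarrow> cayley_walk G S"
  by (simp add: cayley_walk_def cayley_walk_axioms_def cayley_def cayley_axioms_def)

text \<open>The Lipschitz bound is linear in the distance, and distances are unbounded.\<close>

lemma compression_exponent_le_1:
  assumes "group G" "infinite (carrier G)" "\<alpha> \<in> compression_exponents G"
  shows "\<alpha> \<le> 1"
proof (rule ccontr)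
  assume "\<not> \<alpha> \<le> 1"
  then have \<alpha>: "\<alpha> > 1" by simp
  obtain S f where *: "sym_gen_set G S" "compresses G S f \<alpha>"
    using assms(3) unfolding compression_exponents_def by blast
  interpret cayley_walk G S using assms * by (intro cayley_walkI)
  obtain L where L: "L \<ge> 0" "\<And>x y. x \<in> carrier G \<Longrightarrow> y \<in> carrier G \<Longrightarrow>
      L2_norm (\<lambda>t. f x t - f y t) \<le> L * real (word_dist G S x y)"
    using *(2)[unfolded compresses_def, THEN conjunct1] unfolding L2_lipschitz_def by blast
  obtain c where c: "c > 0" "\<And>x y. x \<in> carrier G \<Longrightarrow> y \<in> carrier G \<Longrightarrow> x \<noteq> y \<Longrightarrow>
      c * real (word_dist G S x y) powr \<alpha> \<le> L2_norm (\<lambda>t. f x t - f y t)"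
    using *(2)[unfolded compresses_def, THEN conjunct2] by blast
  define M where "M = L / c + 1"
  have M: "M > 0" "L < c * M" using L(1) c(1) by (auto simp: M_def field_simps add_nonneg_pos)
  obtain n :: nat where n: "M powr (1 / (\<alpha> - 1)) \<le> n" using real_arch_simple by blast
  obtain g where g: "g \<in> carrier G" "len g > n" using len_unbounded .
  let ?d = "real (len g)"
  have d: "?d > 0" using g by simp
  have "M = (M powr (1 / (\<alpha> - 1))) powr (\<alpha> - 1)" using M \<alpha> by (simp add: powr_powr)
  also have "\<dots> \<le> ?d powr (\<alpha> - 1)" using n g \<alpha> by (intro powr_mono2) auto
  finally have "M * ?d \<le> ?d powr (\<alpha> - 1) * ?d" using d by simp
  also have "\<dots> = ?d powr \<alpha>" using d by (simp add: powr_diff)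
  finally have "c * M * ?d \<le> c * ?d powr \<alpha>" using c(1) by simp
  also have "\<dots> \<le> L * ?d"
  proof -
    have "g \<noteq> \<one>\<^bsub>G\<^esub>" using g by auto
    then show ?thesis using c(2)[of "\<one>\<^bsub>G\<^esub>" g] L(2)[of "\<one>\<^bsub>G\<^esub>" g] g by simp
  qed
  finally show False using M(2) d by simp
qed

lemma speed_exponent_bounds:
  assumes "group G" "infinite (carrier G)" "\<beta> \<in> speed_exponents G"
  shows "0 \<le> \<beta>" "\<beta> \<le> 1"
  using assms cayley_walk.speed_exponent_le_1[OF cayley_walkI] by (auto simp: speed_exponents_def)

text \<open>A symmetric generating set of an infinite group has at least two elements, and in each step at
  most one of them leads back to the identity. So the walk is away from the identity with probability at least \<open>1/2\<close>.\<close>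

lemma zero_speed_exponent:
  assumes "group G" "infinite (carrier G)" "sym_gen_set G S"
  shows "0 \<in> speed_exponents G"
proof -
  interpret cayley_walk G S using assms by (intro cayley_walkI)
  have "card S \<noteq> 1"
  proof
    assume "card S = 1"
    then obtain s where s: "S = {s}" by (auto simp: card_1_singleton_iff)
    have inv_s: "inv\<^bsub>G\<^esub> s = s" "s \<in> carrier G" using S_inv[of s] S_carrier[of s] s by auto
    then have ss: "s \<otimes>\<^bsub>G\<^esub> s = \<one>\<^bsub>G\<^esub>" using r_inv[of s] by simp
    have "g \<in> {\<one>\<^bsub>G\<^esub>, s}" if "g \<in> carrier G" for g
      using that by (induction g rule: word_induct) (use s ss inv_s in auto)
    then have "carrier G \<subseteq> {\<one>\<^bsub>G\<^esub>, s}" by blast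
    then show False using infinite_carrier finite_subset by blast
  qed
  then have card: "real (card S) \<ge> 2" using card_S_pos by linarith
  have "1 / 2 * real t powr 0 \<le> E t (\<lambda>w. real (word_dist G S w \<one>\<^bsub>G\<^esub>))" for t
  proof (cases t)
    case (Suc u)
    have "1 / 2 \<le> E u (\<lambda>w. (\<Sum>s\<in>S. real (word_dist G S (w \<otimes>\<^bsub>G\<^esub> s) \<one>\<^bsub>G\<^esub>)) / card S)"
    proof -
      have "1 / 2 \<le> (\<Sum>s\<in>S. real (word_dist G S (w \<otimes>\<^bsub>G\<^esub> s) \<one>\<^bsub>G\<^esub>)) / card S" if w: "w \<in> carrier G" for w
      proof -
        have "real (card S) - 1 \<le> (\<Sum>s\<in>S. 1 - (if s = inv\<^bsub>G\<^esub> w then 1 else 0))"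
          by (simp add: sum_subtractf sum.delta)
        also have "\<dots> \<le> (\<Sum>s\<in>S. real (word_dist G S (w \<otimes>\<^bsub>G\<^esub> s) \<one>\<^bsub>G\<^esub>))"
        proof (rule sum_mono)
          fix s assume s: "s \<in> S"
          have "s = inv\<^bsub>G\<^esub> w" if "w \<otimes>\<^bsub>G\<^esub> s = \<one>\<^bsub>G\<^esub>"
            using inv_equality[of s w] that w s inv_inv by (metis S_carrier inv_equality inv_comm)
          then show "1 - (if s = inv\<^bsub>G\<^esub> w then 1 else 0) \<le> real (word_dist G S (w \<otimes>\<^bsub>G\<^esub> s) \<one>\<^bsub>G\<^esub>)"
            using dist_eq_0[of "w \<otimes>\<^bsub>G\<^esub> s" "\<one>\<^bsub>G\<^esub>"] w s by (cases "w \<otimes>\<^bsub>G\<^esub> s = \<one>\<^bsub>G\<^esub>") auto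
        qed
        finally show ?thesis using card by (simp add: le_divide_eq)
      qed
      then have "E u (\<lambda>_. 1 / 2) \<le> E u (\<lambda>w. (\<Sum>s\<in>S. real (word_dist G S (w \<otimes>\<^bsub>G\<^esub> s) \<one>\<^bsub>G\<^esub>)) / card S)"
        by (intro E_mono)
      then show ?thesis by simp
    qed
    then show ?thesis using Suc E_Suc[of u] by simp
  qed simp
  then show ?thesis
    unfolding speed_exponents_def has_speed_def
    using assms(3) by (intro CollectI conjI exI[of _ S] exI[of _ "1 / 2"]) auto
qed

text \<open>The invariant of the iteration; it contains everything that the next step needs to know about
  the group.\<close>

definition balanced :: "('a, 'b) monoid_scheme \<Rightarrow> real \<Rightarrow> bool" where
  "balanced G a \<longleftrightarrow> group G \<and> infinite (carrier G) \<and> (\<exists>S. sym_gen_set G S) \<and> approx_amenable G \<and>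
     alpha_star G = ereal a \<and> beta_star G = ereal (1 / (2 * a)) \<and> 1 / 2 \<le> a \<and> a \<le> 1"

lemma balanced_iso:
  assumes "balanced G a" "group H" "G \<cong> H"
  shows "balanced H a"
proof -
  have G: "group G" "infinite (carrier G)" using assms(1) by (auto simp: balanced_def)
  obtain h where h: "h \<in> iso G H" using assms(3) by (auto simp: is_iso_def)
  interpret GH: group_iso G H h
    using G assms(2) h by (simp add: group_iso_def group_iso_axioms_def)
  have "H \<cong> G" using group.iso_sym[OF G(1) assms(3)] .
  then obtain k where k: "k \<in> iso H G" by (auto simp: is_iso_def)
  interpret HG: group_iso H G k
    using G assms(2) k GH.infinite_image by (simp add: group_iso_def group_iso_axioms_def)
  have "alpha_star H = alpha_star G" "beta_star H = beta_star G"
    using GH.alpha_star_le HG.alpha_star_le GH.beta_star_le HG.beta_star_le by (auto intro: antisym)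
  then show ?thesis
    using assms(1,2) GH.infinite_image GH.sym_gen_set_image GH.approx_amenable_image
    unfolding balanced_def by metis
qed

text \<open>The lower bounds \<open>A\<close> and \<open>B\<close> of the two exponents satisfy \<open>2 A B = 1\<close>. By the product inequality, an
  exponent above one of them would contradict the exponents that exist just below the other one.\<close>

theorem balanced_wreath_product:
  assumes "balanced G a"
  shows "balanced (wreath_product G integer_group) (2 * a / (2 * a + 1))"
proof -
  let ?W = "wreath_product G integer_group"
  define A where "A = 2 * a / (2 * a + 1)"
  define B where "B = 1 / (2 * A)"
  have G: "group G" "infinite (carrier G)" "approx_amenable G" "alpha_star G = ereal a"
    "beta_star G = ereal (1 / (2 * a))" and a: "1 / 2 \<le> a" "a \<le> 1"
    using assms by (auto simp: balanced_def)
  obtain S where S: "sym_gen_set G S" using assms by (auto simp: balanced_def)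
  interpret S: cayley_walk G S using G S by (intro cayley_walkI)
  have W: "group ?W" "infinite (carrier ?W)" "approx_amenable ?W"
    using S.group_W S.infinite_W S.approx_amenable_W[OF G(3)] by auto
  have W_gen: "sym_gen_set ?W S.wreath_gens" using cayley.gen[OF S.cayley_W] .
  have A: "0 < A" "1 / 2 \<le> A" "A < 1" "A \<le> a"
    using a by (auto simp: A_def field_simps)
  have B: "B = (1 + 1 / (2 * a)) / 2" using a by (simp add: A_def B_def field_simps)
  have bound: "2 * \<alpha> * \<beta> \<le> 1" if "\<alpha> \<in> compression_exponents ?W" "\<beta> \<in> speed_exponents ?W" for \<alpha> \<beta>
    using that compression_times_speed_le[OF W]
    unfolding compression_exponents_def speed_exponents_def by blast
  have compression: "q \<in> compression_exponents ?W" if q: "0 \<le> q" "q < A" for q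
  proof -
    have q1: "q < 1" using q A by simp
    have "q / (2 * (1 - q)) < a"
    proof -
      have "q * (2 * a + 1) < 2 * a" using q a by (simp add: A_def less_divide_eq)
      then show ?thesis using q1 by (simp add: divide_less_eq algebra_simps)
    qed
    then have "ereal (max q (q / (2 * (1 - q)))) < Sup (ereal ` compression_exponents G)"
      using q A G(4) by (simp add: alpha_star_Sup)
    then obtain p where p: "p \<in> compression_exponents G" "max q (q / (2 * (1 - q))) < p"
      by (auto simp: less_Sup_iff)
    have "q < wreath_exponent p"
    proof (cases "p \<ge> 1 / 2")
      case True
      have "q < 2 * p * (1 - q)" using p(2) q1 by (simp add: divide_less_eq mult_ac)
      then have "q < 2 * p / (2 * p + 1)" using True by (simp add: less_divide_eq algebra_simps)
      then show ?thesis using True by (simp add: wreath_exponent_def)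
    qed (use p in \<open>auto simp: wreath_exponent_def\<close>)
    obtain S1 f where 1: "p \<ge> 0" "sym_gen_set G S1" "compresses G S1 f p"
      using p(1) unfolding compression_exponents_def by blast
    interpret S1: cayley_walk G S1 using G 1 by (intro cayley_walkI)
    obtain F where "compresses ?W S1.wreath_gens F q"
      using S1.compression_W[OF 1(3,1) q(1) \<open>q < wreath_exponent p\<close>] .
    then show ?thesis
      unfolding compression_exponents_def using q(1) cayley.gen[OF S1.cayley_W] by blast
  qed
  have speed: "\<exists>\<beta>\<in>speed_exponents ?W. b < \<beta>" if "b < B" for b
  proof -
    have "ereal (2 * b - 1) < Sup (ereal ` speed_exponents G)"
      using that G(5) by (simp add: beta_star_Sup[symmetric] B)
    then obtain \<beta> where \<beta>: "\<beta> \<in> speed_exponents G" "2 * b - 1 < \<beta>"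
      by (auto simp: less_Sup_iff)
    then obtain S2 where 2: "0 \<le> \<beta>" "sym_gen_set G S2" "has_speed G S2 \<beta>"
      unfolding speed_exponents_def by blast
    interpret S2: cayley_walk G S2 using G 2 by (intro cayley_walkI)
    have "(1 + \<beta>) / 2 \<in> speed_exponents ?W"
      using S2.speed_W[OF 2(3,1)] 2(1) cayley.gen[OF S2.cayley_W] unfolding speed_exponents_def by auto
    then show ?thesis using \<beta>(2) by (intro bexI[of _ "(1 + \<beta>) / 2"]) auto
  qed
  have B0: "B > 0" using A by (simp add: B_def)
  have "alpha_star ?W = ereal A"
    unfolding alpha_star_Sup
  proof (rule Sup_eqI)
    fix y assume "y \<in> ereal ` compression_exponents ?W"
    then obtain \<alpha> where \<alpha>: "\<alpha> \<in> compression_exponents ?W" "y = ereal \<alpha>" by blast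
    have "\<alpha> \<le> A"
    proof (rule ccontr)
      assume "\<not> \<alpha> \<le> A"
      then have "1 / (2 * \<alpha>) < B" using A by (simp add: B_def field_simps)
      then obtain \<beta> where "\<beta> \<in> speed_exponents ?W" "1 / (2 * \<alpha>) < \<beta>" using speed by blast
      then show False using bound[OF \<alpha>(1)] \<open>\<not> \<alpha> \<le> A\<close> A by (fastforce simp: divide_less_eq mult_ac)
    qed
    then show "y \<le> ereal A" using \<alpha>(2) by simp
  next
    fix y assume y: "\<And>z. z \<in> ereal ` compression_exponents ?W \<Longrightarrow> z \<le> y"
    have "ereal 0 \<le> y" using y compression[of 0] A by blast
    show "ereal A \<le> y"
    proof (rule ccontr)
      assume "\<not> ereal A \<le> y"
      then obtain r where r: "y = ereal r" "0 \<le> r" "r < A" using \<open>ereal 0 \<le> y\<close> by (cases y) auto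
      then have "(r + A) / 2 \<in> compression_exponents ?W" by (intro compression) auto
      from y[OF imageI[OF this]] r show False by simp
    qed
  qed
  moreover have "beta_star ?W = ereal B"
    unfolding beta_star_Sup
  proof (rule Sup_eqI)
    fix y assume "y \<in> ereal ` speed_exponents ?W"
    then obtain \<beta> where \<beta>: "\<beta> \<in> speed_exponents ?W" "y = ereal \<beta>" by blast
    have "\<beta> \<le> B"
    proof (rule ccontr)
      assume n: "\<not> \<beta> \<le> B"
      then have \<beta>0: "\<beta> > 0" using B0 by simp
      have less: "1 / (2 * \<beta>) < A" using n B0 A \<beta>0 by (simp add: B_def field_simps)
      define \<alpha> where "\<alpha> = (1 / (2 * \<beta>) + A) / 2"
      have "1 / (2 * \<beta>) < \<alpha>" "\<alpha> < A" "0 \<le> \<alpha>" using less \<beta>0 A by (auto simp: \<alpha>_def)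
      then show False using bound[OF compression \<beta>(1), of \<alpha>] \<beta>0 by (simp add: divide_less_eq mult_ac)
    qed
    then show "y \<le> ereal B" using \<beta>(2) by simp
  next
    fix y assume y: "\<And>z. z \<in> ereal ` speed_exponents ?W \<Longrightarrow> z \<le> y"
    show "ereal B \<le> y"
    proof (rule ccontr)
      assume "\<not> ereal B \<le> y"
      then obtain b where b: "y < ereal b" "b < B" by (metis not_le ereal_dense2 ereal_less_eq(3) less_ereal.simps(1))
      then obtain \<beta> where "\<beta> \<in> speed_exponents ?W" "b < \<beta>" using speed by blast
      then have "ereal \<beta> \<le> y" "ereal b < ereal \<beta>" using y by auto
      then show False using b(1) by (metis not_less_iff_gr_or_eq order.strict_trans2)
    qed
  qed
  ultimately show ?thesis
    unfolding balanced_def using W W_gen A by (auto simp: A_def B_def)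
qed

text \<open>Since the speed exponent is nonnegative and the compression exponent at most \<open>1\<close>, the equality
  makes both of them finite: a vanishing speed exponent would force \<open>1 / 0 = \<infinity>\<close> in the extended reals.
  It also gives \<open>a \<ge> 1/2\<close>, because the speed exponent is at most \<open>1\<close>.\<close>

lemma balanced_if_equality:
  assumes "group G" "infinite (carrier G)" "finitely_generated G" "amenable G"
    and eq: "alpha_star G = 1 / (2 * beta_star G)"
  obtains a where "balanced G a"
proof -
  obtain S where S: "sym_gen_set G S" using sym_gen_set_exists[OF assms(1,3)] .
  have \<alpha>1: "alpha_star G \<le> 1"
    unfolding alpha_star_Sup using compression_exponent_le_1[OF assms(1,2)] by (intro Sup_least) (auto simp: one_ereal_def)
  have "beta_star G \<le> 1"
    unfolding beta_star_Sup using speed_exponent_bounds(2)[OF assms(1,2)] by (intro Sup_least) (auto simp: one_ereal_def)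
  moreover have "ereal 0 \<le> beta_star G"
    unfolding beta_star_Sup using zero_speed_exponent[OF assms(1,2) S] by (intro Sup_upper) auto
  ultimately obtain b where b: "beta_star G = ereal b" "0 \<le> b" "b \<le> 1"
    by (cases "beta_star G") auto
  have "b \<noteq> 0"
  proof
    assume "b = 0"
    then have "alpha_star G = \<infinity>" using eq b by (simp add: zero_ereal_def[symmetric])
    then show False using \<alpha>1 by simp
  qed
  then have b0: "b > 0" using b by simp
  have \<alpha>: "alpha_star G = ereal (1 / (2 * b))"
    using eq b(1) b0 by (simp add: one_ereal_def numeral_eq_ereal)
  then have "balanced G (1 / (2 * b))"
    unfolding balanced_def using assms(1,2) S approx_amenable_of_amenable[OF assms(1,4)] \<alpha>1 b b0
    by (auto simp: one_ereal_def field_simps)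
  then show ?thesis by (rule that)
qed

lemma balanced_iterated_wreath:
  assumes "group G" "balanced G a"
  shows "balanced (iterated_wreath G n) (2 ^ n * a / ((2 ^ Suc n - 2) * a + 1))"
proof (induction n)
  case 0
  show ?case
    using balanced_iso[OF assms(2) group_iterated_wreath[OF assms(1)] iterated_wreath_0_iso[OF assms(1)]] by simp
next
  case (Suc n)
  let ?a = "2 ^ n * a / ((2 ^ Suc n - 2) * a + 1)"
  have a: "a > 0" using assms(2) by (simp add: balanced_def)
  have "(2::real) ^ Suc n \<ge> 2" by simp
  then have d: "(2 ^ Suc n - 2) * a + 1 > 0" using a by (intro add_nonneg_pos mult_nonneg_nonneg) auto
  have "2 * ?a / (2 * ?a + 1) = 2 ^ Suc n * a / ((2 ^ Suc (Suc n) - 2) * a + 1)"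
  proof -
    have "2 * (x / d) / (2 * (x / d) + 1) = 2 * x / (2 * x + d)" if "d > 0" for x d :: real
      using that by (simp add: field_simps)
    from this[OF d, of "2 ^ n * a"] show ?thesis by (simp add: algebra_simps)
  qed
  then show ?case
    using balanced_iso[OF balanced_wreath_product[OF Suc] group_iterated_wreath[OF assms(1)]
        iterated_wreath_Suc_iso[OF assms(1)]] by simp
qed

theorem corollary1p3:
  fixes G :: "('a, 'b) monoid_scheme"
  assumes "group G" and "infinite (carrier G)" and "finitely_generated G" and "amenable G"
    and "alpha_star G = 1 / (2 * beta_star G)"
  shows "alpha_star (wreath_product G integer_group)
           = 1 / (2 * beta_star (wreath_product G integer_group))
       \<and> 1 / (2 * beta_star (wreath_product G integer_group))
           = 2 * alpha_star G / (2 * alpha_star G + 1)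
       \<and> (\<forall>k\<ge>1. alpha_star (iterated_wreath G (k - 1))
           = 2 ^ (k - 1) * alpha_star G / ((2 ^ k - 2) * alpha_star G + 1))"
proof -
  obtain a where G: "balanced G a" using balanced_if_equality[OF assms] .
  have a: "a > 0" and \<alpha>: "alpha_star G = ereal a" using G by (auto simp: balanced_def)
  have W: "alpha_star (wreath_product G integer_group) = ereal (2 * a / (2 * a + 1))"
    "beta_star (wreath_product G integer_group) = ereal (1 / (2 * (2 * a / (2 * a + 1))))"
    using balanced_wreath_product[OF G] by (auto simp: balanced_def)
  have two: "2 = ereal 2" by simp
  have "1 / (2 * beta_star (wreath_product G integer_group)) = ereal (2 * a / (2 * a + 1))"
    using a unfolding W(2) two one_ereal_def by (simp add: field_simps)
  moreover have "2 * alpha_star G / (2 * alpha_star G + 1) = ereal (2 * a / (2 * a + 1))"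
    using a unfolding \<alpha> two one_ereal_def by simp
  moreover have "alpha_star (iterated_wreath G (k - 1))
      = 2 ^ (k - 1) * alpha_star G / ((2 ^ k - 2) * alpha_star G + 1)" if k: "k \<ge> 1" for k
  proof -
    obtain n where n: "k = Suc n" using k by (cases k) auto
    have "(2::real) ^ Suc n \<ge> 2" by simp
    then have d: "(2 ^ Suc n - 2) * a + 1 > 0" using a by (intro add_nonneg_pos mult_nonneg_nonneg) auto
    have "alpha_star (iterated_wreath G n) = ereal (2 ^ n * a / ((2 ^ Suc n - 2) * a + 1))"
      using balanced_iterated_wreath[OF assms(1) G] by (simp add: balanced_def)
    also have "\<dots> = 2 ^ n * alpha_star G / ((2 ^ Suc n - 2) * alpha_star G + 1)"
      using d unfolding \<alpha> two one_ereal_def by simp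
    finally show ?thesis by (simp add: n)
  qed
  ultimately show ?thesis using W(1) by simp
qed

end
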